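(* Let $d\ge1$, $T>0$, $0<s<1$, and let $a,b,c\in L^\infty(\mathbb R^d)$ satisfy, for some constants $a_0,b_0,c_0$, \[ a(x)\ge a_0>0,\qquad b(x)\ge b_0>0,\qquad c(x)\ge c_0>0\qquad\text{for a.e. }x\in\mathbb R^d . \] Let $u_0\in H^1(\mathbb R^d)$ and let $u$ be the unique weak solution of \[ u_t-\nabla\cdot(a\nabla u)+(-\Delta)^{s/2}\bigl(b(-\Delta)^{s/2}u\bigr)+cu=0\ \text{ in }(0,T)\times\mathbb R^d,\qquad u(0,\cdot)=u_0 . \] Let $(a_\varepsilon,b_\varepsilon,c_\varepsilon,u_{0,\varepsilon})_{\varepsilon\in(0,1]}$ be regularisations, i.e. nets with $a_\varepsilon,b_\varepsilon,c_\varepsilon\in L^\infty(\mathbb R^d)$ and $u_{0,\varepsilon}\in H^1(\mathbb R^d)$, satisfying \[ a_\varepsilon\to a,\qquad b_\varepsilon\to b,\qquad c_\varepsilon\to c\quad\text{in }L^\infty(\mathbb R^d),\qquad u_{0,\varepsilon}\to u_0\quad\text{in }H^1(\mathbb R^d)\qquad\text{as }\varepsilon\to0 . \] Assume moreover that $a_\varepsilon(x)\ge a_0$, $b_\varepsilon(x)\ge b_0$, $c_\varepsilon(x)\ge c_0$ for a.e. $x\in\mathbb R^d$ and every $\varepsilon\in(0,1]$. Let $u_\varepsilon$ be the unique weak solution of \[ \partial_tu_\varepsilon-\nabla\cdot(a_\varepsilon\nabla u_\varepsilon)+(-\Delta)^{s/2}\bigl(b_\varepsilon(-\Delta)^{s/2}u_\varepsilon\bigr)+c_\varepsilon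 u_\varepsilon=0\ \text{ in }(0,T)\times\mathbb R^d,\qquad u_\varepsilon(0,\cdot)=u_{0,\varepsilon}. \] Then \[ u_\varepsilon\to u\quad\text{in } C([0,T];L^2(\mathbb R^d))\cap L^2(0,T;H^1(\mathbb R^d))\qquad\text{as }\varepsilon\to0 . \]
   Context: Coefficients are real-valued. $(-\Delta)^{s/2}$ is the Fourier multiplier with symbol $|\xi|^s$. Weak solution: for real-valued $\alpha,\beta,\gamma\in L^\infty(\mathbb R^d)$ bounded below by positive constants and $v_0\in H^1(\mathbb R^d)$, a weak solution of $v_t-\nabla\cdot(\alpha\nabla v)+(-\Delta)^{s/2}(\beta(-\Delta)^{s/2}v)+\gamma v=0$ in $(0,T)\times\mathbb R^d$, $v(0)=v_0$, is a function $v\in L^2(0,T;H^1(\mathbb R^d))$ with $v_t\in L^2(0,T;(H^1(\mathbb R^d))')$, $v(0)=v_0$ in $L^2(\mathbb R^d)$ (using the representative in $C([0,T];L^2)$), such that for a.e. $t\in(0,T)$ and all $\varphi\in H^1(\mathbb R^d)$ \[ \langle v_t,\varphi\rangle+\int\alpha\nabla v\cdot\overline{\nabla\varphi}\,dx+\int\beta(-\Delta)^{s/2}v\,\overline{(-\Delta)^{s/2}\varphi}\,dx+\int\gamma v\overline{\varphi}\,dx=0, \] where $\langle\cdot,\cdot\rangle$ is the $(H^1)'$–$H^1$ pairing extending $(f,g)_{L^2}=\int f\overline g\,dx$. Such a weak solution exists and is unique. *)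

theory Defs
  imports "HOL-Analysis.Analysis" "HOL-Probability.Essential_Supremum"
begin

text \<open>
  The space variable ranges over a type of class \<open>euclidean_space\<close>, which stands for R^d with
  d = \<open>DIM('a)\<close>; d is at least 1 for every such type.  Elements of function spaces on R^d are
  represented by Borel functions, equality of classes being equality almost everywhere (every
  Lebesgue class has a Borel representative).  Solutions are complex-valued, coefficients
  real-valued.  Time measurability is with respect to Lebesgue measure on the interval (0,T).
\<close>

definition L2 :: "('a::euclidean_space \<Rightarrow> complex) set" where
  "L2 = {f \<in> borel_measurable lborel. integrable lborel (\<lambda>x. (cmod (f x))\<^sup>2)}"

definition L2_norm :: "('a::euclidean_space \<Rightarrow> complex) \<Rightarrow> real" where
  "L2_norm f = sqrt (\<integral>x. (cmod (f x))\<^sup>2 \<partial>lborel)"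

definition Linf_norm :: "('a::euclidean_space \<Rightarrow> real) \<Rightarrow> ereal" where
  "Linf_norm f = esssup lborel (\<lambda>x. ereal \<bar>f x\<bar>)"

definition Linf :: "('a::euclidean_space \<Rightarrow> real) set" where
  "Linf = {f \<in> borel_measurable lborel. Linf_norm f < \<infinity>}"

fun Ck :: "nat \<Rightarrow> ('a::euclidean_space \<Rightarrow> 'b::real_normed_vector) \<Rightarrow> bool" where
  "Ck 0 f \<longleftrightarrow> continuous_on UNIV f"
| "Ck (Suc k) f \<longleftrightarrow>
     (\<forall>x. f differentiable (at x)) \<and> (\<forall>i\<in>Basis. Ck k (\<lambda>x. frechet_derivative f (at x) i))"

definition test_functions ::
    "'a::euclidean_space set \<Rightarrow> ('a \<Rightarrow> 'b::real_normed_vector) set" where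
  "test_functions \<Omega> =
     {\<phi>. (\<forall>k. Ck k \<phi>) \<and> (\<exists>K. compact K \<and> K \<subseteq> \<Omega> \<and> (\<forall>x. x \<notin> K \<longrightarrow> \<phi> x = 0))}"

definition is_weak_partial ::
    "'a::euclidean_space \<Rightarrow> ('a \<Rightarrow> complex) \<Rightarrow> ('a \<Rightarrow> complex) \<Rightarrow> bool" where
  "is_weak_partial i f g \<longleftrightarrow> g \<in> L2 \<and>
     (\<forall>\<phi>\<in>test_functions UNIV.
        (\<integral>x. f x * frechet_derivative \<phi> (at x) i \<partial>lborel) = - (\<integral>x. g x * \<phi> x \<partial>lborel))"

text \<open>Weak derivatives are unique up to null sets; the choice only picks a representative.\<close>

definition weak_partial :: "'a::euclidean_space \<Rightarrow> ('a \<Rightarrow> complex) \<Rightarrow> 'a \<Rightarrow> complex" where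
  "weak_partial i f = (SOME g. is_weak_partial i f g)"

definition H1 :: "('a::euclidean_space \<Rightarrow> complex) set" where
  "H1 = {f \<in> L2. \<forall>i\<in>Basis. \<exists>g. is_weak_partial i f g}"

definition H1_norm :: "('a::euclidean_space \<Rightarrow> complex) \<Rightarrow> real" where
  "H1_norm f = sqrt ((L2_norm f)\<^sup>2 + (\<Sum>i\<in>Basis. (L2_norm (weak_partial i f))\<^sup>2))"

text \<open>
  The Fourier transform of an L^2 function is the L^2 limit of the Fourier integrals of its
  truncations to balls.  The omitted power of 2 pi does not affect Fourier multipliers.
\<close>

definition is_fourier ::
    "('a::euclidean_space \<Rightarrow> complex) \<Rightarrow> ('a \<Rightarrow> complex) \<Rightarrow> bool" where
  "is_fourier f g \<longleftrightarrow> g \<in> L2 \<and>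
     ((\<lambda>R. L2_norm (\<lambda>\<xi>. (LINT x:cball 0 R|lborel. cis (- (x \<bullet> \<xi>)) * f x) - g \<xi>)) \<longlongrightarrow> 0) at_top"

definition fourier :: "('a::euclidean_space \<Rightarrow> complex) \<Rightarrow> 'a \<Rightarrow> complex" where
  "fourier f = (SOME g. is_fourier f g)"

text \<open>
  The operator \<open>half_lap s\<close> is the Fourier multiplier with symbol |xi|^s, i.e. the power s/2 of
  the negative Laplacian; the result is determined up to null sets.
\<close>

definition half_lap :: "real \<Rightarrow> ('a::euclidean_space \<Rightarrow> complex) \<Rightarrow> 'a \<Rightarrow> complex" where
  "half_lap s f =
     (SOME h. h \<in> L2 \<and>
        (AE \<xi> in lborel. fourier h \<xi> = complex_of_real (norm \<xi> powr s) * fourier f \<xi>))"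

text \<open>
  Functionals are conjugate-linear, since the duality pairing extends the inner product
  \<open>(f, g) \<mapsto> \<integral>x. f x * cnj (g x) \<partial>lborel\<close>.  Only their values on H^1 are relevant, and
  boundedness makes them respect equality almost everywhere.
\<close>

definition H1_dual :: "(('a::euclidean_space \<Rightarrow> complex) \<Rightarrow> complex) set" where
  "H1_dual = {F.
     (\<forall>\<phi>\<in>H1. \<forall>\<psi>\<in>H1. F (\<lambda>x. \<phi> x + \<psi> x) = F \<phi> + F \<psi>) \<and>
     (\<forall>\<phi>\<in>H1. \<forall>k. F (\<lambda>x. k * \<phi> x) = cnj k * F \<phi>) \<and>
     (\<exists>C. \<forall>\<phi>\<in>H1. cmod (F \<phi>) \<le> C * H1_norm \<phi>)}"

definition H1_dual_norm :: "(('a::euclidean_space \<Rightarrow> complex) \<Rightarrow> complex) \<Rightarrow> real" where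
  "H1_dual_norm F = (SUP \<phi>\<in>{\<phi>\<in>H1. H1_norm \<phi> \<le> 1}. cmod (F \<phi>))"

text \<open>
  A normed function space is given by a carrier \<open>X\<close> and a norm \<open>N\<close>.  Strong measurability is in
  the sense of Bochner: almost everywhere limit of simple \<open>X\<close>-valued functions.
\<close>

definition strongly_measurable ::
    "real \<Rightarrow> ('x \<Rightarrow> complex) set \<Rightarrow> (('x \<Rightarrow> complex) \<Rightarrow> real) \<Rightarrow> (real \<Rightarrow> 'x \<Rightarrow> complex) \<Rightarrow> bool" where
  "strongly_measurable T X N v \<longleftrightarrow>
     (\<exists>\<sigma>. (\<forall>n::nat. simple_function (lebesgue_on {0<..<T}) (\<sigma> n) \<and> \<sigma> n ` {0<..<T} \<subseteq> X) \<and>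
          (AE t in lebesgue_on {0<..<T}. (\<lambda>n. N (\<lambda>x. \<sigma> n t x - v t x)) \<longlonglongrightarrow> 0))"

definition bochner_L2 ::
    "real \<Rightarrow> ('x \<Rightarrow> complex) set \<Rightarrow> (('x \<Rightarrow> complex) \<Rightarrow> real) \<Rightarrow> (real \<Rightarrow> 'x \<Rightarrow> complex) set" where
  "bochner_L2 T X N =
     {v. (AE t in lebesgue_on {0<..<T}. v t \<in> X) \<and> strongly_measurable T X N v \<and>
         integrable (lebesgue_on {0<..<T}) (\<lambda>t. (N (v t))\<^sup>2)}"

definition bochner_L2_norm ::
    "real \<Rightarrow> (('x \<Rightarrow> complex) \<Rightarrow> real) \<Rightarrow> (real \<Rightarrow> 'x \<Rightarrow> complex) \<Rightarrow> real" where
  "bochner_L2_norm T N v = sqrt (\<integral>t. (N (v t))\<^sup>2 \<partial>lebesgue_on {0<..<T})"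

definition C_L2 :: "real \<Rightarrow> (real \<Rightarrow> 'a::euclidean_space \<Rightarrow> complex) set" where
  "C_L2 T = {v. \<forall>t\<in>{0..T}. v t \<in> L2 \<and>
     ((\<lambda>\<tau>. L2_norm (\<lambda>x. v \<tau> x - v t x)) \<longlongrightarrow> 0) (at t within {0..T})}"

definition C_L2_norm :: "real \<Rightarrow> (real \<Rightarrow> 'a::euclidean_space \<Rightarrow> complex) \<Rightarrow> real" where
  "C_L2_norm T v = (SUP t\<in>{0..T}. L2_norm (v t))"

text \<open>
  Distributional time derivative with values in the dual of H^1, where an L^2 function acts on
  H^1 through the L^2 inner product; the identity between Bochner integrals in the dual space is
  written out by evaluating both sides at an arbitrary element of H^1.
\<close>

definition is_weak_time_derivative ::
    "real \<Rightarrow> (real \<Rightarrow> 'a::euclidean_space \<Rightarrow> complex) \<Rightarrow> (real \<Rightarrow> ('a \<Rightarrow> complex) \<Rightarrow> complex) \<Rightarrow> bool"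
  where
  "is_weak_time_derivative T v w \<longleftrightarrow>
     (\<forall>\<eta>::real \<Rightarrow> real. \<eta> \<in> test_functions {0<..<T} \<longrightarrow>
        (\<forall>\<phi>\<in>H1.
          (\<integral>t. complex_of_real (vector_derivative \<eta> (at t)) * (\<integral>x. v t x * cnj (\<phi> x) \<partial>lborel)
              \<partial>lebesgue_on {0<..<T})
          = - (\<integral>t. complex_of_real (\<eta> t) * w t \<phi> \<partial>lebesgue_on {0<..<T})))"

text \<open>
  The function \<open>v\<close> is identified with its representative that is continuous on [0,T] with values
  in L^2; thus \<open>v 0\<close> is the initial value.
\<close>

definition weak_solution ::
    "real \<Rightarrow> real \<Rightarrow> ('a::euclidean_space \<Rightarrow> real) \<Rightarrow> ('a \<Rightarrow> real) \<Rightarrow> ('a \<Rightarrow> real) \<Rightarrow>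
     ('a \<Rightarrow> complex) \<Rightarrow> (real \<Rightarrow> 'a \<Rightarrow> complex) \<Rightarrow> bool" where
  "weak_solution T s \<alpha> \<beta> \<gamma> v0 v \<longleftrightarrow>
     v \<in> bochner_L2 T H1 H1_norm \<and>
     v \<in> C_L2 T \<and>
     (AE x in lborel. v 0 x = v0 x) \<and>
     (\<exists>w\<in>bochner_L2 T H1_dual H1_dual_norm.
        is_weak_time_derivative T v w \<and>
        (AE t in lebesgue_on {0<..<T}. \<forall>\<phi>\<in>H1.
           w t \<phi>
           + (\<integral>x. complex_of_real (\<alpha> x) *
                  (\<Sum>i\<in>Basis. weak_partial i (v t) x * cnj (weak_partial i \<phi> x)) \<partial>lborel)
           + (\<integral>x. complex_of_real (\<beta> x) * half_lap s (v t) x * cnj (half_lap s \<phi> x) \<partial>lborel)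
           + (\<integral>x. complex_of_real (\<gamma> x) * v t x * cnj (\<phi> x) \<partial>lborel) = 0))"

end

theory Submission
  imports Defs "HOL-Probability.Characteristic_Functions"
begin

text \<open>
  Test the equation of the difference \<open>z\<close> of the two solutions with \<open>z\<close> itself.  The form of the
  regularised problem is coercive on H1 with constant \<open>k = min a0 c0\<close>, and the difference of the two
  forms at the fixed solution \<open>u\<close> is controlled by the L-infinity distance \<open>\<delta>\<close> of the coefficients, so
  Young's inequality gives

    \<open>\<parallel>z(t)\<parallel>\<^sup>2 + k \<integral>\<^sub>0\<^sup>t \<parallel>z\<parallel>\<^sup>2 \<le> \<parallel>z(0)\<parallel>\<^sup>2 + (d + 2)\<^sup>2 \<delta>\<^sup>2 / k \<integral>\<^sub>0\<^sup>T \<parallel>u\<parallel>\<^sup>2\<close>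

  with L2 norms at \<open>t\<close> and \<open>0\<close> and H1 norms under the integrals.  The fractional operator is only
  meaningful through Plancherel's theorem, which is obtained by Gaussian regularisation.
\<close>

subsection \<open>The space of square integrable functions\<close>

text \<open>Testing with \<open>z\<close> is the step that has to be earned. The weak time
  derivative is a scalar identity for each fixed element of H1, whereas \<open>z\<close> moves with
  time and its derivative lives only in the dual of H1. The way out is to integrate the scalar
  identities over subintervals and to smooth \<open>z\<close> by a projection in frequency: such a
  projection is self-adjoint in L2, contracts H1 and is bounded from L2 to H1. A second obstacle is
  that \<open>weak_partial\<close>, \<open>fourier\<close> and \<open>half_lap\<close> are chosen
  objects, so even their linearity holds only almost everywhere and has to be drawn from a
  uniqueness statement: uniqueness of L2 limits for the transform, injectivity of the transform for
  the other two. This is why H1 is described on the Fourier side. The factor d + 2 counts the terms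
  of the form: d partial derivatives, the fractional term and the term of order zero, each
  controlled by the H1 norms. Coercivity needs only the sign of the fractional term, so k is built
  from the other two lower bounds.\<close>

definition ip :: "('a::euclidean_space \<Rightarrow> complex) \<Rightarrow> ('a \<Rightarrow> complex) \<Rightarrow> complex" where
  "ip f g = (\<integral>x. f x * cnj (g x) \<partial>lborel)"

lemma borel_measurable_cnj[measurable (raw)]:
  "f \<in> borel_measurable M \<Longrightarrow> (\<lambda>x. cnj (f x)) \<in> borel_measurable M"
  by (rule borel_measurable_continuous_on[OF continuous_on_cnj[OF continuous_on_id]])

lemma L2I:
  "f \<in> borel_measurable lborel \<Longrightarrow> integrable lborel (\<lambda>x. (cmod (f x))\<^sup>2) \<Longrightarrow> f \<in> L2"
  by (simp add: L2_def)

lemma L2_measurable[measurable_dest]: "f \<in> L2 \<Longrightarrow> f \<in> borel_measurable borel"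
  by (simp add: L2_def)

lemma L2_integrable_sq: "f \<in> L2 \<Longrightarrow> integrable lborel (\<lambda>x. (cmod (f x))\<^sup>2)"
  by (simp add: L2_def)

lemma L2_bound:
  assumes "f \<in> borel_measurable lborel" "integrable lborel h" "AE x in lborel. (cmod (f x))\<^sup>2 \<le> h x"
  shows "f \<in> L2"
proof (rule L2I)
  show "integrable lborel (\<lambda>x. (cmod (f x))\<^sup>2)"
    by (rule Bochner_Integration.integrable_bound[OF assms(2)]) (use assms in auto)
qed fact

lemma sq_add_le: "((x::real) + y)\<^sup>2 \<le> 2 * x\<^sup>2 + 2 * y\<^sup>2"
  using zero_le_power2[of "x - y"] by (simp add: power2_sum power2_diff)

lemma cmod_add_sq_le: "(cmod (x + y))\<^sup>2 \<le> 2 * (cmod x)\<^sup>2 + 2 * (cmod y)\<^sup>2"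
  by (meson norm_ge_zero norm_triangle_ineq order_trans power_mono sq_add_le)

lemma L2_add: "f \<in> L2 \<Longrightarrow> g \<in> L2 \<Longrightarrow> (\<lambda>x. f x + g x) \<in> L2"
  by (rule L2_bound[where h="\<lambda>x. 2 * (cmod (f x))\<^sup>2 + 2 * (cmod (g x))\<^sup>2"])
     (auto simp: L2_def cmod_add_sq_le)

lemma L2_mult_bounded:
  assumes f: "f \<in> L2" and m: "m \<in> borel_measurable borel" and M: "AE x in lborel. cmod (m x) \<le> C"
  shows "(\<lambda>x. m x * f x) \<in> L2"
proof (rule L2_bound[where h="\<lambda>x. C\<^sup>2 * (cmod (f x))\<^sup>2"])
  show "AE x in lborel. (cmod (m x * f x))\<^sup>2 \<le> C\<^sup>2 * (cmod (f x))\<^sup>2"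
    using M by eventually_elim (simp add: norm_mult power_mult_distrib mult_right_mono power_mono)
qed (use f m in \<open>auto simp: L2_def\<close>)

lemma L2_cmult: "f \<in> L2 \<Longrightarrow> (\<lambda>x. k * f x) \<in> L2"
  by (rule L2_mult_bounded[where C="cmod k"]) auto

lemma L2_uminus: "f \<in> L2 \<Longrightarrow> (\<lambda>x. - f x) \<in> L2"
  using L2_cmult[of f "-1"] by simp

lemma L2_diff: "f \<in> L2 \<Longrightarrow> g \<in> L2 \<Longrightarrow> (\<lambda>x. f x - g x) \<in> L2"
  using L2_add[OF _ L2_uminus, of f g] by simp

lemma L2_cnj: "f \<in> L2 \<Longrightarrow> (\<lambda>x. cnj (f x)) \<in> L2"
  by (auto simp: L2_def)

lemma L2_indicator: 
  assumes "f \<in> L2" "A \<in> sets borel" shows "(\<lambda>x. indicator A x * f x) \<in> L2"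
  by (rule L2_mult_bounded[where C=1]) (use assms in \<open>auto simp: indicator_def\<close>)

lemma L2_AE: "f \<in> L2 \<Longrightarrow> g \<in> borel_measurable borel \<Longrightarrow> AE x in lborel. g x = f x \<Longrightarrow> g \<in> L2"
  by (rule L2_bound[where h="\<lambda>x. (cmod (f x))\<^sup>2"]) (auto simp: L2_def)

lemma L2_norm_nonneg[simp]: "0 \<le> L2_norm f"
  by (simp add: L2_norm_def)

lemma L2_norm_sq: "(L2_norm f)\<^sup>2 = (\<integral>x. (cmod (f x))\<^sup>2 \<partial>lborel)"
  by (simp add: L2_norm_def)

lemma L2_norm_zero[simp]: "L2_norm (\<lambda>x. 0) = 0"
  by (simp add: L2_norm_def)

lemma L2_norm_cong_AE:
  assumes "f \<in> L2" "g \<in> L2" "AE x in lborel. f x = g x"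
  shows "L2_norm f = L2_norm g"
proof -
  have "(\<integral>x. (cmod (f x))\<^sup>2 \<partial>lborel) = (\<integral>x. (cmod (g x))\<^sup>2 \<partial>lborel)"
    by (rule integral_cong_AE) (use assms in \<open>auto simp: L2_def\<close>)
  then show ?thesis by (simp add: L2_norm_def)
qed

lemma L2_norm_mono:
  assumes "f \<in> borel_measurable borel" "g \<in> L2" "AE x in lborel. cmod (f x) \<le> cmod (g x)"
  shows "L2_norm f \<le> L2_norm g"
  unfolding L2_norm_def
proof (intro real_sqrt_le_mono integral_mono_AE)
  show ae: "AE x in lborel. (cmod (f x))\<^sup>2 \<le> (cmod (g x))\<^sup>2"
    using assms(3) by eventually_elim (simp add: power_mono)
  show "integrable lborel (\<lambda>x. (cmod (f x))\<^sup>2)"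
    using L2_bound[OF _ L2_integrable_sq[OF assms(2)] ae] assms(1) by (simp add: L2_def)
qed (use assms in \<open>auto simp: L2_def\<close>)

lemma L2_norm_cmult: "L2_norm (\<lambda>x. k * f x) = cmod k * L2_norm f"
  by (simp add: L2_norm_def norm_mult power_mult_distrib real_sqrt_mult)

lemma L2_norm_uminus: "L2_norm (\<lambda>x. - f x) = L2_norm f"
  by (simp add: L2_norm_def)

lemma L2_norm_minus_commute: "L2_norm (\<lambda>x. f x - g x) = L2_norm (\<lambda>x. g x - f x)"
  by (simp add: L2_norm_def norm_minus_commute)

lemma L2_norm_cnj: "L2_norm (\<lambda>x. cnj (f x)) = L2_norm f"
  by (simp add: L2_norm_def)

lemma L2_norm_eq_0_iff:
  assumes "f \<in> L2" shows "L2_norm f = 0 \<longleftrightarrow> (AE x in lborel. f x = 0)"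
  unfolding L2_norm_def
  using integral_nonneg_eq_0_iff_AE[OF L2_integrable_sq[OF assms]] by simp

lemma L2_mult_integrable:
  assumes "f \<in> L2" "g \<in> L2" shows "integrable lborel (\<lambda>x. f x * g x)"
proof (rule Bochner_Integration.integrable_bound)
  show "integrable lborel (\<lambda>x. (cmod (f x))\<^sup>2 + (cmod (g x))\<^sup>2)"
    using assms by (simp add: L2_def)
  have "2 * (a * b) \<le> a\<^sup>2 + b\<^sup>2" for a b :: real
    using zero_le_power2[of "a - b"] by (simp add: power2_diff)
  then have "cmod a * cmod b \<le> (cmod a)\<^sup>2 + (cmod b)\<^sup>2" for a b
    by (smt (verit) mult_nonneg_nonneg norm_ge_zero)
  then show "AE x in lborel. norm (f x * g x) \<le> norm ((cmod (f x))\<^sup>2 + (cmod (g x))\<^sup>2)"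
    by (simp add: norm_mult)
qed (use assms in \<open>auto simp: L2_def\<close>)

lemma ip_integrable: "f \<in> L2 \<Longrightarrow> g \<in> L2 \<Longrightarrow> integrable lborel (\<lambda>x. f x * cnj (g x))"
  using L2_mult_integrable[OF _ L2_cnj] .

lemma L2_norm_mult_integrable:
  "f \<in> L2 \<Longrightarrow> g \<in> L2 \<Longrightarrow> integrable lborel (\<lambda>x. cmod (f x) * cmod (g x))"
  using integrable_norm[OF L2_mult_integrable] by (simp add: norm_mult)

lemma Cauchy_Schwarz_L2:
  assumes f: "f \<in> L2" and g: "g \<in> L2"
  shows "(\<integral>x. cmod (f x) * cmod (g x) \<partial>lborel) \<le> L2_norm f * L2_norm g"
proof (rule power2_le_imp_le)
  let ?I = "\<integral>x. cmod (f x) * cmod (g x) \<partial>lborel"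
  let ?F = "\<integral>x. (cmod (f x))\<^sup>2 \<partial>lborel" and ?G = "\<integral>x. (cmod (g x))\<^sup>2 \<partial>lborel"
  have [measurable]: "f \<in> borel_measurable borel" "g \<in> borel_measurable borel"
    using f g by (auto simp: L2_def)
  have e1: "(\<integral>\<^sup>+x. ennreal (cmod (f x)) * ennreal (cmod (g x)) \<partial>lborel) = ennreal ?I"
    by (subst nn_integral_eq_integral[symmetric])
       (use f g in \<open>auto simp: ennreal_mult L2_norm_mult_integrable\<close>)
  have e2: "(\<integral>\<^sup>+x. (ennreal (cmod (f x)))\<^sup>2 \<partial>lborel) = ennreal ?F"
    by (subst nn_integral_eq_integral[symmetric])
       (use f in \<open>auto simp: ennreal_power L2_integrable_sq\<close>)
  have e3: "(\<integral>\<^sup>+x. (ennreal (cmod (g x)))\<^sup>2 \<partial>lborel) = ennreal ?G"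
    by (subst nn_integral_eq_integral[symmetric])
       (use g in \<open>auto simp: ennreal_power L2_integrable_sq\<close>)
  have "(ennreal ?I)\<^sup>2 \<le> ennreal ?F * ennreal ?G"
    using Cauchy_Schwarz_nn_integral[of "\<lambda>x. ennreal (cmod (f x))" lborel "\<lambda>x. ennreal (cmod (g x))"]
    by (simp add: e1 e2 e3)
  then have "?I\<^sup>2 \<le> ?F * ?G"
    by (simp add: ennreal_power ennreal_mult[symmetric] integral_nonneg)
  then show "?I\<^sup>2 \<le> (L2_norm f * L2_norm g)\<^sup>2"
    by (simp add: power_mult_distrib L2_norm_sq)
qed simp

lemma L2_mult_le:
  assumes f: "f \<in> L2" and g: "g \<in> L2"
  shows "cmod (\<integral>x. f x * g x \<partial>lborel) \<le> L2_norm f * L2_norm g"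
proof -
  have "cmod (\<integral>x. f x * g x \<partial>lborel) \<le> (\<integral>x. cmod (f x) * cmod (g x) \<partial>lborel)"
    using integral_norm_bound[of lborel "\<lambda>x. f x * g x"] by (simp add: norm_mult)
  then show ?thesis using Cauchy_Schwarz_L2[OF f g] by linarith
qed

lemma ip_le: "f \<in> L2 \<Longrightarrow> g \<in> L2 \<Longrightarrow> cmod (ip f g) \<le> L2_norm f * L2_norm g"
  using L2_mult_le[OF _ L2_cnj] by (simp add: ip_def L2_norm_cnj)

lemma L2_norm_triangle:
  assumes f: "f \<in> L2" and g: "g \<in> L2"
  shows "L2_norm (\<lambda>x. f x + g x) \<le> L2_norm f + L2_norm g"
proof (rule power2_le_imp_le)
  note [simp] = L2_integrable_sq[OF f] L2_integrable_sq[OF g] L2_norm_mult_integrable[OF f g]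
  have "(L2_norm (\<lambda>x. f x + g x))\<^sup>2 
      \<le> (\<integral>x. (cmod (f x))\<^sup>2 + (cmod (g x))\<^sup>2 + 2 * (cmod (f x) * cmod (g x)) \<partial>lborel)"
    unfolding L2_norm_sq
  proof (rule integral_mono)
    show "(cmod (f x + g x))\<^sup>2 \<le> (cmod (f x))\<^sup>2 + (cmod (g x))\<^sup>2 + 2 * (cmod (f x) * cmod (g x))" for x
      using power_mono[OF norm_triangle_ineq[of "f x" "g x"], of 2] by (simp add: power2_sum)
  qed (use L2_add[OF f g] in \<open>auto simp: L2_def\<close>)
  also have "\<dots> = (L2_norm f)\<^sup>2 + (L2_norm g)\<^sup>2 + 2 * (\<integral>x. cmod (f x) * cmod (g x) \<partial>lborel)"
    by (simp add: L2_norm_sq)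
  also have "\<dots> \<le> (L2_norm f + L2_norm g)\<^sup>2"
    using Cauchy_Schwarz_L2[OF f g] by (simp add: power2_sum)
  finally show "(L2_norm (\<lambda>x. f x + g x))\<^sup>2 \<le> (L2_norm f + L2_norm g)\<^sup>2" .
qed simp

lemma L2_norm_triangle_diff:
  "f \<in> L2 \<Longrightarrow> g \<in> L2 \<Longrightarrow> L2_norm (\<lambda>x. f x - g x) \<le> L2_norm f + L2_norm g"
  using L2_norm_triangle[OF _ L2_uminus, of f g] by (simp add: L2_norm_uminus)

lemma L2_norm_triangle3:
  "f \<in> L2 \<Longrightarrow> g \<in> L2 \<Longrightarrow> h \<in> L2 \<Longrightarrow>
     L2_norm (\<lambda>x. f x - g x) \<le> L2_norm (\<lambda>x. f x - h x) + L2_norm (\<lambda>x. h x - g x)"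
  using L2_norm_triangle[OF L2_diff[of f h] L2_diff[of h g]] by simp

lemma L2_norm_diff_ge:
  assumes f: "f \<in> L2" and g: "g \<in> L2"
  shows "\<bar>L2_norm f - L2_norm g\<bar> \<le> L2_norm (\<lambda>x. f x - g x)"
  using L2_norm_triangle[OF L2_diff[OF f g] g] L2_norm_triangle[OF L2_diff[OF g f] f]
  by (simp add: L2_norm_minus_commute[of f g] abs_le_iff)

lemma ip_add_left:
  "f \<in> L2 \<Longrightarrow> g \<in> L2 \<Longrightarrow> h \<in> L2 \<Longrightarrow> ip (\<lambda>x. f x + g x) h = ip f h + ip g h"
  by (simp add: ip_def ring_distribs ip_integrable)

lemma ip_diff_left:
  "f \<in> L2 \<Longrightarrow> g \<in> L2 \<Longrightarrow> h \<in> L2 \<Longrightarrow> ip (\<lambda>x. f x - g x) h = ip f h - ip g h"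
  by (simp add: ip_def ring_distribs ip_integrable)

lemma ip_add_right:
  "f \<in> L2 \<Longrightarrow> g \<in> L2 \<Longrightarrow> h \<in> L2 \<Longrightarrow> ip h (\<lambda>x. f x + g x) = ip h f + ip h g"
  by (simp add: ip_def ring_distribs ip_integrable)

lemma ip_diff_right:
  "f \<in> L2 \<Longrightarrow> g \<in> L2 \<Longrightarrow> h \<in> L2 \<Longrightarrow> ip h (\<lambda>x. f x - g x) = ip h f - ip h g"
  by (simp add: ip_def ring_distribs ip_integrable)

lemma ip_cmult_left: "ip (\<lambda>x. k * f x) g = k * ip f g"
  by (simp add: ip_def mult.assoc)

lemma ip_cmult_right: "ip f (\<lambda>x. k * g x) = cnj k * ip f g"
  by (simp add: ip_def mult.left_commute)

lemma ip_cnj: "cnj (ip f g) = ip g f"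
proof -
  have "cnj (ip f g) = (\<integral>x. cnj (f x * cnj (g x)) \<partial>lborel)"
    unfolding ip_def by (rule Bochner_Integration.integral_cnj[symmetric])
  then show ?thesis by (simp add: ip_def mult.commute)
qed

lemma ip_self: "ip f f = of_real ((L2_norm f)\<^sup>2)"
  unfolding ip_def L2_norm_sq 
  by (subst integral_complex_of_real[symmetric]) (simp only: complex_norm_square)

lemma ip_cong_AE:
  assumes "f \<in> L2" "g \<in> L2" "f' \<in> L2" "g' \<in> L2"
    "AE x in lborel. f x = f' x" "AE x in lborel. g x = g' x"
  shows "ip f g = ip f' g'"
  unfolding ip_def by (rule integral_cong_AE) (use assms in \<open>auto simp: L2_def\<close>)

lemma L2_norm_add_sq:
  assumes f: "f \<in> L2" and g: "g \<in> L2"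
  shows "(L2_norm (\<lambda>x. f x + g x))\<^sup>2 = (L2_norm f)\<^sup>2 + (L2_norm g)\<^sup>2 + 2 * Re (ip f g)"
proof -
  have "complex_of_real ((L2_norm (\<lambda>x. f x + g x))\<^sup>2) = ip f f + ip g g + (ip f g + cnj (ip f g))"
    unfolding ip_self[symmetric] ip_cnj
    using f g by (simp add: ip_add_left ip_add_right L2_add algebra_simps)
  also have "\<dots> = of_real ((L2_norm f)\<^sup>2 + (L2_norm g)\<^sup>2 + 2 * Re (ip f g))"
    by (simp add: ip_self complex_add_cnj)
  finally show ?thesis by (simp only: of_real_eq_iff)
qed

lemma ip_eq_0_imp:
  assumes "f \<in> L2" "\<And>g. g \<in> L2 \<Longrightarrow> ip f g = 0"
  shows "AE x in lborel. f x = 0"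
  using assms(2)[OF assms(1)] L2_norm_eq_0_iff[OF assms(1)] by (simp add: ip_self)

text \<open>The values 1, -1, i and -i of \<open>k\<close> isolate the real and the imaginary part
  of the product. The scale \<open>c\<close> is kept because the transform is unnormalised and
  preserves norms only up to a constant.\<close>

lemma polarization:
  assumes f: "f \<in> L2" and g: "g \<in> L2" and f': "f' \<in> L2" and g': "g' \<in> L2"
    and F: "\<And>k. L2_norm (\<lambda>x. f' x + k * g' x) = c * L2_norm (\<lambda>x. f x + k * g x)"
  shows "ip f' g' = of_real (c\<^sup>2) * ip f g"
proof -
  have n: "(L2_norm (\<lambda>x. f x + k * g x))\<^sup>2 = 
      (L2_norm f)\<^sup>2 + (cmod k)\<^sup>2 * (L2_norm g)\<^sup>2 + 2 * Re (cnj k * ip f g)"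
    if "f \<in> L2" "g \<in> L2" for f g :: "'x::euclidean_space \<Rightarrow> complex" and k
    using L2_norm_add_sq[OF that(1) L2_cmult[OF that(2)], of k]
    by (simp add: L2_norm_cmult power_mult_distrib ip_cmult_right)
  have F': "(L2_norm f')\<^sup>2 + (cmod k)\<^sup>2 * (L2_norm g')\<^sup>2 + 2 * Re (cnj k * ip f' g')
    = c\<^sup>2 * ((L2_norm f)\<^sup>2 + (cmod k)\<^sup>2 * (L2_norm g)\<^sup>2 + 2 * Re (cnj k * ip f g))" for k
    using arg_cong[OF F[of k], of power2] n[OF f g, of k] n[OF f' g', of k] 
    by (simp add: power_mult_distrib)
  have 1: "Re (ip f' g') = c\<^sup>2 * Re (ip f g)"
    using F'[of 1] F'[of "-1"] by (simp add: algebra_simps)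
  have 2: "Im (ip f' g') = c\<^sup>2 * Im (ip f g)"
    using F'[of \<i>] F'[of "-\<i>"] by (simp add: algebra_simps)
  show ?thesis by (rule complex_eqI) (simp_all add: 1 2)
qed

section \<open>Completeness of L2\<close>

lemma L2_Fatou:
  assumes F: "\<And>n. F n \<in> L2" and g[measurable]: "g \<in> borel_measurable borel"
    and lim: "AE x in lborel. (\<lambda>n. F n x) \<longlonglongrightarrow> g x"
    and bd: "\<And>n. L2_norm (F n) \<le> C" and C: "0 \<le> C"
  shows "g \<in> L2" and "L2_norm g \<le> C"
proof -
  have [measurable]: "F n \<in> borel_measurable borel" for n using F by (rule L2_measurable)
  have "(\<integral>\<^sup>+x. ennreal ((cmod (g x))\<^sup>2) \<partial>lborel) = 
        (\<integral>\<^sup>+x. liminf (\<lambda>n. ennreal ((cmod (F n x))\<^sup>2)) \<partial>lborel)"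
  proof (rule nn_integral_cong_AE)
    show "AE x in lborel. ennreal ((cmod (g x))\<^sup>2) = liminf (\<lambda>n. ennreal ((cmod (F n x))\<^sup>2))"
      using lim
    proof eventually_elim
      case (elim x)
      have "(\<lambda>n. ennreal ((cmod (F n x))\<^sup>2)) \<longlonglongrightarrow> ennreal ((cmod (g x))\<^sup>2)"
        by (intro tendsto_intros tendsto_ennrealI elim)
      then show ?case
        using lim_imp_Liminf[OF sequentially_bot] by metis
    qed
  qed
  also have "\<dots> \<le> liminf (\<lambda>n. \<integral>\<^sup>+x. ennreal ((cmod (F n x))\<^sup>2) \<partial>lborel)"
    by (rule nn_integral_liminf) simp
  also have "\<dots> = liminf (\<lambda>n. ennreal ((L2_norm (F n))\<^sup>2))"
    using F by (simp add: L2_norm_sq nn_integral_eq_integral L2_integrable_sq)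
  also have "\<dots> \<le> liminf (\<lambda>n. ennreal (C\<^sup>2))"
    by (intro Liminf_mono always_eventually allI ennreal_leI power_mono bd) simp
  also have "\<dots> = ennreal (C\<^sup>2)"
    by (rule lim_imp_Liminf) auto
  finally have le: "(\<integral>\<^sup>+x. ennreal ((cmod (g x))\<^sup>2) \<partial>lborel) \<le> ennreal (C\<^sup>2)" .
  then have "(\<integral>\<^sup>+x. ennreal ((cmod (g x))\<^sup>2) \<partial>lborel) < \<infinity>"
    using le_less_trans ennreal_less_top by (metis infinity_ennreal_def)
  then have i: "integrable lborel (\<lambda>x. (cmod (g x))\<^sup>2)"
    by (intro integrableI_nonneg) auto
  then show "g \<in> L2" by (intro L2I) auto
  have "ennreal (\<integral>x. (cmod (g x))\<^sup>2 \<partial>lborel) \<le> ennreal (C\<^sup>2)"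
    using le nn_integral_eq_integral[OF i] by simp
  then have "(L2_norm g)\<^sup>2 \<le> C\<^sup>2"
    by (simp add: L2_norm_sq)
  then show "L2_norm g \<le> C" using C power2_le_imp_le by blast
qed

text \<open>The squared increments have integral at most 4^(-n), so after weighting by 2^n their sum
  still has finite integral and is finite almost everywhere. There the increments are O(2^(-n/2))
  and their series converges absolutely.\<close>

lemma L2_geometric_Cauchy:
  assumes F: "\<And>n. F n \<in> L2" and d: "\<And>n. L2_norm (\<lambda>x. F (Suc n) x - F n x) \<le> (1/2)^n"
  shows "AE x in lborel. Cauchy (\<lambda>n. F n x)"
proof -
  have [measurable]: "F n \<in> borel_measurable borel" for n using F by (rule L2_measurable)
  define D where "D n x = (cmod (F (Suc n) x - F n x))\<^sup>2" for n x
  have [measurable]: "D n \<in> borel_measurable borel" for n unfolding D_def by measurable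
  have D: "(\<integral>\<^sup>+x. ennreal (2^n * D n x) \<partial>lborel) \<le> ennreal ((1/2)^n)" for n
  proof -
    have "(\<integral>\<^sup>+x. ennreal (2^n * D n x) \<partial>lborel) = ennreal (\<integral>x. 2^n * D n x \<partial>lborel)"
      unfolding D_def by (rule nn_integral_eq_integral) (use L2_integrable_sq[OF L2_diff[OF F F]] in auto)
    also have "(\<integral>x. 2^n * D n x \<partial>lborel) = 2^n * (L2_norm (\<lambda>x. F (Suc n) x - F n x))\<^sup>2"
      by (simp add: D_def L2_norm_sq)
    also have "\<dots> \<le> 2^n * ((1/2)^n)\<^sup>2"
      by (intro mult_left_mono power_mono d) auto
    also have "\<dots> = (1/2)^n"
      by (simp add: power2_eq_square power_divide)
    finally show ?thesis by (simp add: ennreal_leI)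
  qed
  have "(\<integral>\<^sup>+x. (\<Sum>n. ennreal (2^n * D n x)) \<partial>lborel) = (\<Sum>n. \<integral>\<^sup>+x. ennreal (2^n * D n x) \<partial>lborel)"
    by (rule nn_integral_suminf) simp
  also have "\<dots> \<le> (\<Sum>n. ennreal ((1/2)^n))"
    by (intro suminf_le D) auto
  also have "\<dots> = ennreal (\<Sum>n. (1/2)^n)"
    by (rule suminf_ennreal2) auto
  also have "\<dots> < \<infinity>" by simp
  finally have "AE x in lborel. (\<Sum>n. ennreal (2^n * D n x)) \<noteq> \<infinity>"
    by (intro nn_integral_noteq_infinite) auto
  then show ?thesis
  proof eventually_elim
    case (elim x)
    have "summable (\<lambda>n. 2^n * D n x)"
      by (rule summable_suminf_not_top) (use elim in \<open>auto simp: D_def\<close>)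
    then have "Bseq (\<lambda>n. 2^n * D n x)"
      using summable_LIMSEQ_zero convergent_imp_Bseq convergentI by blast
    then obtain C where C: "C > 0" "\<And>n. norm (2^n * D n x) \<le> C" by (auto simp: Bseq_def)
    have le: "norm (F (Suc n) x - F n x) \<le> sqrt C * (sqrt (1/2))^n" for n
    proof (rule power2_le_imp_le)
      have sq: "((sqrt (1/2))^n)\<^sup>2 = (1/2::real)^n"
        by (simp only: power_mult[symmetric] mult.commute[of n]) (simp add: power_mult)
      have "D n x \<le> C * (1/2)^n" using C(2)[of n] by (simp add: D_def field_simps power_divide)
      then show "(norm (F (Suc n) x - F n x))\<^sup>2 \<le> (sqrt C * (sqrt (1/2))^n)\<^sup>2"
        using C(1) by (simp only: D_def power_mult_distrib sq real_sqrt_pow2)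
    qed (use C(1) in auto)
    have "summable (\<lambda>n. F (Suc n) x - F n x)"
    proof (rule summable_comparison_test'[where N=0])
      show "summable (\<lambda>n. sqrt C * (sqrt (1/2))^n)"
        by (intro summable_mult summable_geometric) (simp add: real_sqrt_lt_1_iff)
    qed (use le in auto)
    then have "convergent (\<lambda>n. (\<Sum>i<n. F (Suc i) x - F i x))"
      by (simp add: summable_iff_convergent)
    then have "convergent (\<lambda>n. F n x - F 0 x)"
      by (simp only: sum_lessThan_telescope[of "\<lambda>i. F i x"])
    then have "convergent (\<lambda>n. F n x)"
      using convergent_add[OF _ convergent_const[of "F 0 x"]] by force
    then show ?case by (rule convergent_Cauchy)
  qed
qed

theorem Riesz_Fischer:
  assumes F: "\<And>n::nat. F n \<in> L2"
    and C: "\<And>e. e > 0 \<Longrightarrow> \<exists>N. \<forall>m\<ge>N. \<forall>n\<ge>N. L2_norm (\<lambda>x. F m x - F n x) < e"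
  obtains g where "g \<in> L2" "(\<lambda>n. L2_norm (\<lambda>x. F n x - g x)) \<longlonglongrightarrow> 0"
proof -
  have [measurable]: "F n \<in> borel_measurable borel" for n using F by (rule L2_measurable)
  have "\<forall>k. \<exists>N. \<forall>m\<ge>N. \<forall>n\<ge>N. L2_norm (\<lambda>x. F m x - F n x) < (1/2)^k"
    using C by simp
  then obtain N where N: "\<And>k m n. m \<ge> N k \<Longrightarrow> n \<ge> N k \<Longrightarrow> L2_norm (\<lambda>x. F m x - F n x) < (1/2)^k"
    by metis
  \<comment> \<open>Summing the thresholds gives a monotone index sequence that still dominates each
    of them.\<close>
  define r where "r k = (\<Sum>i\<le>k. N i) + k" for k
  have r: "r k \<ge> N k" "r k \<ge> k" "r k \<le> r (Suc k)" for k
  proof -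
    show "r k \<ge> N k" unfolding r_def using member_le_sum[of k "{..k}" N] by simp
  qed (auto simp: r_def)
  have AEC: "AE x in lborel. Cauchy (\<lambda>k. F (r k) x)"
  proof (rule L2_geometric_Cauchy[OF F])
    show "L2_norm (\<lambda>x. F (r (Suc n)) x - F (r n) x) \<le> (1/2)^n" for n
      using N[of n "r (Suc n)" "r n"] r[of n] by simp
  qed
  define g where "g x = lim (\<lambda>k. F (r k) x)" for x
  have [measurable]: "g \<in> borel_measurable borel" unfolding g_def by measurable
  have lim: "AE x in lborel. (\<lambda>k. F (r k) x) \<longlonglongrightarrow> g x"
    using AEC by eventually_elim (simp add: g_def Cauchy_convergent_iff convergent_LIMSEQ_iff)
  \<comment> \<open>With \<open>m\<close> fixed, Fatou along the subsequence turns the Cauchy bound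
    into a distance to \<open>g\<close>. This controls the whole sequence, not only the subsequence
    that defines \<open>g\<close>.\<close>
  have A: "(\<lambda>x. F m x - g x) \<in> L2 \<and> L2_norm (\<lambda>x. F m x - g x) \<le> (1/2)^k" if m: "m \<ge> N k" for m k
  proof -
    have "\<And>n. L2_norm (\<lambda>x. F m x - F (r (n + k)) x) \<le> (1/2)^k"
    proof -
      fix n
      have "mono r" using r(3) by (simp add: mono_iff_le_Suc)
      then have "r (n + k) \<ge> N k" using r(1)[of k] monoD[of r k "n + k"] by simp
      then show "L2_norm (\<lambda>x. F m x - F (r (n + k)) x) \<le> (1/2)^k"
        using N[OF m] by (simp add: less_imp_le)
    qed
    moreover have "AE x in lborel. (\<lambda>n. F m x - F (r (n + k)) x) \<longlonglongrightarrow> F m x - g x"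
      using lim by eventually_elim (intro tendsto_intros LIMSEQ_ignore_initial_segment)
    ultimately show ?thesis
      using L2_Fatou[of "\<lambda>n x. F m x - F (r (n + k)) x" "\<lambda>x. F m x - g x" "(1/2)^k"] L2_diff[OF F F] by auto
  qed
  show ?thesis
  proof
    show "g \<in> L2"
      using L2_diff[OF F conjunct1[OF A[OF order_refl, of 0]], of "N 0"] by simp
    show "(\<lambda>n. L2_norm (\<lambda>x. F n x - g x)) \<longlonglongrightarrow> 0"
    proof (rule LIMSEQ_I)
      fix e :: real assume "e > 0"
      then obtain k where k: "(1/2::real)^k < e" using real_arch_pow_inv[of e "1/2"] by auto
      show "\<exists>no. \<forall>n\<ge>no. norm (L2_norm (\<lambda>x. F n x - g x) - 0) < e"
        using A[of k] k by (intro exI[of _ "N k"]) fastforce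
    qed
  qed
qed

subsection \<open>The Fourier integral and Plancherel's identity\<close>

lemma lborel_integrable_affine:
  fixes f :: "'a::euclidean_space \<Rightarrow> 'b::{banach, second_countable_topology}"
  assumes c: "c \<noteq> 0" and f: "integrable lborel f"
  shows "integrable lborel (\<lambda>x. f (t + c *\<^sub>R x))"
proof -
  have [measurable]: "f \<in> borel_measurable borel" using f by auto
  have "integrable (density (distr lborel borel (\<lambda>x. t + c *\<^sub>R x)) (\<lambda>_. ennreal (\<bar>c\<bar>^DIM('a)))) f"
    using f lborel_affine[OF c, of t] by (simp add: ennreal_power)
  then show ?thesis
    using c integrable_scaleR_right[of "inverse (\<bar>c\<bar>^DIM('a))" lborel "\<lambda>x. \<bar>c\<bar>^DIM('a) *\<^sub>R f (t + c *\<^sub>R x)"]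
    by (subst (asm) integrable_density) (auto simp: integrable_distr_eq)
qed

lemma lborel_integral_affine:
  fixes f :: "'a::euclidean_space \<Rightarrow> 'b::{banach, second_countable_topology}"
  assumes c: "c \<noteq> 0" and [measurable]: "f \<in> borel_measurable borel"
  shows "(\<integral>x. f x \<partial>lborel) = \<bar>c\<bar>^DIM('a) *\<^sub>R (\<integral>x. f (t + c *\<^sub>R x) \<partial>lborel)"
proof -
  have "(\<integral>x. f x \<partial>lborel) = 
    (\<integral>x. f x \<partial>density (distr lborel borel (\<lambda>x. t + c *\<^sub>R x)) (\<lambda>_. ennreal (\<bar>c\<bar>^DIM('a))))"
    using lborel_affine[OF c, of t] by (simp add: ennreal_power)
  also have "\<dots> = \<bar>c\<bar>^DIM('a) *\<^sub>R (\<integral>x. f (t + c *\<^sub>R x) \<partial>lborel)"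
    using c by (subst integral_density) (auto simp: integral_distr)
  finally show ?thesis .
qed

lemma lborel_integral_translate:
  fixes f :: "'a::euclidean_space \<Rightarrow> 'b::{banach, second_countable_topology}"
  assumes "f \<in> borel_measurable borel"
  shows "(\<integral>x. f (x + t) \<partial>lborel) = (\<integral>x. f x \<partial>lborel)"
  using lborel_integral_affine[of 1 f t] assms by (simp add: add.commute)

lemma lborel_integral_reflect:
  fixes f :: "'a::euclidean_space \<Rightarrow> 'b::{banach, second_countable_topology}"
  assumes "f \<in> borel_measurable borel"
  shows "(\<integral>x. f (t - x) \<partial>lborel) = (\<integral>x. f x \<partial>lborel)"
  using lborel_integral_affine[of "-1" f t] assms by simp

definition ft :: "('a::euclidean_space \<Rightarrow> complex) \<Rightarrow> 'a \<Rightarrow> complex" where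
  "ft f \<xi> = (\<integral>x. cis (- (x \<bullet> \<xi>)) * f x \<partial>lborel)"

lemma borel_measurable_cis[measurable (raw)]:
  "f \<in> borel_measurable M \<Longrightarrow> (\<lambda>x. cis (f x)) \<in> borel_measurable M"
  by (simp add: cis_conv_exp)

lemma integrable_cis_mult:
  fixes f :: "'a::euclidean_space \<Rightarrow> complex"
  assumes "integrable lborel f" "h \<in> borel_measurable borel"
  shows "integrable lborel (\<lambda>x. cis (h x) * f x)"
  by (rule Bochner_Integration.integrable_bound[OF assms(1)]) (use assms in \<open>auto simp: norm_mult\<close>)

lemma borel_measurable_ft[measurable]:
  assumes [measurable]: "f \<in> borel_measurable borel" shows "ft f \<in> borel_measurable borel"
proof -
  have "(\<lambda>\<xi>. \<integral>x. cis (- (x \<bullet> \<xi>)) * f x \<partial>lborel) \<in> borel_measurable borel" by measurable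
  then show ?thesis by (simp add: ft_def[abs_def])
qed

lemma ft_le: "cmod (ft f \<xi>) \<le> (\<integral>x. cmod (f x) \<partial>lborel)"
  unfolding ft_def using integral_norm_bound[of lborel "\<lambda>x. cis (- (x \<bullet> \<xi>)) * f x"] 
  by (simp add: norm_mult)

lemma ft_diff:
  assumes "integrable lborel f" "integrable lborel g"
  shows "ft (\<lambda>x. f x - g x) \<xi> = ft f \<xi> - ft g \<xi>"
  unfolding ft_def using assms by (simp add: right_diff_distrib integrable_cis_mult)

lemma ft_add:
  assumes "integrable lborel f" "integrable lborel g"
  shows "ft (\<lambda>x. f x + g x) \<xi> = ft f \<xi> + ft g \<xi>"
  unfolding ft_def using assms by (simp add: distrib_left integrable_cis_mult)

lemma ft_cmult: "ft (\<lambda>x. k * f x) \<xi> = k * ft f \<xi>"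
  unfolding ft_def by (simp add: mult.left_commute)

text \<open>Fubini for a kernel symmetric in the two variables. With a Gaussian as \<open>g\<close>
  it moves the transform onto an explicit function; extended to L2 it describes the adjoint of the
  transform.\<close>

lemma ft_mult_formula:
  assumes f: "integrable lborel f" and g: "integrable lborel g"
  shows "(\<integral>\<xi>. ft f \<xi> * g \<xi> \<partial>lborel) = (\<integral>x. f x * ft g x \<partial>lborel)"
proof -
  have [measurable]: "f \<in> borel_measurable borel" "g \<in> borel_measurable borel" using f g by auto
  let ?h = "\<lambda>x \<xi>. cis (- (x \<bullet> \<xi>)) * f x * g \<xi>"
  have "integrable (lborel \<Otimes>\<^sub>M lborel) (case_prod ?h)"
  proof (rule lborel_pair.Fubini_integrable)
    show "integrable lborel (\<lambda>x. \<integral>y. norm (case (x, y) of (x, \<xi>) \<Rightarrow> ?h x \<xi>) \<partial>lborel)"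
      using f by (simp add: norm_mult mult.assoc)
    show "AE x in lborel. integrable lborel (\<lambda>y. case (x, y) of (x, \<xi>) \<Rightarrow> ?h x \<xi>)"
    proof (rule AE_I2)
      show "integrable lborel (\<lambda>y. case (x, y) of (x, \<xi>) \<Rightarrow> ?h x \<xi>)" for x
        using integrable_mult_right[OF integrable_cis_mult[OF g, of "\<lambda>\<xi>. - (x \<bullet> \<xi>)"], of "f x"]
        by (simp add: mult_ac)
    qed
  qed measurable
  then have "(\<integral>\<xi>. (\<integral>x. ?h x \<xi> \<partial>lborel) \<partial>lborel) = (\<integral>x. (\<integral>\<xi>. ?h x \<xi> \<partial>lborel) \<partial>lborel)"
    by (rule lborel_pair.Fubini_integral)
  moreover have "(\<integral>x. ?h x \<xi> \<partial>lborel) = ft f \<xi> * g \<xi>" for \<xi>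
    by (simp add: ft_def)
  moreover have "(\<integral>\<xi>. ?h x \<xi> \<partial>lborel) = f x * ft g x" for x
    unfolding ft_def Bochner_Integration.integral_mult_right_zero[symmetric]
    by (simp add: inner_commute mult_ac)
  ultimately show ?thesis by (simp only:)
qed

section \<open>Gaussians and their transforms\<close>

definition gauss :: "'a::euclidean_space \<Rightarrow> real" where
  "gauss x = exp (- (norm x)\<^sup>2 / 2)"

lemma gauss_measurable[measurable]: "gauss \<in> borel_measurable borel"
  unfolding gauss_def[abs_def] by measurable

lemma gauss_prod: "gauss (\<Sum>b\<in>Basis. x b *\<^sub>R b) = (\<Prod>b\<in>(Basis::'a::euclidean_space set). exp (- (x b)\<^sup>2 / 2))"
proof -
  have "(norm (\<Sum>b\<in>(Basis::'a set). x b *\<^sub>R b))\<^sup>2 = (\<Sum>b\<in>(Basis::'a set). (x b)\<^sup>2)"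
    unfolding power2_norm_eq_inner euclidean_inner[of "\<Sum>b\<in>(Basis::'a set). x b *\<^sub>R b" "\<Sum>b\<in>(Basis::'a set). x b *\<^sub>R b"]
    by (intro sum.cong refl) (simp add: inner_sum_left inner_Basis if_distrib sum.If_cases power2_eq_square cong: if_cong)
  then show ?thesis
    by (simp add: gauss_def exp_sum[symmetric] sum_negf sum_divide_distrib)
qed

text \<open>The second claim is the characteristic function of the standard normal law, rescaled by
  sqrt(2 pi).\<close>

lemma gauss_1d:
  shows "integrable lborel (\<lambda>t::real. exp (- t\<^sup>2 / 2))"
    and "(\<integral>t. cis (- (y * t)) * of_real (exp (- t\<^sup>2 / 2)) \<partial>lborel) = of_real (sqrt (2 * pi) * exp (- y\<^sup>2 / 2))"
proof -
  have n: "exp (- t\<^sup>2 / 2) = sqrt (2 * pi) * std_normal_density t" for t :: real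
    by (simp add: normal_density_def)
  show "integrable lborel (\<lambda>t::real. exp (- t\<^sup>2 / 2))"
    unfolding n by (intro integrable_mult_right integrable_normal_density) simp
  have "char std_normal_distribution (-y) = (\<integral>t. std_normal_density t *\<^sub>R iexp (- y * t) \<partial>lborel)"
    unfolding char_def by (subst integral_density) auto
  then have "(\<integral>t. std_normal_density t *\<^sub>R iexp (- y * t) \<partial>lborel) = exp (- y\<^sup>2 / 2)"
    by (simp add: char_std_normal_distribution)
  then have "of_real (sqrt (2 * pi)) * (\<integral>t. std_normal_density t *\<^sub>R iexp (- y * t) \<partial>lborel) = 
    of_real (sqrt (2 * pi) * exp (- y\<^sup>2 / 2))" by simp
  moreover have "of_real (sqrt (2 * pi)) * (\<integral>t. std_normal_density t *\<^sub>R iexp (- y * t) \<partial>lborel) =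
    (\<integral>t. of_real (sqrt (2 * pi)) * (std_normal_density t *\<^sub>R iexp (- y * t)) \<partial>lborel)"
    by (rule Bochner_Integration.integral_mult_right_zero[symmetric])
  moreover have "of_real (sqrt (2 * pi)) * (std_normal_density t *\<^sub>R iexp (- y * t)) = 
     cis (- (y * t)) * of_real (exp (- t\<^sup>2 / 2))" for t
    unfolding n of_real_mult by (simp add: cis_conv_exp scaleR_conv_of_real mult_ac)
  ultimately show "(\<integral>t. cis (- (y * t)) * of_real (exp (- t\<^sup>2 / 2)) \<partial>lborel) = of_real (sqrt (2 * pi) * exp (- y\<^sup>2 / 2))"
    by simp
qed

lemma cis_sum: "finite I \<Longrightarrow> cis (\<Sum>i\<in>I. f i) = (\<Prod>i\<in>I. cis (f i))"
  by (induction I rule: finite_induct) (auto simp: cis_mult[symmetric])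

interpretation lborel_product: product_sigma_finite "\<lambda>_::'a::euclidean_space. (lborel :: real measure)"
  ..

lemma gauss_integrable: "integrable lborel (gauss :: 'a::euclidean_space \<Rightarrow> real)"
proof (subst lborel_eq, subst integrable_distr_eq)
  show "integrable (\<Pi>\<^sub>M b\<in>(Basis::'a set). lborel) (\<lambda>x. gauss (\<Sum>b\<in>(Basis::'a set). x b *\<^sub>R b))"
    unfolding gauss_prod by (rule lborel_product.product_integrable_prod) (use gauss_1d(1) in simp_all)
qed measurable

text \<open>Both the Gaussian and the plane wave factorise over coordinates, so on the product of
  real lines the integral is a product of one-dimensional ones.\<close>

lemma ft_gauss: "ft (\<lambda>x. of_real (gauss x)) (y::'a::euclidean_space) = of_real (sqrt (2 * pi) ^ DIM('a) * gauss y)"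
proof -
  have e: "cis (- ((\<Sum>b\<in>(Basis::'a set). x b *\<^sub>R b) \<bullet> y)) * of_real (gauss (\<Sum>b\<in>(Basis::'a set). x b *\<^sub>R b))
      = (\<Prod>b\<in>(Basis::'a set). cis (- ((y \<bullet> b) * x b)) * of_real (exp (- (x b)\<^sup>2 / 2)))" for x
    by (simp add: gauss_prod prod.distrib cis_sum[symmetric] inner_sum_left inner_sum_right sum_negf 
        inner_commute mult.commute)
  have "ft (\<lambda>x. of_real (gauss x)) y = 
     (\<integral>x. (\<Prod>b\<in>(Basis::'a set). cis (- ((y \<bullet> b) * x b)) * of_real (exp (- (x b)\<^sup>2 / 2))) \<partial>(\<Pi>\<^sub>M b\<in>(Basis::'a set). lborel))"
    unfolding ft_def by (subst lborel_eq, subst integral_distr) (simp_all only: e, measurable)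
  also have "\<dots> = (\<Prod>b\<in>(Basis::'a set). (\<integral>t. cis (- ((y \<bullet> b) * t)) * of_real (exp (- t\<^sup>2 / 2)) \<partial>lborel))"
    by (rule lborel_product.product_integral_prod) 
       (auto intro!: integrable_cis_mult integrable_of_real gauss_1d(1)[simplified])
  also have "\<dots> = of_real (\<Prod>b\<in>(Basis::'a set). sqrt (2 * pi) * exp (- (y \<bullet> b)\<^sup>2 / 2))"
    by (simp only: gauss_1d of_real_prod)
  also have "\<dots> = of_real (sqrt (2 * pi) ^ DIM('a) * gauss y)"
    using gauss_prod[of "\<lambda>b. y \<bullet> b"] by (simp add: prod.distrib euclidean_representation)
  finally show ?thesis .
qed

section \<open>Translation, domination and density in L2\<close>

lemma L2_translate:
  assumes f: "f \<in> L2" shows "(\<lambda>x. f (x - w)) \<in> L2" "L2_norm (\<lambda>x. f (x - w)) = L2_norm f"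
proof -
  have [measurable]: "f \<in> borel_measurable borel" using f by auto
  show "(\<lambda>x. f (x - w)) \<in> L2"
    using lborel_integrable_affine[OF _ L2_integrable_sq[OF f], of 1 "-w"] by (intro L2I) auto
  show "L2_norm (\<lambda>x. f (x - w)) = L2_norm f"
    using lborel_integral_translate[of "\<lambda>x. (cmod (f x))\<^sup>2" "-w"] by (simp add: L2_norm_def)
qed

lemma L2_tendsto_dominated:
  fixes f :: "'a::euclidean_space \<Rightarrow> complex"
  assumes F: "\<And>n::nat. F n \<in> borel_measurable borel" and f: "f \<in> borel_measurable borel" and h: "h \<in> L2"
    and lim: "AE x in lborel. (\<lambda>n. F n x) \<longlonglongrightarrow> f x" 
    and bd: "\<And>n. AE x in lborel. cmod (F n x) \<le> cmod (h x)"
  shows "f \<in> L2" "(\<lambda>n. L2_norm (\<lambda>x. F n x - f x)) \<longlonglongrightarrow> 0"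
proof -
  have [measurable]: "f \<in> borel_measurable borel" "\<And>n. F n \<in> borel_measurable borel" "h \<in> borel_measurable borel" 
    using F f h by auto
  have "AE x in lborel. \<forall>n. cmod (F n x) \<le> cmod (h x)"
    using bd by (simp add: AE_all_countable)
  then have fh: "AE x in lborel. cmod (f x) \<le> cmod (h x)"
    using lim by eventually_elim (auto intro: tendsto_upperbound[OF tendsto_norm] simp: always_eventually)
  then show fL: "f \<in> L2"
    by (intro L2_bound[OF _ L2_integrable_sq[OF h]]) (auto simp: power_mono)
  have "(\<lambda>n. \<integral>x. (cmod (F n x - f x))\<^sup>2 \<partial>lborel) \<longlonglongrightarrow> (\<integral>x. 0 \<partial>(lborel :: 'a measure))"
  proof (rule integral_dominated_convergence)
    show "integrable lborel (\<lambda>x. 4 * (cmod (h x))\<^sup>2)" using L2_integrable_sq[OF h] by simp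
    show "AE x in lborel. (\<lambda>n. (cmod (F n x - f x))\<^sup>2) \<longlonglongrightarrow> 0"
      using lim
    proof eventually_elim
      case (elim x)
      have "(\<lambda>n. (cmod (F n x - f x))\<^sup>2) \<longlonglongrightarrow> (cmod (f x - f x))\<^sup>2" by (intro tendsto_intros elim)
      then show ?case by simp
    qed
    show "AE x in lborel. norm ((cmod (F n x - f x))\<^sup>2) \<le> 4 * (cmod (h x))\<^sup>2" for n
      using bd[of n] fh
    proof eventually_elim
      case (elim x)
      have "(cmod (F n x - f x))\<^sup>2 \<le> (2 * cmod (h x))\<^sup>2"
        by (rule power_mono) (use elim norm_triangle_ineq4[of "F n x" "f x"] in linarith, simp)
      then show ?case by (simp add: power_mult_distrib)
    qed
  qed auto
  then have "(\<lambda>n. sqrt (\<integral>x. (cmod (F n x - f x))\<^sup>2 \<partial>lborel)) \<longlonglongrightarrow> sqrt 0"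
    by (intro tendsto_intros) simp
  then show "(\<lambda>n. L2_norm (\<lambda>x. F n x - f x)) \<longlonglongrightarrow> 0"
    by (simp add: L2_norm_def)
qed

lemma integrable_indicator_cball:
  "integrable lborel (indicator (cball (c::'a::euclidean_space) R) :: 'a \<Rightarrow> real)"
  using emeasure_lborel_cball_finite[of c R] by (intro integrable_real_indicator) auto

text \<open>The function equals its product with the indicator of a ball, and both factors lie in
  L2.\<close>

lemma integrable_bounded_support:
  fixes f :: "'a::euclidean_space \<Rightarrow> complex"
  assumes f: "f \<in> L2" and s: "\<And>x. norm x > R \<Longrightarrow> f x = 0"
  shows "integrable lborel f"
proof -
  have "(\<lambda>x::'a. indicator (cball 0 R) x :: complex) \<in> L2"
  proof (rule L2I)
    have "integrable lborel (indicator (cball (0::'a) R) :: 'a \<Rightarrow> real)"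
      by (rule integrable_indicator_cball)
    moreover have "(\<lambda>x::'a. (cmod (indicator (cball 0 R) x))\<^sup>2) = (indicator (cball (0::'a) R) :: 'a \<Rightarrow> real)"
      by (auto simp: indicator_def)
    ultimately show "integrable lborel (\<lambda>x::'a. (cmod (indicator (cball 0 R) x))\<^sup>2)" by simp
  qed (auto intro!: borel_measurable_indicator)
  from L2_mult_integrable[OF f this] show ?thesis
    by (rule Bochner_Integration.integrable_cong[THEN iffD1, rotated 2])
       (use s in \<open>auto simp: indicator_def\<close>)
qed

lemma L2_bounded_support:
  fixes f :: "'a::euclidean_space \<Rightarrow> complex"
  assumes [measurable]: "f \<in> borel_measurable borel" and s: "\<And>x. norm x > R \<Longrightarrow> f x = 0" 
    and b: "\<And>x. cmod (f x) \<le> B"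
  shows "f \<in> L2"
proof (rule L2_bound[where h="\<lambda>x. B\<^sup>2 * indicator (cball 0 R) x"])
  show "integrable lborel (\<lambda>x::'a. B\<^sup>2 * indicator (cball 0 R) x :: real)"
    by (intro integrable_mult_right integrable_indicator_cball)
  have "(cmod (f x))\<^sup>2 \<le> B\<^sup>2" for x by (intro power_mono b) simp
  then show "AE x in lborel. (cmod (f x))\<^sup>2 \<le> B\<^sup>2 * indicator (cball 0 R) x"
    using s by (auto simp: indicator_def not_le)
qed auto

text \<open>The radial retraction of the plane onto a disc. Being continuous, it bounds a continuous
  approximant without changing values already inside the disc.\<close>

definition clamp_norm :: "real \<Rightarrow> complex \<Rightarrow> complex" where
  "clamp_norm M z = of_real (M / max M (cmod z)) * z"

lemma clamp_norm_properties:
  assumes "M > 0"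
  shows "cmod (clamp_norm M z) \<le> M" "cmod (clamp_norm M z) \<le> cmod z" "cmod z \<le> M \<Longrightarrow> clamp_norm M z = z"
    "continuous_on UNIV (clamp_norm M)"
proof -
  have p: "0 < max M (cmod z)" for z using assms by simp
  show "cmod (clamp_norm M z) \<le> M" "cmod (clamp_norm M z) \<le> cmod z"
    unfolding clamp_norm_def norm_mult norm_of_real using p[of z] assms 
    by (auto simp: field_simps max_def mult_left_mono)
  show "cmod z \<le> M \<Longrightarrow> clamp_norm M z = z" using assms by (simp add: clamp_norm_def max_def)
  show "continuous_on UNIV (clamp_norm M)"
    unfolding clamp_norm_def[abs_def] using p by (intro continuous_intros) (metis less_irrefl)
qed

text \<open>Two approximations: truncate \<open>f\<close> in space and in size, then use that a
  measurable function is almost everywhere a limit of continuous ones. Pointwise limits alone give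
  no L2 convergence, so the continuous functions are clamped and cut off to obtain a dominating
  function.\<close>

lemma L2_dense_continuous:
  fixes f :: "'a::euclidean_space \<Rightarrow> complex"
  assumes f: "f \<in> L2" and e: "e > 0"
  obtains g R B where "g \<in> L2" "continuous_on UNIV g" "\<And>x. norm x > R \<Longrightarrow> g x = 0" "\<And>x. cmod (g x) \<le> B"
    "L2_norm (\<lambda>x. f x - g x) < e"
proof -
  have [measurable]: "f \<in> borel_measurable borel" using f by auto
  define F where "F n x = (if norm x \<le> real n \<and> cmod (f x) \<le> real n then f x else 0)" for n x
  have [measurable]: "F n \<in> borel_measurable borel" for n unfolding F_def by measurable
  have "(\<lambda>n. L2_norm (\<lambda>x. F n x - f x)) \<longlonglongrightarrow> 0"
  proof (rule L2_tendsto_dominated(2)[OF _ _ f])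
    show "AE x in lborel. (\<lambda>n. F n x) \<longlonglongrightarrow> f x"
    proof (rule AE_I2, rule tendsto_eventually)
      fix x
      have "eventually (\<lambda>n. real n \<ge> norm x) sequentially" "eventually (\<lambda>n. real n \<ge> cmod (f x)) sequentially"
        by real_asymp+
      then show "eventually (\<lambda>n. F n x = f x) sequentially"
        by eventually_elim (simp add: F_def)
    qed
  qed (auto simp: F_def)
  from LIMSEQ_D[OF this, of "e/2"] e obtain n0 where "\<And>n. n \<ge> n0 \<Longrightarrow> L2_norm (\<lambda>x. F n x - f x) < e/2"
    by auto
  then have n: "L2_norm (\<lambda>x. F (Suc n0) x - f x) < e/2" by simp
  \<comment> \<open>A successor, so that the clamping radius is positive.\<close>
  define n where "n = Suc n0"
  have F1: "F n \<in> L2" by (rule L2_bounded_support[where R="real n" and B="real n"]) (auto simp: F_def)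
  have "F n measurable_on UNIV"
    by (rule lebesgue_measurable_imp_measurable_on) (auto intro: measurable_completion)
  then obtain N G where N: "negligible N" and G: "\<And>k. continuous_on UNIV (G k)" 
     "\<And>x. x \<notin> N \<Longrightarrow> (\<lambda>k. G k x) \<longlonglongrightarrow> F n x"
    unfolding measurable_on_def by auto
  \<comment> \<open>\<open>c\<close> is 1 where \<open>F n\<close> can be nonzero, and clamping at
    \<open>real n\<close> fixes the values of \<open>F n\<close>; hence neither operation alters the
    limit.\<close>
  define c where "c x = max 0 (min 1 (real n + 1 - norm x))" for x :: 'a
  define g where "g k x = of_real (c x) * clamp_norm (real n) (G k x)" for k x
  have np: "real n > 0" by (simp add: n_def)
  have cc: "continuous_on UNIV c" unfolding c_def by (intro continuous_intros)
  have gc: "continuous_on UNIV (g k)" for k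
    unfolding g_def using continuous_on_compose2[OF clamp_norm_properties(4)[OF np] G(1)] 
    by (intro continuous_intros cc) auto
  have gs: "norm x > real n + 1 \<Longrightarrow> g k x = 0" for k x by (simp add: g_def c_def)
  have gb: "cmod (g k x) \<le> real n" for k x
  proof -
    have "\<bar>c x\<bar> \<le> 1" by (simp add: c_def)
    then show ?thesis using clamp_norm_properties(1)[OF np, of "G k x"] mult_mono[of "\<bar>c x\<bar>" 1 "cmod (clamp_norm (real n) (G k x))" "real n"]
      by (simp add: g_def norm_mult)
  qed
  have [measurable]: "g k \<in> borel_measurable borel" for k using gc by (simp add: borel_measurable_continuous_onI)
  have gL: "g k \<in> L2" for k by (rule L2_bounded_support[OF _ gs gb]) auto
  have "(\<lambda>k. L2_norm (\<lambda>x. g k x - F n x)) \<longlonglongrightarrow> 0"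
  proof (rule L2_tendsto_dominated(2)[where h="\<lambda>x. of_real (real n) * indicator (cball 0 (real n + 1)) x"])
    show "(\<lambda>x::'a. of_real (real n) * indicator (cball 0 (real n + 1)) x) \<in> L2"
      by (rule L2_bounded_support[where R="real n + 1" and B="real n"]) (auto simp: indicator_def)
    have "AE x in lebesgue. x \<notin> N" using N negligible_iff_null_sets AE_not_in by blast
    then have "AE x in lborel. x \<notin> N" by (simp add: AE_completion_iff)
    then show "AE x in lborel. (\<lambda>k. g k x) \<longlonglongrightarrow> F n x"
    proof eventually_elim
      case (elim x)
      have "(\<lambda>k. g k x) \<longlonglongrightarrow> of_real (c x) * clamp_norm (real n) (F n x)"
        unfolding g_def using clamp_norm_properties(4)[OF np] G(2)[OF elim] 
        by (intro tendsto_intros continuous_on_tendsto_compose[OF clamp_norm_properties(4)[OF np]]) auto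
      moreover have "of_real (c x) * clamp_norm (real n) (F n x) = F n x"
        using clamp_norm_properties(3)[OF np, of "F n x"] by (auto simp: F_def c_def)
      ultimately show ?case by simp
    qed
    show "AE x in lborel. cmod (g k x) \<le> cmod (of_real (real n) * indicator (cball 0 (real n + 1)) x)" for k
      using gb gs by (intro AE_I2) (auto simp: indicator_def norm_mult)
  qed auto
  from LIMSEQ_D[OF this, of "e/2"] e obtain k where "L2_norm (\<lambda>x. g k x - F n x) < e/2"
    by auto
  then have "L2_norm (\<lambda>x. f x - g k x) < e"
    using L2_norm_triangle3[OF f gL[of k] F1] n L2_norm_minus_commute[of f "F n"] L2_norm_minus_commute[of "g k" "F n"]
    unfolding n_def by linarith
  with gL gc gs gb show ?thesis by (rule that)
qed

text \<open>The convolution of \<open>f\<close> with the conjugate of its reflection. Its value at 0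
  is the squared L2 norm, and its transform is the squared modulus of the transform of
  \<open>f\<close>.\<close>

definition autocorr :: "('a::euclidean_space \<Rightarrow> complex) \<Rightarrow> 'a \<Rightarrow> complex" where
  "autocorr f w = ip f (\<lambda>x. f (x - w))"

lemma autocorr_le: "f \<in> L2 \<Longrightarrow> cmod (autocorr f w) \<le> (L2_norm f)\<^sup>2"
  unfolding autocorr_def using ip_le[OF _ L2_translate(1)] L2_translate(2) 
  by (metis power2_eq_square)

lemma autocorr_diff_le:
  assumes f: "f \<in> L2" and g: "g \<in> L2"
  shows "cmod (autocorr f w - autocorr g w) \<le> L2_norm (\<lambda>x. f x - g x) * (L2_norm f + L2_norm g)"
proof -
  note [simp] = L2_translate[OF f] L2_translate[OF g] L2_translate[OF L2_diff[OF f g]]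
  have "autocorr f w - autocorr g w = 
     ip (\<lambda>x. f x - g x) (\<lambda>x. f (x - w)) + ip g (\<lambda>x. f (x - w) - g (x - w))"
    unfolding autocorr_def using f g by (simp add: ip_diff_left ip_diff_right)
  also have "cmod \<dots> \<le> L2_norm (\<lambda>x. f x - g x) * L2_norm f + L2_norm g * L2_norm (\<lambda>x. f x - g x)"
    by (rule norm_triangle_le, rule add_mono) 
       (use ip_le[OF L2_diff[OF f g], of "\<lambda>x. f (x - w)"] ip_le[OF g L2_translate(1)[OF L2_diff[OF f g]], of w] in simp_all)
  finally show ?thesis by (simp add: algebra_simps)
qed

text \<open>This is continuity of translations in L2 in weak form. By density it suffices to treat a
  bounded continuous function with bounded support, where dominated convergence applies.\<close>

lemma autocorr_tendsto:
  fixes f :: "'a::euclidean_space \<Rightarrow> complex"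
  assumes f: "f \<in> L2" and w: "w \<longlonglongrightarrow> 0"
  shows "(\<lambda>n. autocorr f (w n)) \<longlonglongrightarrow> of_real ((L2_norm f)\<^sup>2)"
proof (rule LIMSEQ_I)
  fix r :: real assume r: "r > 0"
  define C where "C = 2 * L2_norm f + 1"
  have C: "C > 0" by (simp add: C_def add_nonneg_pos)
  \<comment> \<open>The bound 1 keeps the norm of the approximant below
    \<open>L2_norm f + 1\<close>; then exchanging \<open>f\<close> for \<open>g\<close> costs at
    most \<open>e * C\<close>, a third of \<open>r\<close>, at each of the two points.\<close>
  define e where "e = min 1 (r / (3 * C))"
  have e: "e > 0" "e \<le> 1" "e * C \<le> r/3" using r C by (auto simp: e_def min_def field_simps)
  obtain g :: "'a \<Rightarrow> complex" and R B where g: "g \<in> L2" "continuous_on UNIV g" "\<And>x. norm x > R \<Longrightarrow> g x = 0" 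
    "\<And>x. cmod (g x) \<le> B" "L2_norm (\<lambda>x. f x - g x) < e"
    using L2_dense_continuous[OF f e(1)] by blast
  have [measurable]: "g \<in> borel_measurable borel" using g by auto
  have "L2_norm g \<le> L2_norm f + 1"
    using L2_norm_diff_ge[OF f g(1)] g(5) e by linarith
  then have "L2_norm (\<lambda>x. f x - g x) * (L2_norm f + L2_norm g) \<le> e * C"
    using g(5) e(1) by (intro mult_mono) (auto simp: C_def)
  then have d: "cmod (autocorr f v - autocorr g v) \<le> r/3" for v
    using autocorr_diff_le[OF f g(1), of v] e by linarith
  have "(\<lambda>n. autocorr g (w n)) \<longlonglongrightarrow> autocorr g 0"
    unfolding autocorr_def ip_def
  proof (rule integral_dominated_convergence)
    show "integrable lborel (\<lambda>x. B * cmod (g x))"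
      using integrable_bounded_support[OF g(1) g(3)] by simp
    show "AE x in lborel. (\<lambda>n. g x * cnj (g (x - w n))) \<longlonglongrightarrow> g x * cnj (g (x - 0))"
      using w by (intro AE_I2 tendsto_intros continuous_on_tendsto_compose[OF g(2)]) auto
    show "AE x in lborel. norm (g x * cnj (g (x - w n))) \<le> B * cmod (g x)" for n
    proof (rule AE_I2)
      show "norm (g x * cnj (g (x - w n))) \<le> B * cmod (g x)" for x
        using mult_left_mono[OF g(4)[of "x - w n"], of "cmod (g x)"] by (simp add: norm_mult mult.commute)
    qed
  qed measurable
  from LIMSEQ_D[OF this, of "r/3"] r obtain n0 
    where n0: "\<And>n. n \<ge> n0 \<Longrightarrow> cmod (autocorr g (w n) - autocorr g 0) < r/3"
    by auto
  have "autocorr f 0 = of_real ((L2_norm f)\<^sup>2)" by (simp add: autocorr_def ip_self)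
  moreover have "cmod (autocorr f (w n) - autocorr f 0) < r" if "n \<ge> n0" for n
  proof -
    have "autocorr f (w n) - autocorr f 0 = (autocorr f (w n) - autocorr g (w n)) +
       ((autocorr g (w n) - autocorr g 0) - (autocorr f 0 - autocorr g 0))" by simp
    also have "cmod \<dots> \<le> cmod (autocorr f (w n) - autocorr g (w n)) + 
      (cmod (autocorr g (w n) - autocorr g 0) + cmod (autocorr f 0 - autocorr g 0))"
      by (intro norm_triangle_le add_mono order_refl norm_triangle_ineq4)
    finally show ?thesis using d[of "w n"] d[of 0] n0[OF that] by linarith
  qed
  ultimately show "\<exists>no. \<forall>n\<ge>no. norm (autocorr f (w n) - of_real ((L2_norm f)\<^sup>2)) < r" by auto
qed

text \<open>The convolution theorem: after Fubini the phase at \<open>w\<close> splits into the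
  phase at \<open>x\<close> and the conjugate phase at \<open>x - w\<close>, and a reflection
  decouples the two integrals.\<close>

lemma ft_autocorr:
  fixes f :: "'a::euclidean_space \<Rightarrow> complex"
  assumes f: "integrable lborel f"
  shows "integrable lborel (autocorr f)" "ft (autocorr f) \<xi> = of_real ((cmod (ft f \<xi>))\<^sup>2)"
proof -
  have [measurable]: "f \<in> borel_measurable borel" using f by auto
  let ?h = "\<lambda>x w. f x * cnj (f (x - w))"
  have t: "integrable lborel (\<lambda>w. f (x - w))" for x
    using lborel_integrable_affine[OF _ f, of "-1" x] by simp
  have *: "integrable (lborel \<Otimes>\<^sub>M lborel) (\<lambda>(x, w). ?h x w)"
  proof (rule lborel_pair.Fubini_integrable)
    have "(\<integral>w. cmod (f (x - w)) \<partial>lborel) = (\<integral>w. cmod (f w) \<partial>lborel)" for x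
      by (rule lborel_integral_reflect) simp
    then show "integrable lborel (\<lambda>x. \<integral>w. norm (case (x, w) of (x, w) \<Rightarrow> ?h x w) \<partial>lborel)"
      using f by (simp add: norm_mult)
    show "AE x in lborel. integrable lborel (\<lambda>w. case (x, w) of (x, w) \<Rightarrow> ?h x w)"
      using t by (auto intro!: integrable_mult_right)
  qed measurable
  from lborel_pair.integrable_snd[OF this]
  show i: "integrable lborel (autocorr f)"
    by (simp add: autocorr_def[abs_def] ip_def)
  have "ft (autocorr f) \<xi> = (\<integral>w. (\<integral>x. cis (- (w \<bullet> \<xi>)) * ?h x w \<partial>lborel) \<partial>lborel)"
    by (simp add: ft_def autocorr_def ip_def)
  also have "\<dots> = (\<integral>x. (\<integral>w. cis (- (w \<bullet> \<xi>)) * ?h x w \<partial>lborel) \<partial>lborel)"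
  proof (rule lborel_pair.Fubini_integral)
    show "integrable (lborel \<Otimes>\<^sub>M lborel) (\<lambda>(x, w). cis (- (w \<bullet> \<xi>)) * ?h x w)"
      by (rule Bochner_Integration.integrable_bound[OF *]) (auto simp: norm_mult)
  qed
  also have "\<dots> = (\<integral>x. cis (- (x \<bullet> \<xi>)) * f x * cnj (ft f \<xi>) \<partial>lborel)"
  proof (rule Bochner_Integration.integral_cong[OF refl])
    fix x
    have phase: "cis (- (w \<bullet> \<xi>)) = cis (- (x \<bullet> \<xi>)) * cnj (cis (- ((x - w) \<bullet> \<xi>)))" for x w
      by (simp add: cis_cnj cis_mult inner_diff_left)
    have "(\<integral>w. cis (- (w \<bullet> \<xi>)) * ?h x w \<partial>lborel) = 
      (\<integral>w. (cis (- (x \<bullet> \<xi>)) * f x) * cnj (cis (- ((x - w) \<bullet> \<xi>)) * f (x - w)) \<partial>lborel)"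
      by (rule Bochner_Integration.integral_cong[OF refl], subst phase[where x=x]) (simp add: mult_ac)
    also have "\<dots> = (cis (- (x \<bullet> \<xi>)) * f x) * (\<integral>w. cnj (cis (- ((x - w) \<bullet> \<xi>)) * f (x - w)) \<partial>lborel)"
      by (rule Bochner_Integration.integral_mult_right_zero)
    also have "(\<integral>w. cnj (cis (- ((x - w) \<bullet> \<xi>)) * f (x - w)) \<partial>lborel) = (\<integral>w. cnj (cis (- (w \<bullet> \<xi>)) * f w) \<partial>lborel)"
      by (rule lborel_integral_reflect[of "\<lambda>w. cnj (cis (- (w \<bullet> \<xi>)) * f w)"]) simp
    also have "\<dots> = cnj (ft f \<xi>)"
      unfolding ft_def by (rule Bochner_Integration.integral_cnj)
    finally show "(\<integral>w. cis (- (w \<bullet> \<xi>)) * ?h x w \<partial>lborel) = cis (- (x \<bullet> \<xi>)) * f x * cnj (ft f \<xi>)" .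
  qed
  also have "\<dots> = ft f \<xi> * cnj (ft f \<xi>)"
    by (simp add: ft_def)
  finally show "ft (autocorr f) \<xi> = of_real ((cmod (ft f \<xi>))\<^sup>2)"
    by (simp only: complex_norm_square)
qed

lemma ft_scaled_gauss:
  fixes w :: "'a::euclidean_space"
  assumes e: "e > 0"
  shows "ft (\<lambda>\<xi>. of_real (gauss (e *\<^sub>R \<xi>))) w = of_real (sqrt (2 * pi) ^ DIM('a) * inverse (e ^ DIM('a)) * gauss (w /\<^sub>R e))"
proof -
  have "of_real (sqrt (2 * pi) ^ DIM('a) * gauss (w /\<^sub>R e)) = ft (\<lambda>x. of_real (gauss x)) (w /\<^sub>R e)"
    by (simp only: ft_gauss)
  also have "\<dots> = e ^ DIM('a) *\<^sub>R (\<integral>x. cis (- ((0 + e *\<^sub>R x) \<bullet> (w /\<^sub>R e))) * of_real (gauss (0 + e *\<^sub>R x)) \<partial>lborel)"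
    unfolding ft_def 
    by (subst lborel_integral_affine[of e _ 0]) (use e in auto)
  also have "\<dots> = e ^ DIM('a) *\<^sub>R ft (\<lambda>\<xi>. of_real (gauss (e *\<^sub>R \<xi>))) w"
    using e by (simp add: ft_def mult.assoc[symmetric])
  finally show ?thesis
    using e by (simp add: scaleR_conv_of_real field_simps)
qed

text \<open>The transform of an integrable function is bounded but not yet known to be square
  integrable, so a Gaussian factor enforces integrability. The multiplication formula then puts the
  transform on the Gaussian, and the substitution w = e z cancels the powers of
  \<open>e\<close>.\<close>

lemma gauss_damped_plancherel:
  fixes f :: "'a::euclidean_space \<Rightarrow> complex"
  assumes f: "integrable lborel f" and e: "e > 0"
  shows "integrable lborel (\<lambda>\<xi>. (cmod (ft f \<xi>))\<^sup>2 * gauss (e *\<^sub>R \<xi>))"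
    and "complex_of_real (\<integral>\<xi>. (cmod (ft f \<xi>))\<^sup>2 * gauss (e *\<^sub>R \<xi>) \<partial>lborel) = 
         of_real (sqrt (2 * pi) ^ DIM('a)) * (\<integral>z. of_real (gauss z) * autocorr f (e *\<^sub>R z) \<partial>lborel)"
proof -
  have [measurable]: "f \<in> borel_measurable borel" using f by auto
  have [measurable]: "autocorr f \<in> borel_measurable borel" using ft_autocorr(1)[OF f] by auto
  have g: "integrable lborel (\<lambda>\<xi>::'a. gauss (e *\<^sub>R \<xi>))"
    using lborel_integrable_affine[OF _ gauss_integrable, of e 0] e by simp
  show "integrable lborel (\<lambda>\<xi>. (cmod (ft f \<xi>))\<^sup>2 * gauss (e *\<^sub>R \<xi>))"
  proof (rule Bochner_Integration.integrable_bound)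
    show "integrable lborel (\<lambda>\<xi>::'a. (\<integral>x. cmod (f x) \<partial>lborel)\<^sup>2 * gauss (e *\<^sub>R \<xi>))"
      using g by simp
    show "AE \<xi> in lborel. norm ((cmod (ft f \<xi>))\<^sup>2 * gauss (e *\<^sub>R \<xi>)) \<le> norm ((\<integral>x. cmod (f x) \<partial>lborel)\<^sup>2 * gauss (e *\<^sub>R \<xi>))"
      by (intro AE_I2) (auto simp: abs_mult gauss_def intro!: mult_right_mono power_mono ft_le)
  qed measurable
  have "complex_of_real (\<integral>\<xi>. (cmod (ft f \<xi>))\<^sup>2 * gauss (e *\<^sub>R \<xi>) \<partial>lborel) = 
     (\<integral>\<xi>. ft (autocorr f) \<xi> * of_real (gauss (e *\<^sub>R \<xi>)) \<partial>lborel)"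
    unfolding ft_autocorr(2)[OF f] by (simp flip: of_real_mult of_real_power)
  also have "\<dots> = (\<integral>w. autocorr f w * ft (\<lambda>\<xi>. of_real (gauss (e *\<^sub>R \<xi>))) w \<partial>lborel)"
    using g by (intro ft_mult_formula ft_autocorr f) simp
  also have "\<dots> = e ^ DIM('a) *\<^sub>R (\<integral>z. autocorr f (0 + e *\<^sub>R z) * ft (\<lambda>\<xi>. of_real (gauss (e *\<^sub>R \<xi>))) (0 + e *\<^sub>R z) \<partial>lborel)"
    by (subst lborel_integral_affine[of e _ 0]) (use e in auto)
  also have "(\<integral>z. autocorr f (0 + e *\<^sub>R z) * ft (\<lambda>\<xi>. of_real (gauss (e *\<^sub>R \<xi>))) (0 + e *\<^sub>R z) \<partial>lborel)
    = (\<integral>z. of_real (sqrt (2 * pi) ^ DIM('a) * inverse (e ^ DIM('a))) * (of_real (gauss z) * autocorr f (e *\<^sub>R z)) \<partial>lborel)"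
    by (rule Bochner_Integration.integral_cong[OF refl]) (use e in \<open>simp add: ft_scaled_gauss\<close>)
  also have "\<dots> = of_real (sqrt (2 * pi) ^ DIM('a) * inverse (e ^ DIM('a))) * (\<integral>z. (of_real (gauss z) * autocorr f (e *\<^sub>R z)) \<partial>lborel)"
    by (rule Bochner_Integration.integral_mult_right_zero)
  finally show "complex_of_real (\<integral>\<xi>. (cmod (ft f \<xi>))\<^sup>2 * gauss (e *\<^sub>R \<xi>) \<partial>lborel) = 
         of_real (sqrt (2 * pi) ^ DIM('a)) * (\<integral>z. of_real (gauss z) * autocorr f (e *\<^sub>R z) \<partial>lborel)"
    using e by (simp add: scaleR_conv_of_real field_simps)
qed

text \<open>The price (2 pi)^(d/2) of the unnormalised transform in Plancherel's identity. The type
  argument carries the dimension.\<close>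

definition pconst :: "'a::euclidean_space itself \<Rightarrow> real" where
  "pconst _ = sqrt (2 * pi) ^ DIM('a)"

lemma pconst_pos: "pconst TYPE('a::euclidean_space) > 0"
  by (simp add: pconst_def)

text \<open>As the damping is removed, the right-hand side converges by continuity of the
  autocorrelation at 0. The left-hand side increases, so monotone convergence yields square
  integrability and the value of the norm together.\<close>

theorem plancherel_ft:
  fixes f :: "'a::euclidean_space \<Rightarrow> complex"
  assumes f: "integrable lborel f" and f2: "f \<in> L2"
  shows "ft f \<in> L2" "L2_norm (ft f) = pconst TYPE('a) * L2_norm f"
proof -
  have [measurable]: "f \<in> borel_measurable borel" using f by auto
  have [measurable]: "autocorr f \<in> borel_measurable borel" using ft_autocorr(1)[OF f] by auto
  define e where "e n = inverse (real (Suc n))" for n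
  have e: "e n > 0" for n by (simp add: e_def)
  have e0: "e \<longlonglongrightarrow> 0" unfolding e_def by (rule LIMSEQ_inverse_real_of_nat)
  let ?c = "sqrt (2 * pi) ^ DIM('a)"
  let ?I = "\<lambda>n. \<integral>\<xi>. (cmod (ft f \<xi>))\<^sup>2 * gauss (e n *\<^sub>R \<xi>) \<partial>lborel"
  have "(\<lambda>n. \<integral>z. of_real (gauss z) * autocorr f (e n *\<^sub>R z) \<partial>lborel) \<longlonglongrightarrow> 
        (\<integral>z. complex_of_real (gauss (z::'a)) * of_real ((L2_norm f)\<^sup>2) \<partial>lborel)"
  proof (rule integral_dominated_convergence)
    show "integrable lborel (\<lambda>z::'a. gauss z * (L2_norm f)\<^sup>2)" by (simp add: gauss_integrable)
    show "AE z in lborel. (\<lambda>n. of_real (gauss z) * autocorr f (e n *\<^sub>R z)) \<longlonglongrightarrow> complex_of_real (gauss (z::'a)) * of_real ((L2_norm f)\<^sup>2)"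
    proof (rule AE_I2, rule tendsto_mult[OF tendsto_const autocorr_tendsto[OF f2]])
      fix z :: 'a
      have "(\<lambda>n. e n *\<^sub>R z) \<longlonglongrightarrow> 0 *\<^sub>R z" by (intro tendsto_intros e0)
      then show "(\<lambda>n. e n *\<^sub>R z) \<longlonglongrightarrow> 0" by simp
    qed
    show "AE z in lborel. norm (of_real (gauss z) * autocorr f (e n *\<^sub>R z)) \<le> gauss z * (L2_norm f)\<^sup>2" for n
      by (intro AE_I2) (auto simp: norm_mult gauss_def intro!: mult_left_mono autocorr_le f2)
  qed measurable
  also have "(\<integral>z. complex_of_real (gauss (z::'a)) * of_real ((L2_norm f)\<^sup>2) \<partial>lborel) = 
     ft (\<lambda>x. of_real (gauss x)) (0::'a) * of_real ((L2_norm f)\<^sup>2)"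
    by (simp add: ft_def)
  also have "\<dots> = of_real (?c * (L2_norm f)\<^sup>2)"
    by (simp add: ft_gauss) (simp add: gauss_def)
  finally have "(\<lambda>n. of_real ?c * (\<integral>z. of_real (gauss z) * autocorr f (e n *\<^sub>R z) \<partial>lborel)) \<longlonglongrightarrow> 
    complex_of_real ?c * of_real (?c * (L2_norm f)\<^sup>2)"
    by (intro tendsto_intros)
  then have "(\<lambda>n. complex_of_real (?I n)) \<longlonglongrightarrow> of_real (?c * (?c * (L2_norm f)\<^sup>2))"
    unfolding gauss_damped_plancherel(2)[OF f e] by simp
  then have lim: "?I \<longlonglongrightarrow> ?c * (?c * (L2_norm f)\<^sup>2)"
    by (simp only: tendsto_of_real_iff)
  have mono: "mono (\<lambda>n. (cmod (ft f \<xi>))\<^sup>2 * gauss (e n *\<^sub>R \<xi>))" for \<xi>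
  proof (rule monoI, rule mult_left_mono)
    fix m n :: nat assume "m \<le> n"
    then have "e n \<le> e m" by (simp add: e_def)
    then have "(e n * norm \<xi>)\<^sup>2 \<le> (e m * norm \<xi>)\<^sup>2"
      using e[of n] e[of m] by (intro power_mono mult_right_mono) auto
    then show "gauss (e m *\<^sub>R \<xi>) \<le> gauss (e n *\<^sub>R \<xi>)"
      using e[of n] e[of m] by (simp add: gauss_def)
  qed simp
  have pt: "(\<lambda>n. (cmod (ft f \<xi>))\<^sup>2 * gauss (e n *\<^sub>R \<xi>)) \<longlonglongrightarrow> (cmod (ft f \<xi>))\<^sup>2" for \<xi>
  proof -
    have "(\<lambda>n. (cmod (ft f \<xi>))\<^sup>2 * gauss (e n *\<^sub>R \<xi>)) \<longlonglongrightarrow> (cmod (ft f \<xi>))\<^sup>2 * gauss (0 *\<^sub>R \<xi>)"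
      unfolding gauss_def by (intro tendsto_intros e0) auto
    then show ?thesis by (simp add: gauss_def)
  qed
  have "has_bochner_integral lborel (\<lambda>\<xi>. (cmod (ft f \<xi>))\<^sup>2) (?c * (?c * (L2_norm f)\<^sup>2))"
    by (rule has_bochner_integral_monotone_convergence[OF gauss_damped_plancherel(1)[OF f e] _ _ lim])
       (use mono pt in auto)
  then have i: "integrable lborel (\<lambda>\<xi>. (cmod (ft f \<xi>))\<^sup>2)" 
    and v: "(\<integral>\<xi>. (cmod (ft f \<xi>))\<^sup>2 \<partial>lborel) = ?c * (?c * (L2_norm f)\<^sup>2)"
    by (auto simp: has_bochner_integral_iff)
  show "ft f \<in> L2" using i by (intro L2I) auto
  show "L2_norm (ft f) = pconst TYPE('a) * L2_norm f"
    unfolding L2_norm_def[of "ft f"] v pconst_def 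
    by (simp add: mult.assoc[symmetric] real_sqrt_mult)
qed

subsection \<open>The Fourier transform on square integrable functions\<close>

definition trunc :: "real \<Rightarrow> ('a::euclidean_space \<Rightarrow> complex) \<Rightarrow> 'a \<Rightarrow> complex" where
  "trunc R f x = indicator (cball 0 R) x * f x"

lemma trunc_L2: "f \<in> L2 \<Longrightarrow> trunc R f \<in> L2"
  unfolding trunc_def[abs_def] by (rule L2_indicator) auto

lemma trunc_integrable: "f \<in> L2 \<Longrightarrow> integrable lborel (trunc R f)"
  by (rule integrable_bounded_support[where R=R, OF trunc_L2]) (auto simp: trunc_def indicator_def)

lemma trunc_tendsto:
  fixes f :: "'a::euclidean_space \<Rightarrow> complex"
  assumes f: "f \<in> L2" shows "((\<lambda>R. L2_norm (\<lambda>x. trunc R f x - f x)) \<longlongrightarrow> 0) at_top"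
proof (rule tendsto_at_topI_sequentially)
  fix X :: "nat \<Rightarrow> real" assume X: "filterlim X at_top sequentially"
  show "(\<lambda>n. L2_norm (\<lambda>x. trunc (X n) f x - f x)) \<longlonglongrightarrow> 0"
  proof (rule L2_tendsto_dominated(2)[OF _ _ f])
    show "AE x in lborel. (\<lambda>n. trunc (X n) f x) \<longlonglongrightarrow> f x"
    proof (rule AE_I2, rule tendsto_eventually)
      fix x :: 'a
      have "eventually (\<lambda>n. X n \<ge> norm x) sequentially"
        using X by (simp add: filterlim_at_top)
      then show "eventually (\<lambda>n. trunc (X n) f x = f x) sequentially"
        by eventually_elim (simp add: trunc_def)
    qed
  qed (use f trunc_L2[OF f] in \<open>auto simp: trunc_def indicator_def\<close>)
qed

lemma set_integral_cball_eq_ft: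
  "(LINT x:cball 0 R|lborel. cis (- (x \<bullet> \<xi>)) * f x) = ft (trunc R f) \<xi>"
  unfolding set_lebesgue_integral_def ft_def trunc_def
  by (rule Bochner_Integration.integral_cong[OF refl]) (simp add: indicator_def)

lemma is_fourier_iff:
  "is_fourier f g \<longleftrightarrow> g \<in> L2 \<and> ((\<lambda>R. L2_norm (\<lambda>\<xi>. ft (trunc R f) \<xi> - g \<xi>)) \<longlongrightarrow> 0) at_top"
  unfolding is_fourier_def set_integral_cball_eq_ft ..

lemma ft_trunc_diff_norm:
  fixes f :: "'a::euclidean_space \<Rightarrow> complex"
  assumes f: "f \<in> L2" 
  shows "L2_norm (\<lambda>\<xi>. ft (trunc R f) \<xi> - ft (trunc S f) \<xi>) = 
         pconst TYPE('a) * L2_norm (\<lambda>x. trunc R f x - trunc S f x)"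
proof -
  have "(\<lambda>\<xi>. ft (trunc R f) \<xi> - ft (trunc S f) \<xi>) = ft (\<lambda>x. trunc R f x - trunc S f x)"
    using f by (auto simp: ft_diff trunc_integrable)
  then show ?thesis
    using plancherel_ft(2)[of "\<lambda>x. trunc R f x - trunc S f x"] f
    by (simp add: trunc_integrable trunc_L2 L2_diff)
qed
    
lemma ft_trunc_L2: "f \<in> L2 \<Longrightarrow> ft (trunc R f) \<in> L2"
  by (intro plancherel_ft trunc_integrable trunc_L2)

text \<open>Truncations converge in L2, and Plancherel for integrable functions carries the Cauchy
  property over to their transforms.\<close>

lemma fourier_exists:
  fixes f :: "'a::euclidean_space \<Rightarrow> complex"
  assumes f: "f \<in> L2" shows "\<exists>g. is_fourier f g"
proof -
  let ?c = "pconst TYPE('a)"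
  note c = pconst_pos[where 'a='a]
  define d where "d R = L2_norm (\<lambda>x. trunc R f x - f x)" for R
  have d: "(d \<longlongrightarrow> 0) at_top" unfolding d_def by (rule trunc_tendsto[OF f])
  have dd: "L2_norm (\<lambda>\<xi>. ft (trunc R f) \<xi> - ft (trunc S f) \<xi>) \<le> ?c * (d R + d S)" for R S
    unfolding ft_trunc_diff_norm[OF f] d_def
    using L2_norm_triangle3[OF trunc_L2[OF f, of R] trunc_L2[OF f, of S] f] c
    by (intro mult_left_mono) (auto simp: L2_norm_minus_commute[of f])
  have dn: "(\<lambda>n. d (real n)) \<longlonglongrightarrow> 0"
    by (rule filterlim_compose[OF d filterlim_real_sequentially])
  have "\<exists>N. \<forall>m\<ge>N. \<forall>n\<ge>N. L2_norm (\<lambda>x. ft (trunc (real m) f) x - ft (trunc (real n) f) x) < e" if e: "e > 0" for e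
  proof -
    from LIMSEQ_D[OF dn, of "e / (2 * ?c)"] e c obtain N where N: "\<And>n. n \<ge> N \<Longrightarrow> \<bar>d (real n)\<bar> < e / (2 * ?c)"
      by auto
    have "L2_norm (\<lambda>x. ft (trunc (real m) f) x - ft (trunc (real n) f) x) < e" if "m \<ge> N" "n \<ge> N" for m n
    proof -
      have "d (real m) + d (real n) < e / ?c" using N[OF that(1)] N[OF that(2)] by (simp add: field_simps)
      then have "?c * (d (real m) + d (real n)) < e" using c by (simp add: field_simps)
      then show ?thesis using dd[of "real m" "real n"] by linarith
    qed
    then show ?thesis by blast
  qed
  then obtain g where g: "g \<in> L2" "(\<lambda>n. L2_norm (\<lambda>x. ft (trunc (real n) f) x - g x)) \<longlonglongrightarrow> 0"
    using Riesz_Fischer[of "\<lambda>n. ft (trunc (real n) f)"] ft_trunc_L2[OF f] by blast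
  \<comment> \<open>\<open>g\<close> was obtained along integer radii, while
    \<open>is_fourier\<close> asks for convergence along all real radii. Letting \<open>n\<close>
    tend to infinity in the Cauchy estimate gives a rate for every real \<open>R\<close>.\<close>
  have le: "L2_norm (\<lambda>\<xi>. ft (trunc R f) \<xi> - g \<xi>) \<le> ?c * d R" for R
  proof (rule LIMSEQ_le_const)
    have "(\<lambda>n. ?c * (d R + d (real n)) + L2_norm (\<lambda>x. ft (trunc (real n) f) x - g x)) \<longlonglongrightarrow> ?c * (d R + 0) + 0"
      by (intro tendsto_intros dn g)
    then show "(\<lambda>n. ?c * (d R + d (real n)) + L2_norm (\<lambda>x. ft (trunc (real n) f) x - g x)) \<longlonglongrightarrow> ?c * d R" by simp
    show "\<exists>N. \<forall>n\<ge>N. L2_norm (\<lambda>\<xi>. ft (trunc R f) \<xi> - g \<xi>) \<le> 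
       ?c * (d R + d (real n)) + L2_norm (\<lambda>x. ft (trunc (real n) f) x - g x)"
      using L2_norm_triangle3[OF ft_trunc_L2[OF f, of R] g(1) ft_trunc_L2[OF f]] dd[of R]
      by (intro exI[of _ 0] allI impI) (meson add_mono order_refl order_trans)
  qed
  have "((\<lambda>R. L2_norm (\<lambda>\<xi>. ft (trunc R f) \<xi> - g \<xi>)) \<longlongrightarrow> 0) at_top"
  proof (rule tendsto_sandwich[OF _ _ tendsto_const])
    show "((\<lambda>R. ?c * d R) \<longlongrightarrow> 0) at_top" using tendsto_mult_left[OF d, of ?c] by simp
  qed (use le in auto)
  then show ?thesis using g(1) by (auto simp: is_fourier_iff)
qed

lemma L2_limit_unique:
  assumes F: "F \<noteq> bot" "\<And>i. h i \<in> L2" "f \<in> L2" "g \<in> L2" 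
    and "((\<lambda>i. L2_norm (\<lambda>x. h i x - f x)) \<longlongrightarrow> 0) F" "((\<lambda>i. L2_norm (\<lambda>x. h i x - g x)) \<longlongrightarrow> 0) F"
  shows "AE x in lborel. f x = g x"
proof -
  have "L2_norm (\<lambda>x. f x - g x) \<le> 0"
  proof (rule tendsto_lowerbound[OF _ _ F(1)])
    show "((\<lambda>i. L2_norm (\<lambda>x. h i x - f x) + L2_norm (\<lambda>x. h i x - g x)) \<longlongrightarrow> 0) F"
      using tendsto_add[OF assms(5,6)] by simp
    show "\<forall>\<^sub>F i in F. L2_norm (\<lambda>x. f x - g x) \<le> L2_norm (\<lambda>x. h i x - f x) + L2_norm (\<lambda>x. h i x - g x)"
      using L2_norm_triangle3[OF F(3,4,2)] 
      by (intro always_eventually allI) (simp add: L2_norm_minus_commute[of f])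
  qed
  then have "L2_norm (\<lambda>x. f x - g x) = 0" using L2_norm_nonneg by (meson antisym)
  then show ?thesis using L2_norm_eq_0_iff[OF L2_diff[OF F(3,4)]] by simp
qed

lemma is_fourier_fourier: "f \<in> L2 \<Longrightarrow> is_fourier f (fourier f)"
  unfolding fourier_def by (rule someI_ex[OF fourier_exists])

lemma fourier_L2: "f \<in> L2 \<Longrightarrow> fourier f \<in> L2"
  using is_fourier_fourier by (auto simp: is_fourier_iff)

lemma fourier_lim: 
  "f \<in> L2 \<Longrightarrow> ((\<lambda>R. L2_norm (\<lambda>\<xi>. ft (trunc R f) \<xi> - fourier f \<xi>)) \<longlongrightarrow> 0) at_top"
  using is_fourier_fourier by (auto simp: is_fourier_iff)

lemma fourier_eqI:
  assumes "f \<in> L2" "g \<in> L2" "((\<lambda>R. L2_norm (\<lambda>\<xi>. ft (trunc R f) \<xi> - g \<xi>)) \<longlongrightarrow> 0) at_top"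
  shows "AE \<xi> in lborel. fourier f \<xi> = g \<xi>"
  by (rule L2_limit_unique[of at_top "\<lambda>R. ft (trunc R f)"])
     (use assms in \<open>auto simp: fourier_L2 fourier_lim ft_trunc_L2\<close>)

lemma fourier_norm:
  fixes f :: "'a::euclidean_space \<Rightarrow> complex"
  assumes f: "f \<in> L2" shows "L2_norm (fourier f) = pconst TYPE('a) * L2_norm f"
proof -
  have lim: "((\<lambda>R. L2_norm (h R)) \<longlongrightarrow> L2_norm g) at_top"
    if "\<And>R. h R \<in> L2" "g \<in> L2" "((\<lambda>R. L2_norm (\<lambda>x. h R x - g x)) \<longlongrightarrow> 0) at_top" 
    for h :: "real \<Rightarrow> 'a \<Rightarrow> complex" and g
  proof (rule LIM_zero_cancel, rule Lim_null_comparison[OF _ that(3)])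
    show "\<forall>\<^sub>F x in at_top. norm (L2_norm (h x) - L2_norm g) \<le> L2_norm (\<lambda>xa. h x xa - g xa)"
      using L2_norm_diff_ge[OF that(1,2)] by simp
  qed
  have "((\<lambda>R. L2_norm (ft (trunc R f))) \<longlongrightarrow> L2_norm (fourier f)) at_top"
    by (rule lim[OF ft_trunc_L2[OF f] fourier_L2[OF f] fourier_lim[OF f]])
  moreover have "((\<lambda>R. L2_norm (ft (trunc R f))) \<longlongrightarrow> pconst TYPE('a) * L2_norm f) at_top"
    unfolding plancherel_ft(2)[OF trunc_integrable[OF f] trunc_L2[OF f]]
    by (intro tendsto_intros lim trunc_L2 f trunc_tendsto)
  ultimately show ?thesis by (rule tendsto_unique[OF trivial_limit_at_top_linorder])
qed

text \<open>The truncated transforms are linear exactly; for the chosen limit, linearity follows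
  from uniqueness of L2 limits.\<close>

lemma fourier_add_cmult:
  assumes f: "f \<in> L2" and g: "g \<in> L2"
  shows "AE \<xi> in lborel. fourier (\<lambda>x. f x + k * g x) \<xi> = fourier f \<xi> + k * fourier g \<xi>"
proof (rule fourier_eqI)
  have t: "trunc R (\<lambda>x. f x + k * g x) = (\<lambda>x. trunc R f x + k * trunc R g x)" for R
    by (auto simp: trunc_def algebra_simps)
  have e: "ft (trunc R (\<lambda>x. f x + k * g x)) \<xi> = ft (trunc R f) \<xi> + k * ft (trunc R g) \<xi>" for R \<xi>
    unfolding t using f g by (simp add: ft_add ft_cmult trunc_integrable)
  show "((\<lambda>R. L2_norm (\<lambda>\<xi>. ft (trunc R (\<lambda>x. f x + k * g x)) \<xi> - (fourier f \<xi> + k * fourier g \<xi>))) \<longlongrightarrow> 0) at_top"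
  proof (rule tendsto_sandwich[OF _ _ tendsto_const])
    show "((\<lambda>R. L2_norm (\<lambda>\<xi>. ft (trunc R f) \<xi> - fourier f \<xi>) + cmod k * L2_norm (\<lambda>\<xi>. ft (trunc R g) \<xi> - fourier g \<xi>)) \<longlongrightarrow> 0) at_top"
      using tendsto_add[OF fourier_lim[OF f] tendsto_mult_left[OF fourier_lim[OF g], of "cmod k"]] by simp
    have "L2_norm (\<lambda>\<xi>. ft (trunc R (\<lambda>x. f x + k * g x)) \<xi> - (fourier f \<xi> + k * fourier g \<xi>)) \<le> 
       L2_norm (\<lambda>\<xi>. ft (trunc R f) \<xi> - fourier f \<xi>) + cmod k * L2_norm (\<lambda>\<xi>. ft (trunc R g) \<xi> - fourier g \<xi>)" for R
    proof -
      have "(\<lambda>\<xi>. ft (trunc R (\<lambda>x. f x + k * g x)) \<xi> - (fourier f \<xi> + k * fourier g \<xi>)) = 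
         (\<lambda>\<xi>. (ft (trunc R f) \<xi> - fourier f \<xi>) + k * (ft (trunc R g) \<xi> - fourier g \<xi>))"
        unfolding e by (auto simp: algebra_simps)
      then show ?thesis 
        using L2_norm_triangle[OF L2_diff[OF ft_trunc_L2[OF f] fourier_L2[OF f]] 
           L2_cmult[OF L2_diff[OF ft_trunc_L2[OF g] fourier_L2[OF g]], of k], of R R]
        by (simp only: L2_norm_cmult)
    qed
    then show "\<forall>\<^sub>F R in at_top. L2_norm (\<lambda>\<xi>. ft (trunc R (\<lambda>x. f x + k * g x)) \<xi> - (fourier f \<xi> + k * fourier g \<xi>)) \<le> 
       L2_norm (\<lambda>\<xi>. ft (trunc R f) \<xi> - fourier f \<xi>) + cmod k * L2_norm (\<lambda>\<xi>. ft (trunc R g) \<xi> - fourier g \<xi>)"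
      by simp
  qed simp
qed (use f g in \<open>simp_all add: L2_add L2_cmult fourier_L2\<close>)

lemma fourier_norm_add_cmult:
  fixes f :: "'a::euclidean_space \<Rightarrow> complex"
  assumes f: "f \<in> L2" and g: "g \<in> L2"
  shows "L2_norm (\<lambda>\<xi>. fourier f \<xi> + k * fourier g \<xi>) = pconst TYPE('a) * L2_norm (\<lambda>x. f x + k * g x)"
proof -
  have "L2_norm (fourier (\<lambda>x. f x + k * g x)) = L2_norm (\<lambda>\<xi>. fourier f \<xi> + k * fourier g \<xi>)"
    by (rule L2_norm_cong_AE[OF _ _ fourier_add_cmult[OF f g]]) 
       (simp_all add: f g L2_add L2_cmult fourier_L2)
  then show ?thesis
    using fourier_norm[OF L2_add[OF f L2_cmult[OF g, of k]]] by simp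
qed

lemma fourier_norm_diff:
  fixes f :: "'a::euclidean_space \<Rightarrow> complex"
  assumes f: "f \<in> L2" and g: "g \<in> L2"
  shows "L2_norm (\<lambda>\<xi>. fourier f \<xi> - fourier g \<xi>) = pconst TYPE('a) * L2_norm (\<lambda>x. f x - g x)"
  using fourier_norm_add_cmult[OF f g, of "-1"] by simp

lemma fourier_ip:
  fixes f :: "'a::euclidean_space \<Rightarrow> complex"
  assumes f: "f \<in> L2" and g: "g \<in> L2"
  shows "ip (fourier f) (fourier g) = of_real ((pconst TYPE('a))\<^sup>2) * ip f g"
  by (rule polarization[OF f g fourier_L2[OF f] fourier_L2[OF g] fourier_norm_add_cmult[OF f g]])

text \<open>The scaled isometry is injective. This is the uniqueness principle by which weak
  derivatives and multipliers are identified almost everywhere.\<close>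

lemma fourier_AE_eq_iff:
  fixes f :: "'a::euclidean_space \<Rightarrow> complex"
  assumes f: "f \<in> L2" and g: "g \<in> L2"
  shows "(AE \<xi> in lborel. fourier f \<xi> = fourier g \<xi>) \<longleftrightarrow> (AE x in lborel. f x = g x)"
  using L2_norm_eq_0_iff[OF L2_diff[OF f g]] L2_norm_eq_0_iff[OF L2_diff[OF fourier_L2[OF f] fourier_L2[OF g]]]
    fourier_norm_diff[OF f g] pconst_pos[where 'a='a]
  by simp

lemma fourier_eq_ft:
  assumes f: "f \<in> L2" and s: "\<And>x. norm x > R \<Longrightarrow> f x = 0"
  shows "AE \<xi> in lborel. fourier f \<xi> = ft f \<xi>"
proof (rule fourier_eqI[OF f])
  have t: "trunc S f = f" if "S \<ge> R" for S
  proof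
    fix x show "trunc S f x = f x" using s[of x] that by (auto simp: trunc_def indicator_def)
  qed
  show "ft f \<in> L2" by (rule plancherel_ft(1)[OF integrable_bounded_support[OF f s] f])
  show "((\<lambda>S. L2_norm (\<lambda>\<xi>. ft (trunc S f) \<xi> - ft f \<xi>)) \<longlongrightarrow> 0) at_top"
    by (rule tendsto_eventually, rule eventually_mono[OF eventually_ge_at_top[of R]]) (simp add: t)
qed

lemma L2_bilinear_tendsto:
  assumes "\<And>i. f i \<in> L2" "f' \<in> L2" "\<And>i. g i \<in> L2" "g' \<in> L2"
    and f: "((\<lambda>i. L2_norm (\<lambda>x. f i x - f' x)) \<longlongrightarrow> 0) F" and g: "((\<lambda>i. L2_norm (\<lambda>x. g i x - g' x)) \<longlongrightarrow> 0) F"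
  shows "((\<lambda>i. \<integral>x. f i x * g i x \<partial>lborel) \<longlongrightarrow> (\<integral>x. f' x * g' x \<partial>lborel)) F"
proof (rule LIM_zero_cancel, rule Lim_null_comparison)
  let ?b = "\<lambda>i. L2_norm (\<lambda>x. f i x - f' x) * (L2_norm (\<lambda>x. g i x - g' x) + L2_norm g') + L2_norm f' * L2_norm (\<lambda>x. g i x - g' x)"
  have "(?b \<longlongrightarrow> 0 * (0 + L2_norm g') + L2_norm f' * 0) F"
    by (intro tendsto_intros f g)
  then show "(?b \<longlongrightarrow> 0) F" by simp
  have "norm ((\<integral>x. f i x * g i x \<partial>lborel) - (\<integral>x. f' x * g' x \<partial>lborel)) \<le> ?b i" for i
  proof -
    note [simp] = L2_mult_integrable assms L2_diff
    have "(\<integral>x. f i x * g i x \<partial>lborel) - (\<integral>x. f' x * g' x \<partial>lborel) = 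
      (\<integral>x. (f i x - f' x) * g i x \<partial>lborel) + (\<integral>x. f' x * (g i x - g' x) \<partial>lborel)"
      by (simp add: left_diff_distrib right_diff_distrib)
    also have "norm \<dots> \<le> L2_norm (\<lambda>x. f i x - f' x) * L2_norm (g i) + L2_norm f' * L2_norm (\<lambda>x. g i x - g' x)"
      by (intro norm_triangle_le add_mono L2_mult_le) auto
    also have "L2_norm (g i) \<le> L2_norm (\<lambda>x. g i x - g' x) + L2_norm g'"
      using L2_norm_diff_ge[of "g i" g'] by simp
    finally show ?thesis by (simp add: mult_left_mono)
  qed
  then show "\<forall>\<^sub>F i in F. norm ((\<integral>x. f i x * g i x \<partial>lborel) - (\<integral>x. f' x * g' x \<partial>lborel)) \<le> ?b i"
    by simp
qed

text \<open>Both sides are continuous in L2, so the identity passes from truncations to the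
  limit.\<close>

lemma fourier_mult_formula:
  assumes f: "f \<in> L2" and g: "g \<in> L2"
  shows "(\<integral>\<xi>. fourier f \<xi> * g \<xi> \<partial>lborel) = (\<integral>x. f x * fourier g x \<partial>lborel)"
proof -
  note [simp] = f g trunc_L2 ft_trunc_L2 fourier_L2 fourier_lim trunc_tendsto
  have "((\<lambda>R. \<integral>\<xi>. ft (trunc R f) \<xi> * trunc R g \<xi> \<partial>lborel) \<longlongrightarrow> (\<integral>\<xi>. fourier f \<xi> * g \<xi> \<partial>lborel)) at_top"
    by (rule L2_bilinear_tendsto) simp_all
  moreover have "((\<lambda>R. \<integral>x. trunc R f x * ft (trunc R g) x \<partial>lborel) \<longlongrightarrow> (\<integral>x. f x * fourier g x \<partial>lborel)) at_top"
    by (rule L2_bilinear_tendsto) simp_all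
  moreover have "(\<integral>\<xi>. ft (trunc R f) \<xi> * trunc R g \<xi> \<partial>lborel) = (\<integral>x. trunc R f x * ft (trunc R g) x \<partial>lborel)" for R
    by (intro ft_mult_formula trunc_integrable f g)
  ultimately show ?thesis using tendsto_unique[OF trivial_limit_at_top_linorder] by (simp only:)
qed

text \<open>
  The multiplication formula identifies the adjoint of the Fourier transform with its conjugate
  by complex conjugation, which is again a multiple of an isometry; hence it is a multiple of the
  inverse.
\<close>

lemma fourier_surj:
  fixes g :: "'a::euclidean_space \<Rightarrow> complex"
  assumes g: "g \<in> L2"
  obtains f where "f \<in> L2" "AE \<xi> in lborel. fourier f \<xi> = g \<xi>"
proof -
  let ?c = "pconst TYPE('a)"
  note c = pconst_pos[where 'a='a]
  define V :: "('a \<Rightarrow> complex) \<Rightarrow> 'a \<Rightarrow> complex" where "V h = (\<lambda>x. cnj (fourier (\<lambda>\<xi>. cnj (h \<xi>)) x))" for h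
  have V: "h \<in> L2 \<Longrightarrow> V h \<in> L2" for h unfolding V_def by (intro L2_cnj fourier_L2)
  have adj: "ip (fourier f) h = ip f (V h)" if "f \<in> L2" "h \<in> L2" for f h
    using fourier_mult_formula[OF that(1) L2_cnj[OF that(2)]] by (simp add: ip_def V_def)
  have ip_cnj2: "ip (\<lambda>x. cnj (f x)) (\<lambda>x. cnj (h x)) = cnj (ip f h)" for f h :: "'a \<Rightarrow> complex"
    unfolding ip_def by (subst Bochner_Integration.integral_cnj[symmetric]) simp
  have VV: "ip (V f) (V h) = of_real (?c\<^sup>2) * ip f h" if "f \<in> L2" "h \<in> L2" for f h
    unfolding V_def ip_cnj2 using fourier_ip[OF L2_cnj[OF that(1)] L2_cnj[OF that(2)]] 
    by (simp add: ip_cnj2)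
  let ?f = "\<lambda>x. of_real (inverse (?c\<^sup>2)) * V g x"
  have f: "?f \<in> L2" by (intro L2_cmult V g)
  have "AE \<xi> in lborel. fourier ?f \<xi> - g \<xi> = 0"
  proof (rule ip_eq_0_imp)
    fix h :: "'a \<Rightarrow> complex" assume h: "h \<in> L2"
    \<comment> \<open>Adjointness turns the left side into \<open>ip ?f (V h)\<close>; since
      \<open>V\<close> preserves products up to the factor \<open>?c\<^sup>2\<close>, the prefactor
      of \<open>?f\<close> restores \<open>ip g h\<close>.\<close>
    have "ip (fourier ?f) h = ip g h"
      using c unfolding adj[OF f h] ip_cmult_left VV[OF g h] by simp
    then show "ip (\<lambda>\<xi>. fourier ?f \<xi> - g \<xi>) h = 0"
      using h g f by (simp add: ip_diff_left fourier_L2)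
  qed (intro L2_diff fourier_L2 f g)
  then show ?thesis using that[OF f] by simp
qed

subsection \<open>Smooth functions\<close>

lemma frechet_eqI: "(f has_derivative f') (at x) \<Longrightarrow> frechet_derivative f (at x) = f'"
  by (rule frechet_derivative_at[symmetric])

lemma Ck_Suc_D: "Ck (Suc k) f \<Longrightarrow> Ck k f"
proof (induction k arbitrary: f)
  case 0
  then show ?case by (auto intro!: continuous_at_imp_continuous_on differentiable_imp_continuous_within)
next
  case (Suc k)
  from Suc.prems have d: "\<And>x. f differentiable (at x)" 
    and c: "\<And>i. i \<in> Basis \<Longrightarrow> Ck (Suc k) (\<lambda>x. frechet_derivative f (at x) i)"
    unfolding Ck.simps(2)[of "Suc k"] by blast+
  show ?case unfolding Ck.simps(2) using d Suc.IH[OF c] by blast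
qed

lemma Ck_differentiable: "Ck (Suc k) f \<Longrightarrow> f differentiable (at x)"
  by simp

lemma Ck_has_derivative: "Ck (Suc k) f \<Longrightarrow> (f has_derivative frechet_derivative f (at x)) (at x)"
  by (rule frechet_derivative_works[THEN iffD1, OF Ck_differentiable])

text \<open>Exchanges the chosen \<open>frechet_derivative\<close> for any derivative known
  explicitly, which is what makes inductions over the order of differentiability short.\<close>

lemma Ck_SucI:
  assumes "\<And>x. (f has_derivative f' x) (at x)" "\<And>i. i \<in> Basis \<Longrightarrow> Ck k (\<lambda>x. f' x i)"
  shows "Ck (Suc k) f"
  using assms(2) frechet_eqI[OF assms(1)] by (auto intro: differentiableI assms(1))

lemma Ck_const: "Ck k (\<lambda>x. c)"
proof (induction k arbitrary: c)
  case (Suc k) show ?case by (rule Ck_SucI[OF has_derivative_const]) (rule Suc)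
qed simp

lemma Ck_add: "Ck k f \<Longrightarrow> Ck k g \<Longrightarrow> Ck k (\<lambda>x. f x + g x)"
proof (induction k arbitrary: f g)
  case 0 then show ?case by (simp add: continuous_on_add)
next
  case (Suc k)
  show ?case
    by (rule Ck_SucI[OF has_derivative_add[OF Ck_has_derivative[OF Suc.prems(1)] Ck_has_derivative[OF Suc.prems(2)]]])
       (use Suc in auto)
qed

lemma Ck_linear_image:
  assumes h: "bounded_linear h" shows "Ck k f \<Longrightarrow> Ck k (\<lambda>x. h (f x))"
proof (induction k arbitrary: f)
  case 0 then show ?case by (simp add: bounded_linear.continuous_on[OF h])
next
  case (Suc k)
  show ?case
    by (rule Ck_SucI[OF bounded_linear.has_derivative[OF h Ck_has_derivative[OF Suc.prems]]])
       (use Suc in auto)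
qed

text \<open>Leibniz's rule produces two terms of the same bilinear shape, so the induction closes
  for ordinary, scalar and inner products at once.\<close>

lemma Ck_bilinear:
  assumes p: "bounded_bilinear p" shows "Ck k f \<Longrightarrow> Ck k g \<Longrightarrow> Ck k (\<lambda>x. p (f x) (g x))"
proof (induction k arbitrary: f g)
  case 0 then show ?case by (simp add: bounded_bilinear.continuous_on[OF p])
next
  case (Suc k)
  show ?case
    by (rule Ck_SucI[OF bounded_bilinear.FDERIV[OF p Ck_has_derivative[OF Suc.prems(1)] Ck_has_derivative[OF Suc.prems(2)]]])
       (use Suc Suc.prems[THEN Ck_Suc_D] in \<open>auto intro!: Ck_add\<close>)
qed

lemmas Ck_mult = Ck_bilinear[OF bounded_bilinear_mult]
lemmas Ck_scaleR = Ck_bilinear[OF bounded_bilinear_scaleR]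
lemmas Ck_inner = Ck_bilinear[OF bounded_bilinear_inner]
lemmas Ck_of_real = Ck_linear_image[OF bounded_linear_of_real]
lemmas Ck_cnj = Ck_linear_image[OF bounded_linear_cnj]

lemma Ck_minus: "Ck k f \<Longrightarrow> Ck k (\<lambda>x. - f x)"
  by (rule Ck_linear_image[OF bounded_linear_minus[OF bounded_linear_ident]])

lemma Ck_diff: "Ck k f \<Longrightarrow> Ck k g \<Longrightarrow> Ck k (\<lambda>x. f x - g x)"
  using Ck_add[OF _ Ck_minus, of k f g] by simp

lemma Ck_linear:
  assumes h: "bounded_linear h" shows "Ck k h"
proof (cases k)
  case 0 then show ?thesis using bounded_linear.continuous_on[OF h continuous_on_id] by simp
next
  case (Suc j)
  show ?thesis unfolding Suc by (rule Ck_SucI[OF bounded_linear_imp_has_derivative[OF h]]) (rule Ck_const)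
qed

lemma frechet_derivative_real_scale:
  fixes h :: "real \<Rightarrow> 'b::real_normed_vector"
  assumes "h differentiable (at t)"
  shows "frechet_derivative h (at t) c = c *\<^sub>R frechet_derivative h (at t) 1"
  using linear_scale[OF linear_frechet_derivative[OF assms], of c 1] by simp

text \<open>On the real line a derivative is determined by its value at 1, so the chain rule again
  gives a composition of the same kind times a scalar factor.\<close>

lemma Ck_compose_real:
  fixes h :: "real \<Rightarrow> 'b::real_normed_vector" and p :: "'a::euclidean_space \<Rightarrow> real"
  shows "Ck k h \<Longrightarrow> Ck k p \<Longrightarrow> Ck k (\<lambda>x. h (p x))"
proof (induction k arbitrary: h p)
  case 0 then show ?case by (auto intro: continuous_on_compose2)
next
  case (Suc k)
  have "((\<lambda>x. h (p x)) has_derivative (\<lambda>v. frechet_derivative p (at x) v *\<^sub>R frechet_derivative h (at (p x)) 1)) (at x)" for x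
    using has_derivative_compose[OF Ck_has_derivative[OF Suc.prems(2)] Ck_has_derivative[OF Suc.prems(1)], of x]
    by (subst (asm) frechet_derivative_real_scale[OF Ck_differentiable[OF Suc.prems(1)]])
  then show ?case
  proof (rule Ck_SucI)
    fix i :: 'a assume i: "i \<in> Basis"
    have "Ck k (\<lambda>t. frechet_derivative h (at t) 1)" using Suc.prems(1) by simp
    from Suc.IH[OF this Ck_Suc_D[OF Suc.prems(2)]] 
    show "Ck k (\<lambda>x. frechet_derivative p (at x) i *\<^sub>R frechet_derivative h (at (p x)) 1)"
      using Suc.prems(2) i by (intro Ck_scaleR) auto
  qed
qed

lemma Ck_inverse:
  fixes f :: "'a::euclidean_space \<Rightarrow> real"
  assumes f: "\<And>k. Ck k f" and nz: "\<And>x. f x \<noteq> 0" shows "Ck k (\<lambda>x. inverse (f x))"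
proof (induction k)
  case 0 show ?case using f[of 0] nz by (simp add: continuous_on_inverse)
next
  case (Suc k)
  have "((\<lambda>x. inverse (f x)) has_derivative (\<lambda>v. - (inverse (f x) * frechet_derivative f (at x) v * inverse (f x)))) (at x)" for x
    by (rule Deriv.has_derivative_inverse[OF nz Ck_has_derivative[OF f]])
  then show ?case
    by (rule Ck_SucI) (use f[of "Suc k"] in \<open>auto intro!: Ck_minus Ck_mult Suc\<close>)
qed

text \<open>The factor \<open>c\<close> is the induction parameter: differentiation only multiplies
  it by i.\<close>

lemma Ck_cis: "Ck k (\<lambda>t. c * cis t)"
proof (induction k arbitrary: c)
  case 0 show ?case by (simp add: continuous_intros)
next
  case (Suc k)
  have "((\<lambda>t. c * cis t) has_derivative (\<lambda>v. of_real v * ((c * \<i>) * cis t))) (at t)" for t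
    by (auto intro!: derivative_eq_intros simp: scaleR_conv_of_real mult_ac has_vector_derivative_def[symmetric])
  then show ?case
    by (rule Ck_SucI) (simp add: Suc)
qed

section \<open>A smooth step function\<close>

definition flat :: "real poly \<Rightarrow> real \<Rightarrow> real" where
  "flat q x = (if x > 0 then poly q (1 / x) * exp (- 1 / x) else 0)"

lemma flat_lim:
  fixes q :: "real poly"
  shows "((\<lambda>x. poly q (1 / x) * exp (- 1 / x)) \<longlongrightarrow> 0) (at_right 0)"
proof -
  have "((\<lambda>y. poly q y / exp y) \<longlongrightarrow> 0) at_top"
  proof -
    have "((\<lambda>y::real. \<Sum>i\<le>degree q. coeff q i * (y ^ i / exp y)) \<longlongrightarrow> (\<Sum>i\<le>degree q. coeff q i * 0)) at_top"
      by (intro tendsto_intros tendsto_power_div_exp_0)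
    then show ?thesis by (simp add: poly_altdef sum_divide_distrib)
  qed
  from filterlim_compose[OF this filterlim_inverse_at_top_right]
  show ?thesis by (simp add: exp_minus field_simps inverse_eq_divide)
qed

text \<open>The polynomial factor makes the family closed under differentiation, so smoothness of
  every member is a plain induction. With y = 1/x the chain rule contributes -y^2, whence the new
  polynomial y^2 (q - q'). At 0 the right difference quotient is the profile of y q, which tends to
  0.\<close>

lemma flat_deriv:
  "(flat q has_real_derivative flat ([:0, 0, 1:] * (q - pderiv q)) x) (at x)"
proof -
  consider "x > 0" | "x < 0" | "x = 0" by linarith
  then show ?thesis
  proof cases
    case 1
    have "((\<lambda>x. poly q (1 / x) * exp (- 1 / x)) has_real_derivative flat ([:0, 0, 1:] * (q - pderiv q)) x) (at x)"
      using 1 by (auto intro!: derivative_eq_intros DERIV_chain'[OF _ poly_DERIV] simp: flat_def field_simps power2_eq_square)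
    then show ?thesis
      by (rule has_field_derivative_transform_within_open[of _ _ _ "{0<..}"]) (use 1 in \<open>auto simp: flat_def\<close>)
  next
    case 2
    have "((\<lambda>x. 0) has_real_derivative flat ([:0, 0, 1:] * (q - pderiv q)) x) (at x)"
      using 2 by (simp add: flat_def)
    then show ?thesis
      by (rule has_field_derivative_transform_within_open[of _ _ _ "{..<0}"]) (use 2 in \<open>auto simp: flat_def\<close>)
  next
    case 3
    have r: "((\<lambda>h. (flat q (0 + h) - flat q 0) / h) \<longlongrightarrow> 0) (at_right 0)"
    proof (rule Lim_transform_eventually[OF flat_lim[of "[:0, 1:] * q"]])
      show "\<forall>\<^sub>F x in at_right 0. poly ([:0, 1:] * q) (1 / x) * exp (- 1 / x) = (flat q (0 + x) - flat q 0) / x"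
        using eventually_at_right_less[of 0] by eventually_elim (simp add: flat_def)
    qed
    have l: "((\<lambda>h. (flat q (0 + h) - flat q 0) / h) \<longlongrightarrow> 0) (at_left 0)"
    proof (rule tendsto_eventually)
      show "\<forall>\<^sub>F h in at_left 0. (flat q (0 + h) - flat q 0) / h = 0"
        by (auto simp: eventually_at_left_field flat_def intro: exI[of _ "-1"])
    qed
    show ?thesis unfolding 3 DERIV_def using filterlim_split_at[OF l r] by (simp add: flat_def)
  qed
qed

lemma Ck_flat: "Ck k (flat q)"
proof (induction k arbitrary: q)
  case 0
  show ?case using DERIV_isCont[OF flat_deriv] by (simp add: continuous_at_imp_continuous_on)
next
  case (Suc k)
  show ?case
    by (rule Ck_SucI[OF flat_deriv[unfolded has_field_derivative_def]]) 
       (simp add: Suc Ck_mult Ck_const del: mult_pCons_left)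
qed

text \<open>The usual quotient of profiles exp(-1/x); the denominator cannot vanish because x and 1
  - x are not both non-positive. The function serves twice: as a spatial cut-off and, through its
  rescaled derivative, as an approximate point mass in time.\<close>

definition step :: "real \<Rightarrow> real" where
  "step x = flat 1 (1 - x) * inverse (flat 1 x + flat 1 (1 - x))"

lemma step_denominator_pos: "flat 1 x + flat 1 (1 - x) > 0"
  by (auto simp: flat_def add_pos_pos)

lemma Ck_step: "Ck k step"
proof -
  have c: "Ck k (\<lambda>x::real. flat 1 (1 - x))" for k
    by (rule Ck_compose_real[OF Ck_flat Ck_diff[OF Ck_const Ck_linear[OF bounded_linear_ident]]])
  have "Ck k (\<lambda>x. inverse (flat 1 x + flat 1 (1 - x)))"
    by (intro Ck_inverse Ck_add Ck_flat c) (use step_denominator_pos in \<open>metis less_irrefl\<close>)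
  then show ?thesis unfolding step_def[abs_def] by (intro Ck_mult c)
qed

lemma step_range: "0 \<le> step x" "step x \<le> 1" 
  using step_denominator_pos[of x] by (auto simp: step_def flat_def field_simps)

lemma step_simps: "x \<le> 0 \<Longrightarrow> step x = 1" "1 \<le> x \<Longrightarrow> step x = 0"
  by (auto simp: step_def flat_def)

definition step' :: "real \<Rightarrow> real" where
  "step' x = frechet_derivative step (at x) 1"

lemma step_deriv: "(step has_real_derivative step' x) (at x)"
proof -
  have "(step has_derivative frechet_derivative step (at x)) (at x)"
    by (rule Ck_has_derivative[OF Ck_step[of 1, unfolded One_nat_def]])
  moreover have "frechet_derivative step (at x) = (*) (step' x)"
  proof
    fix c show "frechet_derivative step (at x) c = step' x * c"
      using frechet_derivative_real_scale[OF Ck_differentiable[OF Ck_step[of "Suc 0"]], of x c]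
      by (simp add: step'_def)
  qed
  ultimately show ?thesis by (simp add: has_field_derivative_def)
qed

lemma Ck_step': "Ck k step'"
  using Ck_step[of "Suc k"] by (simp add: step'_def[abs_def])

lemma step'_0: "x < 0 \<or> 1 < x \<Longrightarrow> step' x = 0"
proof (elim disjE)
  assume "x < 0"
  have "(step has_real_derivative 0) (at x)"
    by (rule has_field_derivative_transform_within_open[of "\<lambda>_. 1" _ _ "{..<0}"]) (use \<open>x < 0\<close> in \<open>auto simp: step_simps\<close>)
  then show ?thesis using DERIV_unique step_deriv by blast
next
  assume "1 < x"
  have "(step has_real_derivative 0) (at x)"
    by (rule has_field_derivative_transform_within_open[of "\<lambda>_. 0" _ _ "{1<..}"]) (use \<open>1 < x\<close> in \<open>auto simp: step_simps\<close>)
  then show ?thesis using DERIV_unique step_deriv by blast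
qed

lemma step'_bounded: obtains C where "C > 0" "\<And>x. \<bar>step' x\<bar> \<le> C"
proof -
  have "continuous_on {0..1} step'" using Ck_step'[of 0] continuous_on_subset by auto
  then have "bounded (step' ` {0..1})" by (intro compact_imp_bounded compact_continuous_image) auto
  then obtain C where C: "C > 0" "\<And>x. x \<in> {0..1} \<Longrightarrow> \<bar>step' x\<bar> \<le> C" by (auto simp: bounded_pos)
  then have "\<bar>step' x\<bar> \<le> C" for x using step'_0[of x] by (cases "x \<in> {0..1}") auto
  with C(1) show ?thesis by (rule that)
qed

text \<open>The square of the norm is used because the norm is not smooth at the origin. The shift
  by 1 makes the function 1 on the ball of radius R and 0 beyond radius sqrt(2) R; the rounder
  radius 2 R suffices below.\<close>

definition cutoff :: "real \<Rightarrow> 'a::euclidean_space \<Rightarrow> real" where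
  "cutoff R x = step ((x \<bullet> x) / R\<^sup>2 - 1)"

definition cutoff' :: "real \<Rightarrow> 'a::euclidean_space \<Rightarrow> 'a \<Rightarrow> real" where
  "cutoff' R i x = step' ((x \<bullet> x) / R\<^sup>2 - 1) * (2 * (x \<bullet> i) / R\<^sup>2)"

lemma cutoff_range: "0 \<le> cutoff R x" "cutoff R x \<le> 1"
  by (simp_all add: cutoff_def step_range)

lemma cutoff_1: "R > 0 \<Longrightarrow> norm x \<le> R \<Longrightarrow> cutoff R x = 1"
  unfolding cutoff_def by (rule step_simps) (simp add: power2_norm_eq_inner[symmetric] power_mono)

lemma cutoff_arg_ge: "R > 0 \<Longrightarrow> norm x > 2 * R \<Longrightarrow> 1 < (x \<bullet> x) / R\<^sup>2 - 1"
proof -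
  assume R: "R > 0" "norm x > 2 * R"
  then have "(2 * R)\<^sup>2 < (norm x)\<^sup>2" by (intro power_strict_mono) auto
  then have "4 < (x \<bullet> x) / R\<^sup>2" using R by (simp add: power_mult_distrib power2_norm_eq_inner field_simps)
  then show ?thesis by simp
qed

lemma cutoff_0: "R > 0 \<Longrightarrow> norm x > 2 * R \<Longrightarrow> cutoff R x = 0"
  unfolding cutoff_def by (rule step_simps) (use cutoff_arg_ge[of R x] in simp)

lemma cutoff'_0: "R > 0 \<Longrightarrow> norm x > 2 * R \<Longrightarrow> cutoff' R i x = 0"
  unfolding cutoff'_def using step'_0 cutoff_arg_ge[of R x] by simp

lemma Ck_cutoff: "Ck k (cutoff R)"
proof -
  have "Ck k (\<lambda>x::'a. (x \<bullet> x) * inverse (R\<^sup>2) - 1)" 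
    by (intro Ck_diff Ck_mult Ck_inner Ck_const Ck_linear bounded_linear_ident)
  from Ck_compose_real[OF Ck_step this] show ?thesis by (simp add: cutoff_def[abs_def] divide_inverse)
qed

lemma cutoff_deriv: "(cutoff R has_derivative (\<lambda>v. cutoff' R v x)) (at x)"
proof -
  have "((\<lambda>x::'a. (x \<bullet> x) / R\<^sup>2 - 1) has_derivative (\<lambda>v. 2 * (x \<bullet> v) / R\<^sup>2)) (at x)"
    unfolding divide_inverse by (auto intro!: derivative_eq_intros simp: inner_commute)
  from has_derivative_compose[OF this step_deriv[unfolded has_field_derivative_def]]
  show ?thesis by (simp add: cutoff_def[abs_def] cutoff'_def)
qed

text \<open>The decay in R removes the term in which the derivative falls on the cut-off. The
  constant arises from \<open>2 * (x \<bullet> i)\<close>, which is at most 4 R on the ball of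
  radius 2 R that contains the support.\<close>

lemma cutoff'_bound:
  obtains C where "C > 0" "\<And>R i (x::'a::euclidean_space). R > 0 \<Longrightarrow> i \<in> Basis \<Longrightarrow> \<bar>cutoff' R i x\<bar> \<le> C / R"
proof -
  obtain C where C: "C > 0" "\<And>x. \<bar>step' x\<bar> \<le> C" using step'_bounded by blast
  have "\<bar>cutoff' R i x\<bar> \<le> 4 * C / R" if R: "R > 0" and i: "i \<in> Basis" for R and i x :: 'a
  proof (cases "norm x > 2 * R")
    case False
    have "\<bar>x \<bullet> i\<bar> \<le> norm x" using i Basis_le_norm by blast
    then have "\<bar>2 * (x \<bullet> i) / R\<^sup>2\<bar> \<le> 2 * (2 * R) / R\<^sup>2"
      using False R by (auto simp: abs_mult intro!: divide_right_mono)
    then have "\<bar>cutoff' R i x\<bar> \<le> C * (2 * (2 * R) / R\<^sup>2)"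
      unfolding cutoff'_def abs_mult[of "step' _"] using C by (intro mult_mono) auto
    then show ?thesis using R by (simp add: power2_eq_square mult.commute)
  qed (use R C cutoff'_0[OF R, of x i] in simp)
  with C(1) show ?thesis by (intro that[of "4 * C"]) auto
qed

subsection \<open>Weak derivatives on the Fourier side\<close>

lemma test_functionD:
  fixes \<phi> :: "'a::euclidean_space \<Rightarrow> complex"
  assumes "\<phi> \<in> test_functions UNIV"
  shows "Ck k \<phi>" "\<phi> differentiable (at x)" "\<exists>R. \<forall>x. norm x > R \<longrightarrow> \<phi> x = 0"
proof -
  show c: "\<And>k. Ck k \<phi>" using assms by (simp add: test_functions_def)
  from c[of "Suc 0"] show "\<phi> differentiable (at x)" by simp
  from assms obtain K where K: "compact K" "\<And>x. x \<notin> K \<Longrightarrow> \<phi> x = 0" by (auto simp: test_functions_def)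
  from compact_imp_bounded[OF K(1)] obtain R where "\<And>x. x \<in> K \<Longrightarrow> norm x \<le> R" by (auto simp: bounded_iff)
  with K(2) show "\<exists>R. \<forall>x. norm x > R \<longrightarrow> \<phi> x = 0" by (metis not_le)
qed

lemma test_functionI:
  fixes \<phi> :: "'a::euclidean_space \<Rightarrow> 'b::real_normed_vector"
  assumes "\<And>k. Ck k \<phi>" "\<And>x. norm x > R \<Longrightarrow> \<phi> x = 0"
  shows "\<phi> \<in> test_functions UNIV"
  unfolding test_functions_def using assms 
  by (auto intro!: exI[of _ "cball 0 R"] simp: not_le)

lemma test_function_deriv_0:
  fixes \<phi> :: "'a::euclidean_space \<Rightarrow> complex"
  assumes "\<And>x. norm x > R \<Longrightarrow> \<phi> x = 0" "norm x > R"
  shows "frechet_derivative \<phi> (at x) = (\<lambda>v. 0)"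
proof (rule frechet_eqI)
  have "((\<lambda>x. 0) has_derivative (\<lambda>v. 0)) (at x)" by simp
  then show "(\<phi> has_derivative (\<lambda>v. 0)) (at x)"
  proof (rule has_derivative_transform_within_open)
    show "open {x. norm x > R}" by (intro open_Collect_less continuous_intros)
  qed (use assms in auto)
qed

lemma Ck_bounded:
  fixes \<phi> :: "'a::euclidean_space \<Rightarrow> complex"
  assumes "Ck 0 \<phi>" "\<And>x. norm x > R \<Longrightarrow> \<phi> x = 0"
  obtains B where "B > 0" "\<And>x. cmod (\<phi> x) \<le> B"
proof -
  have "continuous_on (cball 0 R) \<phi>" using assms(1) continuous_on_subset by auto
  then have "bounded (\<phi> ` cball 0 R)" by (intro compact_imp_bounded compact_continuous_image) auto
  then obtain B where "B > 0" "\<And>x. x \<in> cball 0 R \<Longrightarrow> cmod (\<phi> x) \<le> B" by (auto simp: bounded_pos)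
  then have "B > 0" "\<And>x. cmod (\<phi> x) \<le> B"
    using assms(2) by (auto simp: not_le) (metis less_imp_le norm_zero not_le)
  then show ?thesis by (rule that)
qed

lemma Ck_compact_L2:
  fixes \<phi> :: "'a::euclidean_space \<Rightarrow> complex"
  assumes "Ck 0 \<phi>" "\<And>x. norm x > R \<Longrightarrow> \<phi> x = 0"
  shows "\<phi> \<in> L2"
proof -
  obtain B where "\<And>x. cmod (\<phi> x) \<le> B" using Ck_bounded[OF assms] by blast
  moreover have "\<phi> \<in> borel_measurable borel"
    using assms(1) by (simp add: borel_measurable_continuous_onI)
  ultimately show ?thesis using assms(2) by (intro L2_bounded_support)
qed

lemma test_function_L2:
  fixes \<phi> :: "'a::euclidean_space \<Rightarrow> complex"
  assumes "\<phi> \<in> test_functions UNIV"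
  shows "\<phi> \<in> L2"
  using test_functionD(3)[OF assms] Ck_compact_L2[OF test_functionD(1)[OF assms]] by blast

lemma test_function_deriv:
  fixes \<phi> :: "'a::euclidean_space \<Rightarrow> complex"
  assumes \<phi>: "\<phi> \<in> test_functions UNIV" and i: "i \<in> Basis"
  shows "(\<lambda>x. frechet_derivative \<phi> (at x) i) \<in> test_functions UNIV"
proof -
  obtain R where R: "\<And>x. norm x > R \<Longrightarrow> \<phi> x = 0" using test_functionD(3)[OF \<phi>] by blast
  show ?thesis
  proof (rule test_functionI)
    show "Ck k (\<lambda>x. frechet_derivative \<phi> (at x) i)" for k
      using test_functionD(1)[OF \<phi>, of "Suc k"] i by simp
    show "norm x > R \<Longrightarrow> frechet_derivative \<phi> (at x) i = 0" for x
      by (simp add: test_function_deriv_0[OF R])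
  qed
qed

lemma test_function_cnj:
  fixes \<phi> :: "'a::euclidean_space \<Rightarrow> complex"
  assumes "\<phi> \<in> test_functions UNIV" shows "(\<lambda>x. cnj (\<phi> x)) \<in> test_functions UNIV"
  using test_functionD[OF assms] by (auto intro!: test_functionI Ck_cnj)

lemma test_function_mult:
  fixes \<phi> :: "'a::euclidean_space \<Rightarrow> complex"
  assumes "\<phi> \<in> test_functions UNIV" "\<psi> \<in> test_functions UNIV" 
  shows "(\<lambda>x. \<phi> x * \<psi> x) \<in> test_functions UNIV"
proof -
  obtain R where "\<And>x. norm x > R \<Longrightarrow> \<phi> x = 0" using test_functionD(3)[OF assms(1)] by blast
  then show ?thesis using test_functionD(1)[OF assms(1)] test_functionD(1)[OF assms(2)]
    by (intro test_functionI[where R=R] Ck_mult) auto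
qed

lemma has_vector_derivative_quotient:
  assumes "(f has_vector_derivative D) (at t)"
  shows "((\<lambda>h. (f (t + h) - f t) /\<^sub>R h) \<longlongrightarrow> D) (at 0)"
proof (rule LIM_zero_cancel, rule Lim_null_comparison)
  show "((\<lambda>h. norm (f (t + h) - f t - h *\<^sub>R D) / norm h) \<longlongrightarrow> 0) (at 0)"
    using assms by (simp add: has_vector_derivative_def has_derivative_at)
  have "norm ((f (t + h) - f t) /\<^sub>R h - D) = norm (f (t + h) - f t - h *\<^sub>R D) / norm h" if "h \<noteq> 0" for h
  proof -
    have "(f (t + h) - f t) /\<^sub>R h - D = (f (t + h) - f t - h *\<^sub>R D) /\<^sub>R h"
      using that by (simp add: scaleR_right_diff_distrib)
    then show ?thesis by (simp add: divide_inverse_commute)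
  qed
  then show "\<forall>\<^sub>F h in at 0. norm ((f (t + h) - f t) /\<^sub>R h - D) \<le> norm (f (t + h) - f t - h *\<^sub>R D) / norm h"
    by (simp add: eventually_at_filter)
qed

text \<open>Difference quotients have integral zero by translation invariance. They are bounded by
  the maximum of the derivative and, for increments of length at most 1, vanish off one fixed ball,
  so dominated convergence applies.\<close>

lemma integral_deriv_test_function:
  fixes \<phi> :: "'a::euclidean_space \<Rightarrow> complex"
  assumes \<phi>: "\<phi> \<in> test_functions UNIV" and i: "i \<in> Basis"
  shows "(\<integral>x. frechet_derivative \<phi> (at x) i \<partial>lborel) = 0"
proof -
  obtain R where R: "\<And>x. norm x > R \<Longrightarrow> \<phi> x = 0" using test_functionD(3)[OF \<phi>] by blast
  let ?d = "\<lambda>x. frechet_derivative \<phi> (at x) i"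
  have d: "?d \<in> test_functions UNIV" by (rule test_function_deriv[OF \<phi> i])
  have d0: "norm x > R \<Longrightarrow> ?d x = 0" for x by (simp add: test_function_deriv_0[OF R])
  obtain B where B: "B > 0" "\<And>x. cmod (?d x) \<le> B"
    using Ck_bounded[OF test_functionD(1)[OF d] d0] by blast
  define h where "h n = inverse (real (Suc n))" for n
  have h: "0 < h n" "h n \<le> 1" for n by (auto simp: h_def field_simps)
  have h0: "h \<longlonglongrightarrow> 0" unfolding h_def by (rule LIMSEQ_inverse_real_of_nat)
  have der: "((\<lambda>t. \<phi> (x + t *\<^sub>R i)) has_vector_derivative ?d (x + t *\<^sub>R i)) (at t)" for x t
  proof -
    have 1: "((\<lambda>t. x + t *\<^sub>R i) has_derivative (\<lambda>c. c *\<^sub>R i)) (at t)"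
      by (auto intro!: derivative_eq_intros)
    have 2: "(\<phi> has_derivative frechet_derivative \<phi> (at (x + t *\<^sub>R i))) (at (x + t *\<^sub>R i))"
      using test_functionD(2)[OF \<phi>] frechet_derivative_works by blast
    have "frechet_derivative \<phi> (at (x + t *\<^sub>R i)) (c *\<^sub>R i) = c *\<^sub>R ?d (x + t *\<^sub>R i)" for c
      by (rule linear_scale[OF linear_frechet_derivative[OF test_functionD(2)[OF \<phi>]]])
    with has_derivative_compose[OF 1 2] show ?thesis by (simp add: has_vector_derivative_def)
  qed
  have mv: "cmod (\<phi> (x + h n *\<^sub>R i) - \<phi> x) \<le> B * h n" for x n
  proof -
    have "norm (\<phi> (x + h n *\<^sub>R i) - \<phi> (x + 0 *\<^sub>R i)) \<le> B * norm (h n - 0)"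
    proof (rule differentiable_bound[of "{0..h n}"])
      show "((\<lambda>t. \<phi> (x + t *\<^sub>R i)) has_derivative (\<lambda>c. c *\<^sub>R ?d (x + t *\<^sub>R i))) (at t within {0..h n})" for t
        using der[of x t] has_derivative_at_withinI by (simp add: has_vector_derivative_def)
      show "onorm (\<lambda>c. c *\<^sub>R ?d (x + t *\<^sub>R i)) \<le> B" for t
        by (rule onorm_le) (use B(2)[of "x + t *\<^sub>R i"] in \<open>simp add: mult.commute[of B] mult_left_mono\<close>)
    qed (use h[of n] in auto)
    then show ?thesis using h[of n] by simp
  qed
  have \<phi>m[measurable]: "\<phi> \<in> borel_measurable borel" using test_function_L2[OF \<phi>] by auto
  have [measurable]: "?d \<in> borel_measurable borel" using test_function_L2[OF d] by auto
  have \<phi>i: "integrable lborel \<phi>" by (rule integrable_bounded_support[OF test_function_L2[OF \<phi>] R])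
  have "(\<lambda>n. \<integral>x. (\<phi> (x + h n *\<^sub>R i) - \<phi> x) /\<^sub>R h n \<partial>lborel) \<longlonglongrightarrow> (\<integral>x. ?d x \<partial>lborel)"
  proof (rule integral_dominated_convergence)
    show "integrable lborel (\<lambda>x::'a. B * indicator (cball 0 (R + 1)) x :: real)"
      by (intro integrable_mult_right integrable_indicator_cball)
    show "AE x in lborel. (\<lambda>n. (\<phi> (x + h n *\<^sub>R i) - \<phi> x) /\<^sub>R h n) \<longlonglongrightarrow> ?d x"
    proof (rule AE_I2)
      fix x
      note A = has_vector_derivative_quotient[OF der[of x 0]]
      have B: "filterlim h (at 0) sequentially"
        using h0 h(1) by (auto simp: filterlim_at less_imp_neq[symmetric])
      show "(\<lambda>n. (\<phi> (x + h n *\<^sub>R i) - \<phi> x) /\<^sub>R h n) \<longlonglongrightarrow> ?d x"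
        using filterlim_compose[OF A B] by simp
    qed
    show "AE x in lborel. norm ((\<phi> (x + h n *\<^sub>R i) - \<phi> x) /\<^sub>R h n) \<le> B * indicator (cball 0 (R + 1)) x" for n
    proof (rule AE_I2)
      fix x :: 'a
      show "norm ((\<phi> (x + h n *\<^sub>R i) - \<phi> x) /\<^sub>R h n) \<le> B * indicator (cball 0 (R + 1)) x"
      proof (cases "norm x > R + 1")
        case True
        have "norm x \<le> norm (x + h n *\<^sub>R i) + norm (h n *\<^sub>R i)"
          using norm_triangle_ineq4[of "x + h n *\<^sub>R i" "h n *\<^sub>R i"] by simp
        then have "norm (x + h n *\<^sub>R i) > R" using True h[of n] i by (simp add: norm_Basis)
        with R True show ?thesis by simp
      next
        case False
        have "norm ((\<phi> (x + h n *\<^sub>R i) - \<phi> x) /\<^sub>R h n) = cmod (\<phi> (x + h n *\<^sub>R i) - \<phi> x) / h n"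
          using h[of n] by (simp only: norm_scaleR) (simp add: divide_inverse_commute)
        also have "\<dots> \<le> B" using mv[of x n] h[of n] by (simp add: divide_le_eq)
        finally show ?thesis using False by (simp add: indicator_def)
      qed
    qed
  qed measurable
  moreover have "(\<integral>x. (\<phi> (x + h n *\<^sub>R i) - \<phi> x) /\<^sub>R h n \<partial>lborel) = 0" for n
    using lborel_integrable_affine[OF _ \<phi>i, of 1 "h n *\<^sub>R i"] \<phi>i lborel_integral_translate[OF \<phi>m, of "h n *\<^sub>R i"]
    by (simp add: add.commute)
  ultimately have "(\<lambda>n::nat. 0) \<longlonglongrightarrow> (\<integral>x. ?d x \<partial>lborel)" by (simp only:)
  then show ?thesis by (simp add: LIMSEQ_const_iff)
qed

text \<open>Integration by parts, as the vanishing integral of the derivative of a product of two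
  test functions.\<close>

lemma test_function_weak_partial:
  fixes \<phi> :: "'a::euclidean_space \<Rightarrow> complex"
  assumes \<phi>: "\<phi> \<in> test_functions UNIV" and i: "i \<in> Basis"
  shows "is_weak_partial i \<phi> (\<lambda>x. frechet_derivative \<phi> (at x) i)"
  unfolding is_weak_partial_def
proof (intro conjI ballI)
  show "(\<lambda>x. frechet_derivative \<phi> (at x) i) \<in> L2"
    by (intro test_function_L2 test_function_deriv \<phi> i)
  fix \<psi> :: "'a \<Rightarrow> complex" assume \<psi>: "\<psi> \<in> test_functions UNIV"
  have "frechet_derivative (\<lambda>x. \<phi> x * \<psi> x) (at x) = 
     (\<lambda>v. \<phi> x * frechet_derivative \<psi> (at x) v + frechet_derivative \<phi> (at x) v * \<psi> x)" for x
    using test_functionD(2)[OF \<phi>] test_functionD(2)[OF \<psi>] unfolding frechet_derivative_works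
    by (intro frechet_eqI has_derivative_mult)
  then have "(\<integral>x. \<phi> x * frechet_derivative \<psi> (at x) i + frechet_derivative \<phi> (at x) i * \<psi> x \<partial>lborel) = 0"
    using integral_deriv_test_function[OF test_function_mult[OF \<phi> \<psi>] i] by simp
  then show "(\<integral>x. \<phi> x * frechet_derivative \<psi> (at x) i \<partial>lborel) = - (\<integral>x. frechet_derivative \<phi> (at x) i * \<psi> x \<partial>lborel)"
    using \<phi> \<psi> i by (simp add: L2_mult_integrable test_function_L2 test_function_deriv eq_neg_iff_add_eq_0)
qed

text \<open>A plane wave is the natural function to test a weak derivative with, but its support is
  not compact; the cut-off makes it admissible at the price of one extra term.\<close>

lemma wave_cutoff_test_function:
  assumes R: "R > 0"
  shows "(\<lambda>x. cis (- (x \<bullet> \<xi>)) * of_real (cutoff R x)) \<in> test_functions UNIV"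
    and "frechet_derivative (\<lambda>x. cis (- (x \<bullet> \<xi>)) * of_real (cutoff R x)) (at x) v = 
       cis (- (x \<bullet> \<xi>)) * (of_real (cutoff' R v x) - \<i> * of_real (v \<bullet> \<xi>) * of_real (cutoff R x))"
proof -
  have "Ck k (\<lambda>x::'a. - (x \<bullet> \<xi>))" for k by (intro Ck_minus Ck_linear bounded_linear_inner_left)
  from Ck_compose_real[OF Ck_cis[of _ 1] this] have "Ck k (\<lambda>x::'a. cis (- (x \<bullet> \<xi>)))" for k by simp
  then show "(\<lambda>x. cis (- (x \<bullet> \<xi>)) * of_real (cutoff R x)) \<in> test_functions UNIV"
    using cutoff_0[OF R] by (intro test_functionI[where R="2*R"] Ck_mult Ck_of_real Ck_cutoff) auto
  have 1: "((\<lambda>x. cis (- (x \<bullet> \<xi>))) has_derivative (\<lambda>v. cis (- (x \<bullet> \<xi>)) * (- \<i> * of_real (v \<bullet> \<xi>)))) (at x)"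
    by (auto intro!: derivative_eq_intros simp: scaleR_conv_of_real mult_ac)
  have 2: "((\<lambda>x. complex_of_real (cutoff R x)) has_derivative (\<lambda>v. of_real (cutoff' R v x))) (at x)"
    by (rule bounded_linear.has_derivative[OF bounded_linear_of_real cutoff_deriv])
  show "frechet_derivative (\<lambda>x. cis (- (x \<bullet> \<xi>)) * of_real (cutoff R x)) (at x) v = 
       cis (- (x \<bullet> \<xi>)) * (of_real (cutoff' R v x) - \<i> * of_real (v \<bullet> \<xi>) * of_real (cutoff R x))"
    by (subst frechet_eqI[OF has_derivative_mult[OF 1 2]]) (simp add: algebra_simps)
qed

lemma cutoff_measurable[measurable]: "cutoff R \<in> borel_measurable borel"
  by (rule borel_measurable_continuous_onI[OF Ck_cutoff[where k=0, unfolded Ck.simps(1)]])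

lemma cutoff'_measurable[measurable]: "cutoff' R i \<in> borel_measurable borel"
proof -
  have [measurable]: "step' \<in> borel_measurable borel"
    by (rule borel_measurable_continuous_onI[OF Ck_step'[where k=0, unfolded Ck.simps(1)]])
  show ?thesis unfolding cutoff'_def[abs_def] by measurable
qed

lemma cutoff_L2:
  assumes "f \<in> L2" shows "(\<lambda>x. of_real (cutoff R x) * f x) \<in> L2"
  by (rule L2_mult_bounded[OF assms, where C=1]) (auto simp: cutoff_range)

lemma cutoff'_L2:
  fixes f :: "'a::euclidean_space \<Rightarrow> complex"
  assumes "f \<in> L2" "R > 0" "i \<in> Basis" shows "(\<lambda>x. of_real (cutoff' R i x) * f x) \<in> L2"
proof -
  obtain C where C: "\<And>R i (x::'a). R > 0 \<Longrightarrow> i \<in> Basis \<Longrightarrow> \<bar>cutoff' R i x\<bar> \<le> C / R" using cutoff'_bound by metis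
  show ?thesis
    by (rule L2_mult_bounded[OF assms(1), where C="C/R"]) (use C assms in auto)
qed

lemma cutoff_tendsto:
  fixes f :: "'a::euclidean_space \<Rightarrow> complex"
  assumes f: "f \<in> L2" 
  shows "(\<lambda>n. L2_norm (\<lambda>x. of_real (cutoff (real (Suc n)) x) * f x - f x)) \<longlonglongrightarrow> 0"
proof (rule L2_tendsto_dominated(2)[OF _ _ f])
  have [measurable]: "f \<in> borel_measurable borel" using f by auto
  show "AE x in lborel. (\<lambda>n. of_real (cutoff (real (Suc n)) x) * f x) \<longlonglongrightarrow> f x"
  proof (rule AE_I2, rule tendsto_eventually)
    fix x :: 'a
    have "eventually (\<lambda>n. real (Suc n) \<ge> norm x) sequentially" by real_asymp
    then show "eventually (\<lambda>n. of_real (cutoff (real (Suc n)) x) * f x = f x) sequentially"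
      by eventually_elim (simp add: cutoff_1)
  qed
  show "AE x in lborel. cmod (of_real (cutoff (real (Suc n)) x) * f x) \<le> cmod (f x)" for n
    by (intro AE_I2) (auto simp: norm_mult cutoff_range simp del: of_nat_Suc intro!: mult_left_le_one_le)
qed (use f in auto)

text \<open>Testing with the cut-off plane wave: the derivative of the wave produces the symbol,
  that of the cut-off the last summand. Everything has bounded support, so the transforms are
  genuine integrals.\<close>

lemma weak_partial_ft:
  fixes f :: "'a::euclidean_space \<Rightarrow> complex"
  assumes f: "f \<in> L2" and g: "is_weak_partial i f g" and R: "R > 0" and i: "i \<in> Basis"
  shows "\<i> * of_real (i \<bullet> \<xi>) * ft (\<lambda>x. of_real (cutoff R x) * f x) \<xi> = 
     ft (\<lambda>x. of_real (cutoff R x) * g x) \<xi> + ft (\<lambda>x. of_real (cutoff' R i x) * f x) \<xi>"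
proof -
  have gL: "g \<in> L2" using g by (simp add: is_weak_partial_def)
  have [measurable]: "f \<in> borel_measurable borel" "g \<in> borel_measurable borel" using f gL by auto
  have i1: "integrable lborel (\<lambda>x. of_real (cutoff R x) * f x)"
    by (rule integrable_bounded_support[OF cutoff_L2[OF f], where R="2*R"]) (use R cutoff_0 in auto)
  have i2: "integrable lborel (\<lambda>x. of_real (cutoff' R i x) * f x)"
    by (rule integrable_bounded_support[OF cutoff'_L2[OF f R i], where R="2*R"]) (use R cutoff'_0 in auto)
  note i12 = integrable_cis_mult[OF i1, of "\<lambda>x. - (x \<bullet> \<xi>)"] integrable_cis_mult[OF i2, of "\<lambda>x. - (x \<bullet> \<xi>)"]
  have "(\<integral>x. f x * (cis (- (x \<bullet> \<xi>)) * (of_real (cutoff' R i x) - \<i> * of_real (i \<bullet> \<xi>) * of_real (cutoff R x))) \<partial>lborel)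
     = - (\<integral>x. g x * (cis (- (x \<bullet> \<xi>)) * of_real (cutoff R x)) \<partial>lborel)"
    using bspec[OF conjunct2[OF g[unfolded is_weak_partial_def]] wave_cutoff_test_function(1)[OF R, of \<xi>]]
    unfolding wave_cutoff_test_function(2)[OF R] .
  also have "(\<integral>x. f x * (cis (- (x \<bullet> \<xi>)) * (of_real (cutoff' R i x) - \<i> * of_real (i \<bullet> \<xi>) * of_real (cutoff R x))) \<partial>lborel)
    = (\<integral>x. cis (- (x \<bullet> \<xi>)) * (of_real (cutoff' R i x) * f x) - 
         \<i> * of_real (i \<bullet> \<xi>) * (cis (- (x \<bullet> \<xi>)) * (of_real (cutoff R x) * f x)) \<partial>lborel)"
    by (rule Bochner_Integration.integral_cong[OF refl]) (simp add: algebra_simps)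
  also have "\<dots> = (\<integral>x. cis (- (x \<bullet> \<xi>)) * (of_real (cutoff' R i x) * f x) \<partial>lborel) - 
         \<i> * of_real (i \<bullet> \<xi>) * (\<integral>x. (cis (- (x \<bullet> \<xi>)) * (of_real (cutoff R x) * f x)) \<partial>lborel)"
    by (subst Bochner_Integration.integral_diff[OF i12(2) integrable_mult_right[OF i12(1)]])
       (simp_all only: Bochner_Integration.integral_mult_right_zero, measurable)
  also have "(\<integral>x. g x * (cis (- (x \<bullet> \<xi>)) * of_real (cutoff R x)) \<partial>lborel) = ft (\<lambda>x. of_real (cutoff R x) * g x) \<xi>"
    unfolding ft_def by (rule Bochner_Integration.integral_cong[OF refl]) (simp add: mult_ac)
  finally show ?thesis unfolding ft_def by (simp add: algebra_simps)
qed

text \<open>The previous identity is passed to the limit of large cut-off radii. The symbol is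
  unbounded, so the limit is taken on one frequency ball at a time, and countably many balls exhaust
  the space.\<close>

lemma weak_partial_fourier:
  fixes f :: "'a::euclidean_space \<Rightarrow> complex"
  assumes f: "f \<in> L2" and g: "is_weak_partial i f g" and i: "i \<in> Basis"
  shows "AE \<xi> in lborel. fourier g \<xi> = \<i> * of_real (i \<bullet> \<xi>) * fourier f \<xi>"
proof -
  let ?c = "pconst TYPE('a)"
  have gL: "g \<in> L2" using g by (simp add: is_weak_partial_def)
  note Fm[measurable] = L2_measurable[OF fourier_L2[OF f]] L2_measurable[OF fourier_L2[OF gL]]
  obtain C where C: "\<And>R i (x::'a). R > 0 \<Longrightarrow> i \<in> Basis \<Longrightarrow> \<bar>cutoff' R i x\<bar> \<le> C / R" 
    using cutoff'_bound by metis
  define f1 where "f1 n x = of_real (cutoff (real (Suc n)) x) * f x" for n x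
  define g1 where "g1 n x = of_real (cutoff (real (Suc n)) x) * g x" for n x
  define f2 where "f2 n x = of_real (cutoff' (real (Suc n)) i x) * f x" for n x
  have L: "f1 n \<in> L2" "g1 n \<in> L2" "f2 n \<in> L2" for n
    unfolding f1_def g1_def f2_def using f gL i by (auto intro!: cutoff_L2 cutoff'_L2)
  have eq: "AE \<xi> in lborel. \<i> * of_real (i \<bullet> \<xi>) * fourier (f1 n) \<xi> = fourier (g1 n) \<xi> + fourier (f2 n) \<xi>" for n
  proof -
    have z: "f1 n x = 0" "g1 n x = 0" "f2 n x = 0" if "norm x > 2 * real (Suc n)" for x
      using that by (simp_all add: f1_def g1_def f2_def cutoff_0 cutoff'_0 del: of_nat_Suc)
    have "AE \<xi> in lborel. fourier (f1 n) \<xi> = ft (f1 n) \<xi>" "AE \<xi> in lborel. fourier (g1 n) \<xi> = ft (g1 n) \<xi>"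
      "AE \<xi> in lborel. fourier (f2 n) \<xi> = ft (f2 n) \<xi>"
      using fourier_eq_ft[OF L(1) z(1)] fourier_eq_ft[OF L(2) z(2)] fourier_eq_ft[OF L(3) z(3)] by blast+
    then show ?thesis
      by eventually_elim (use weak_partial_ft[OF f g _ i, of "real (Suc n)"] in \<open>simp add: f1_def[abs_def] g1_def[abs_def] f2_def[abs_def]\<close>)
  qed
  have AE_M: "AE \<xi> in lborel. norm \<xi> \<le> real M \<longrightarrow> \<i> * of_real (i \<bullet> \<xi>) * fourier f \<xi> - fourier g \<xi> = 0" for M :: nat
  proof -
    let ?i = "\<lambda>\<xi>. indicator (cball 0 (real M)) \<xi> :: complex"
    let ?m = "\<lambda>\<xi>. ?i \<xi> * (\<i> * of_real (i \<bullet> \<xi>))"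
    have mb: "cmod (?m \<xi>) \<le> real M" for \<xi>
    proof -
      have "\<bar>i \<bullet> \<xi>\<bar> \<le> norm \<xi>" using Basis_le_norm[OF i, of \<xi>] by (simp add: inner_commute)
      then show ?thesis by (auto simp: indicator_def norm_mult)
    qed
    have mm[measurable]: "?m \<in> borel_measurable borel"
      by (auto intro!: borel_measurable_times borel_measurable_indicator)
    have mL: "(\<lambda>\<xi>. ?m \<xi> * u \<xi>) \<in> L2" "L2_norm (\<lambda>\<xi>. ?m \<xi> * u \<xi>) \<le> real M * L2_norm u" 
      if u: "u \<in> L2" for u
    proof -
      have [measurable]: "u \<in> borel_measurable borel" using u by auto
      show "(\<lambda>\<xi>. ?m \<xi> * u \<xi>) \<in> L2"
        by (rule L2_mult_bounded[OF u mm AE_I2[OF mb]])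
      have "L2_norm (\<lambda>\<xi>. ?m \<xi> * u \<xi>) \<le> L2_norm (\<lambda>\<xi>. of_real (real M) * u \<xi>)"
      proof (rule L2_norm_mono[OF _ L2_cmult[OF u]])
        show "AE \<xi> in lborel. cmod (?m \<xi> * u \<xi>) \<le> cmod (of_real (real M) * u \<xi>)"
          unfolding norm_mult[of "?m _"] norm_mult[of "of_real _"]
          by (intro AE_I2 mult_right_mono) (use mb in auto)
      qed measurable
      then show "L2_norm (\<lambda>\<xi>. ?m \<xi> * u \<xi>) \<le> real M * L2_norm u" by (simp add: L2_norm_cmult)
    qed
    \<comment> \<open>Restriction to the ball makes the difference square integrable before anything
      is known about the product of symbol and transform on the whole space.\<close>
    define D where "D \<xi> = ?i \<xi> * (\<i> * of_real (i \<bullet> \<xi>) * fourier f \<xi> - fourier g \<xi>)" for \<xi>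
    have DL: "D \<in> L2"
    proof -
      have "(\<lambda>\<xi>. ?m \<xi> * fourier f \<xi> - ?i \<xi> * fourier g \<xi>) \<in> L2"
        by (intro L2_diff mL fourier_L2 f L2_indicator gL) auto
      then show ?thesis by (simp add: D_def[abs_def] algebra_simps)
    qed
    \<comment> \<open>By the identity for the cut-off functions, \<open>D\<close> consists of the
      symbol times the error of \<open>f1\<close>, the error of \<open>g1\<close>, and the transform
      of \<open>f2\<close>. The first two vanish by convergence of the cut-offs, the third through
      the factor \<open>C / real (Suc n)\<close>.\<close>
    have le: "L2_norm D \<le> real M * (?c * L2_norm (\<lambda>x. f1 n x - f x)) + 
      (?c * L2_norm (\<lambda>x. g1 n x - g x) + ?c * (C / real (Suc n) * L2_norm f))" for n
    proof -
      let ?a = "\<lambda>\<xi>. ?m \<xi> * (fourier f \<xi> - fourier (f1 n) \<xi>)"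
      let ?b = "\<lambda>\<xi>. ?i \<xi> * (fourier (g1 n) \<xi> - fourier g \<xi>)"
      let ?d = "\<lambda>\<xi>. ?i \<xi> * fourier (f2 n) \<xi>"
      note Ls = L2_diff[OF fourier_L2[OF f] fourier_L2[OF L(1), of n]] 
         L2_diff[OF fourier_L2[OF L(2), of n] fourier_L2[OF gL]] fourier_L2[OF L(3), of n]
      have L': "?a \<in> L2" "?b \<in> L2" "?d \<in> L2"
        using Ls by (auto intro!: mL L2_indicator)
      have ind: "L2_norm (\<lambda>\<xi>. ?i \<xi> * u \<xi>) \<le> L2_norm u" if u: "u \<in> L2" for u
        by (rule L2_norm_mono[OF L2_measurable[OF L2_indicator[OF u]] u]) (auto simp: indicator_def)
      have "L2_norm D = L2_norm (\<lambda>\<xi>. ?a \<xi> + (?b \<xi> + ?d \<xi>))"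
      proof (rule L2_norm_cong_AE[OF DL L2_add[OF L'(1) L2_add[OF L'(2,3)]]])
        show "AE \<xi> in lborel. D \<xi> = ?a \<xi> + (?b \<xi> + ?d \<xi>)"
          using eq[of n] by eventually_elim (auto simp: D_def indicator_def algebra_simps)
      qed
      also have "\<dots> \<le> L2_norm ?a + (L2_norm ?b + L2_norm ?d)"
        using L2_norm_triangle[OF L'(1) L2_add[OF L'(2,3)]] L2_norm_triangle[OF L'(2,3)] by linarith
      also have "L2_norm ?a \<le> real M * (?c * L2_norm (\<lambda>x. f1 n x - f x))"
        using mL(2)[OF Ls(1)] fourier_norm_diff[OF f L(1)[of n]] L2_norm_minus_commute[of f "f1 n"] by simp
      also have "L2_norm ?b \<le> ?c * L2_norm (\<lambda>x. g1 n x - g x)"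
        using ind[OF Ls(2)] fourier_norm_diff[OF L(2)[of n] gL] by simp
      also have "L2_norm ?d \<le> ?c * (C / real (Suc n) * L2_norm f)"
      proof -
        have "L2_norm (f2 n) \<le> L2_norm (\<lambda>x. of_real (C / real (Suc n)) * f x)"
        proof (rule L2_norm_mono[OF L2_measurable[OF L(3)] L2_cmult[OF f]], rule AE_I2)
          fix x
          have "\<bar>cutoff' (real (Suc n)) i x\<bar> \<le> \<bar>C / real (Suc n)\<bar>" 
            using C[OF _ i, of "real (Suc n)" x] by linarith
          then show "cmod (f2 n x) \<le> cmod (of_real (C / real (Suc n)) * f x)"
            by (simp only: f2_def norm_mult norm_of_real mult_right_mono norm_ge_zero)
        qed
        also have "\<dots> = \<bar>C / real (Suc n)\<bar> * L2_norm f" by (simp only: L2_norm_cmult norm_of_real)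
        also have "\<bar>C / real (Suc n)\<bar> = C / real (Suc n)"
          using C[OF _ i, of "real (Suc n)" 0] by linarith
        finally have "?c * L2_norm (f2 n) \<le> ?c * (C / real (Suc n) * L2_norm f)"
          using pconst_pos[where 'a='a] by (intro mult_left_mono) auto
        then show ?thesis using ind[OF Ls(3)] fourier_norm[OF L(3)[of n]] by simp
      qed
      finally show ?thesis by simp
    qed
    have "(\<lambda>n. real M * (?c * L2_norm (\<lambda>x. f1 n x - f x)) + 
      (?c * L2_norm (\<lambda>x. g1 n x - g x) + ?c * (C / real (Suc n) * L2_norm f))) \<longlonglongrightarrow> 
       real M * (?c * 0) + (?c * 0 + ?c * (0 * L2_norm f))"
    proof (intro tendsto_intros)
      show "(\<lambda>n. L2_norm (\<lambda>x. f1 n x - f x)) \<longlonglongrightarrow> 0" "(\<lambda>n. L2_norm (\<lambda>x. g1 n x - g x)) \<longlonglongrightarrow> 0"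
        unfolding f1_def g1_def by (intro cutoff_tendsto f gL)+
      show "(\<lambda>n. C / real (Suc n)) \<longlonglongrightarrow> 0" by real_asymp
    qed
    then have "L2_norm D \<le> real M * (?c * 0) + (?c * 0 + ?c * (0 * L2_norm f))"
      by (rule LIMSEQ_le_const) (use le in blast)
    then have "L2_norm D \<le> 0" by simp
    then have "L2_norm D = 0" using L2_norm_nonneg by (meson antisym)
    then have "AE \<xi> in lborel. D \<xi> = 0" using L2_norm_eq_0_iff[OF DL] by simp
    then show ?thesis by eventually_elim (auto simp: D_def)
  qed
  have "AE \<xi> in lborel. \<forall>M::nat. norm \<xi> \<le> real M \<longrightarrow> \<i> * of_real (i \<bullet> \<xi>) * fourier f \<xi> - fourier g \<xi> = 0"
    unfolding AE_all_countable using AE_M by blast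
  then show ?thesis
  proof eventually_elim
    case (elim \<xi>)
    obtain M :: nat where "norm \<xi> \<le> real M" using real_arch_simple by blast
    with elim have "\<i> * of_real (i \<bullet> \<xi>) * fourier f \<xi> - fourier g \<xi> = 0" by blast
    then show ?case by simp
  qed
qed

text \<open>Parseval moves the symbol onto the test function, whose transform is already understood.
  Conjugates appear because \<open>ip\<close> conjugates its second argument, whereas weak
  derivatives are defined by a bilinear pairing.\<close>

lemma fourier_imp_weak_partial:
  fixes f :: "'a::euclidean_space \<Rightarrow> complex"
  assumes f: "f \<in> L2" and g: "g \<in> L2" and i: "i \<in> Basis"
    and eq: "AE \<xi> in lborel. fourier g \<xi> = \<i> * of_real (i \<bullet> \<xi>) * fourier f \<xi>"
  shows "is_weak_partial i f g"
  unfolding is_weak_partial_def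
proof (intro conjI ballI g)
  fix \<phi> :: "'a \<Rightarrow> complex" assume \<phi>: "\<phi> \<in> test_functions UNIV"
  let ?p = "\<lambda>x. cnj (\<phi> x)" and ?d = "\<lambda>x. cnj (frechet_derivative \<phi> (at x) i)"
  note p = test_function_cnj[OF \<phi>]
  have d: "frechet_derivative ?p (at x) i = ?d x" for x
    using test_functionD(2)[OF \<phi>] unfolding frechet_derivative_works
    by (subst frechet_eqI[OF bounded_linear.has_derivative[OF bounded_linear_cnj]]) auto
  have pL: "?p \<in> L2" and dL: "?d \<in> L2"
    using test_function_L2[OF p] test_function_L2[OF test_function_deriv[OF p i]] by (simp_all add: d)
  have "AE \<xi> in lborel. fourier ?d \<xi> = \<i> * of_real (i \<bullet> \<xi>) * fourier ?p \<xi>"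
    using weak_partial_fourier[OF pL test_function_weak_partial[OF p i] i] by (simp only: d)
  with eq have ae: "AE \<xi> in lborel. fourier f \<xi> * cnj (fourier ?d \<xi>) = - (fourier g \<xi> * cnj (fourier ?p \<xi>))"
    by eventually_elim simp
  have [measurable]: "fourier f \<in> borel_measurable borel" "fourier g \<in> borel_measurable borel"
    "fourier ?p \<in> borel_measurable borel" "fourier ?d \<in> borel_measurable borel"
    using f g pL dL by (auto intro: L2_measurable fourier_L2)
  have "ip (fourier f) (fourier ?d) = - ip (fourier g) (fourier ?p)"
    unfolding ip_def Bochner_Integration.integral_minus[symmetric]
    by (rule integral_cong_AE[OF _ _ ae]) measurable
  then have "of_real ((pconst TYPE('a))\<^sup>2) * (ip f ?d + ip g ?p) = 0"
    unfolding fourier_ip[OF f dL] fourier_ip[OF g pL] by (simp add: distrib_left)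
  then have "ip f ?d + ip g ?p = 0"
    using pconst_pos[where 'a='a] by simp
  then have "ip f ?d = - ip g ?p" by (simp add: eq_neg_iff_add_eq_0)
  then show "(\<integral>x. f x * frechet_derivative \<phi> (at x) i \<partial>lborel) = - (\<integral>x. g x * \<phi> x \<partial>lborel)"
    by (simp add: ip_def)
qed

subsection \<open>The space H1 and Fourier multipliers\<close>

text \<open>The transform weighted by the square root of 1 + |\<xi>|^2. Up to the constant
  \<open>pconst\<close> this map is isometric from H1 into L2, so norm estimates in H1 reduce to
  estimates in L2.\<close>

definition wf :: "('a::euclidean_space \<Rightarrow> complex) \<Rightarrow> 'a \<Rightarrow> complex" where
  "wf f \<xi> = of_real (sqrt (1 + (norm \<xi>)\<^sup>2)) * fourier f \<xi>"

lemma wf_sq: "(cmod (wf f \<xi>))\<^sup>2 = (cmod (fourier f \<xi>))\<^sup>2 + (\<Sum>i\<in>Basis. (cmod (\<i> * of_real (i \<bullet> \<xi>) * fourier f \<xi>))\<^sup>2)"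
proof -
  have "(norm \<xi>)\<^sup>2 = (\<Sum>i\<in>Basis. (i \<bullet> \<xi>)\<^sup>2)"
    unfolding power2_norm_eq_inner euclidean_inner[of \<xi> \<xi>] by (simp add: power2_eq_square inner_commute)
  moreover have "0 \<le> 1 + (norm \<xi>)\<^sup>2" by (simp add: add_nonneg_nonneg)
  ultimately show ?thesis
    by (simp add: wf_def norm_mult power_mult_distrib distrib_right sum_distrib_right)
qed

lemma wf_measurable: "f \<in> L2 \<Longrightarrow> wf f \<in> borel_measurable borel"
  using L2_measurable[OF fourier_L2, of f] unfolding wf_def[abs_def] by measurable

lemma weak_partial_sq_integrable:
  assumes f: "f \<in> L2" and g: "\<And>i. i \<in> Basis \<Longrightarrow> is_weak_partial i f (g i)"
  shows "wf f \<in> L2" "(L2_norm (wf f))\<^sup>2 = (L2_norm (fourier f))\<^sup>2 + (\<Sum>i\<in>Basis. (L2_norm (fourier (g i)))\<^sup>2)"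
proof -
  have gL: "i \<in> Basis \<Longrightarrow> g i \<in> L2" for i using g by (auto simp: is_weak_partial_def)
  have [measurable]: "wf f \<in> borel_measurable borel" by (rule wf_measurable[OF f])
  have [measurable]: "fourier f \<in> borel_measurable borel" "\<And>i. i \<in> Basis \<Longrightarrow> fourier (g i) \<in> borel_measurable borel"
    using L2_measurable[OF fourier_L2] f gL by auto
  let ?h = "\<lambda>\<xi>. (cmod (fourier f \<xi>))\<^sup>2 + (\<Sum>i\<in>Basis. (cmod (fourier (g i) \<xi>))\<^sup>2)"
  have i: "integrable lborel ?h"
    using f gL by (intro Bochner_Integration.integrable_add Bochner_Integration.integrable_sum L2_integrable_sq fourier_L2)
  have "AE \<xi> in lborel. \<forall>i\<in>Basis. fourier (g i) \<xi> = \<i> * of_real (i \<bullet> \<xi>) * fourier f \<xi>"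
    using weak_partial_fourier[OF f g] by (intro AE_finite_allI) auto
  then have e: "AE \<xi> in lborel. (cmod (wf f \<xi>))\<^sup>2 = ?h \<xi>"
    by eventually_elim (simp add: wf_sq)
  show "wf f \<in> L2" by (rule L2_bound[OF _ i]) (use e in auto)
  have "(L2_norm (wf f))\<^sup>2 = (\<integral>\<xi>. ?h \<xi> \<partial>lborel)"
    unfolding L2_norm_sq by (rule integral_cong_AE) (use e in auto)
  also have "\<dots> = (L2_norm (fourier f))\<^sup>2 + (\<Sum>i\<in>Basis. (L2_norm (fourier (g i)))\<^sup>2)"
    using f gL by (simp add: L2_norm_sq L2_integrable_sq fourier_L2)
  finally show "(L2_norm (wf f))\<^sup>2 = (L2_norm (fourier f))\<^sup>2 + (\<Sum>i\<in>Basis. (L2_norm (fourier (g i)))\<^sup>2)" .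
qed

lemma H1_D:
  assumes "f \<in> H1"
  shows "f \<in> L2" "i \<in> Basis \<Longrightarrow> is_weak_partial i f (weak_partial i f)" 
    "i \<in> Basis \<Longrightarrow> weak_partial i f \<in> L2"
proof -
  show "f \<in> L2" using assms by (simp add: H1_def)
  show "i \<in> Basis \<Longrightarrow> is_weak_partial i f (weak_partial i f)"
    using someI_ex[of "is_weak_partial i f"] assms by (auto simp: weak_partial_def H1_def)
  then show "i \<in> Basis \<Longrightarrow> weak_partial i f \<in> L2" by (simp add: is_weak_partial_def)
qed

text \<open>In the backward direction the symbol times the transform lies in L2, and surjectivity of
  the transform supplies a function with that transform: the weak derivative.\<close>

lemma H1_iff_wf: "f \<in> H1 \<longleftrightarrow> f \<in> L2 \<and> wf f \<in> L2"
proof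
  assume f: "f \<in> H1"
  show "f \<in> L2 \<and> wf f \<in> L2" 
    using weak_partial_sq_integrable(1)[OF H1_D(1)[OF f] H1_D(2)[OF f]] H1_D(1)[OF f] by simp
next
  assume f: "f \<in> L2 \<and> wf f \<in> L2"
  have "\<exists>g. is_weak_partial i f g" if i: "i \<in> Basis" for i
  proof -
    have "(\<lambda>\<xi>. \<i> * of_real (i \<bullet> \<xi>) * fourier f \<xi>) \<in> L2"
    proof (rule L2_bound[OF _ L2_integrable_sq[of "wf f"]])
      show "(\<lambda>\<xi>. \<i> * of_real (i \<bullet> \<xi>) * fourier f \<xi>) \<in> borel_measurable lborel"
      proof -
        have [measurable]: "fourier f \<in> borel_measurable borel" using L2_measurable[OF fourier_L2] f by blast
        show ?thesis by measurable
      qed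
      have "(cmod (\<i> * of_real (i \<bullet> \<xi>) * fourier f \<xi>))\<^sup>2 \<le> (\<Sum>i\<in>Basis. (cmod (\<i> * of_real (i \<bullet> \<xi>) * fourier f \<xi>))\<^sup>2)" for \<xi>
        by (rule member_le_sum[OF i]) auto
      then show "AE \<xi> in lborel. (cmod (\<i> * of_real (i \<bullet> \<xi>) * fourier f \<xi>))\<^sup>2 \<le> (cmod (wf f \<xi>))\<^sup>2"
        unfolding wf_sq by (intro AE_I2) (smt (verit) zero_le_power2)
    qed (use f in auto)
    then obtain g where "g \<in> L2" "AE \<xi> in lborel. fourier g \<xi> = \<i> * of_real (i \<bullet> \<xi>) * fourier f \<xi>"
      using fourier_surj by blast
    then show ?thesis using fourier_imp_weak_partial[of f g i] f i by auto
  qed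
  with f show "f \<in> H1" by (simp add: H1_def)
qed

lemma H1_wf: "f \<in> H1 \<Longrightarrow> wf f \<in> L2"
  by (simp add: H1_iff_wf)

lemma H1_norm_nonneg[simp]: "0 \<le> H1_norm f"
  by (simp add: H1_norm_def add_nonneg_nonneg sum_nonneg)

lemma H1_norm_sq: "(H1_norm f)\<^sup>2 = (L2_norm f)\<^sup>2 + (\<Sum>i\<in>Basis. (L2_norm (weak_partial i f))\<^sup>2)"
  by (simp add: H1_norm_def add_nonneg_nonneg sum_nonneg)

lemma wf_norm:
  fixes f :: "'a::euclidean_space \<Rightarrow> complex"
  assumes f: "f \<in> H1" shows "L2_norm (wf f) = pconst TYPE('a) * H1_norm f"
proof -
  have "(L2_norm (wf f))\<^sup>2 = (pconst TYPE('a) * L2_norm f)\<^sup>2 + (\<Sum>i\<in>Basis. (pconst TYPE('a) * L2_norm (weak_partial i f))\<^sup>2)"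
    using weak_partial_sq_integrable(2)[OF H1_D(1)[OF f] H1_D(2)[OF f]] H1_D[OF f] by (simp add: fourier_norm)
  also have "\<dots> = (pconst TYPE('a) * H1_norm f)\<^sup>2"
    by (simp add: power_mult_distrib H1_norm_sq distrib_left sum_distrib_left)
  finally show ?thesis
    using pconst_pos[where 'a='a] by (simp add: power2_eq_iff_nonneg)
qed

lemma H1_add_cmult:
  assumes f: "f \<in> H1" and g: "g \<in> H1"
  shows "(\<lambda>x. f x + k * g x) \<in> H1" "AE \<xi> in lborel. wf (\<lambda>x. f x + k * g x) \<xi> = wf f \<xi> + k * wf g \<xi>"
proof -
  have L: "(\<lambda>x. f x + k * g x) \<in> L2" using H1_D(1)[OF f] H1_D(1)[OF g] by (intro L2_add L2_cmult)
  show ae: "AE \<xi> in lborel. wf (\<lambda>x. f x + k * g x) \<xi> = wf f \<xi> + k * wf g \<xi>"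
    using fourier_add_cmult[OF H1_D(1)[OF f] H1_D(1)[OF g], of k] 
    by eventually_elim (simp add: wf_def algebra_simps)
  have "wf (\<lambda>x. f x + k * g x) \<in> L2"
    by (rule L2_AE[OF L2_add[OF H1_wf[OF f] L2_cmult[OF H1_wf[OF g], of k]] wf_measurable[OF L] ae])
  with L show "(\<lambda>x. f x + k * g x) \<in> H1" by (simp add: H1_iff_wf)
qed

lemma H1_add: "f \<in> H1 \<Longrightarrow> g \<in> H1 \<Longrightarrow> (\<lambda>x. f x + g x) \<in> H1"
  using H1_add_cmult(1)[of f g 1] by simp

lemma H1_diff: "f \<in> H1 \<Longrightarrow> g \<in> H1 \<Longrightarrow> (\<lambda>x. f x - g x) \<in> H1"
  using H1_add_cmult(1)[of f g "-1"] by simp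

lemma H1_norm_add_cmult:
  fixes f :: "'a::euclidean_space \<Rightarrow> complex"
  assumes f: "f \<in> H1" and g: "g \<in> H1"
  shows "H1_norm (\<lambda>x. f x + k * g x) \<le> H1_norm f + cmod k * H1_norm g"
proof -
  let ?c = "pconst TYPE('a)"
  have "?c * H1_norm (\<lambda>x. f x + k * g x) = L2_norm (\<lambda>\<xi>. wf f \<xi> + k * wf g \<xi>)"
    unfolding wf_norm[OF H1_add_cmult(1)[OF f g], symmetric]
    by (rule L2_norm_cong_AE) 
       (use f g H1_add_cmult[OF f g] in \<open>simp_all add: H1_wf L2_add L2_cmult\<close>)
  also have "\<dots> \<le> L2_norm (wf f) + L2_norm (\<lambda>\<xi>. k * wf g \<xi>)"
    by (intro L2_norm_triangle L2_cmult H1_wf f g)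
  also have "\<dots> = ?c * (H1_norm f + cmod k * H1_norm g)"
    by (simp add: L2_norm_cmult wf_norm f g algebra_simps)
  finally show ?thesis using pconst_pos[where 'a='a] by simp
qed

lemma H1_norm_triangle: "f \<in> H1 \<Longrightarrow> g \<in> H1 \<Longrightarrow> H1_norm (\<lambda>x. f x + g x) \<le> H1_norm f + H1_norm g"
  using H1_norm_add_cmult[of f g 1] by simp

lemma H1_norm_triangle_diff: "f \<in> H1 \<Longrightarrow> g \<in> H1 \<Longrightarrow> H1_norm (\<lambda>x. f x - g x) \<le> H1_norm f + H1_norm g"
  using H1_norm_add_cmult[of f g "-1"] by simp

lemma H1_norm_diff_ge:
  assumes "f \<in> H1" "g \<in> H1"
  shows "\<bar>H1_norm f - H1_norm g\<bar> \<le> H1_norm (\<lambda>x. f x - g x)"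
proof -
  have "H1_norm f \<le> H1_norm (\<lambda>x. f x - g x) + H1_norm g"
    using H1_norm_triangle[OF H1_diff[OF assms] assms(2)] by simp
  moreover have "H1_norm g \<le> H1_norm f + H1_norm (\<lambda>x. f x - g x)"
    using H1_norm_triangle_diff[OF assms(1) H1_diff[OF assms]] by simp
  ultimately show ?thesis by linarith
qed

lemma L2_norm_le_H1_norm: "L2_norm f \<le> H1_norm f"
  by (rule power2_le_imp_le) (simp_all add: H1_norm_sq sum_nonneg)

lemma weak_partial_norm_le: "i \<in> Basis \<Longrightarrow> L2_norm (weak_partial i f) \<le> H1_norm f"
proof (rule power2_le_imp_le)
  assume "i \<in> Basis"
  then have "(L2_norm (weak_partial i f))\<^sup>2 \<le> (\<Sum>i\<in>Basis. (L2_norm (weak_partial i f))\<^sup>2)"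
    by (intro member_le_sum) auto
  then show "(L2_norm (weak_partial i f))\<^sup>2 \<le> (H1_norm f)\<^sup>2" by (simp add: H1_norm_sq add_increasing)
qed simp

text \<open>Both sides involve chosen representatives; their transforms agree, and injectivity does
  the rest.\<close>

lemma weak_partial_add_cmult:
  assumes f: "f \<in> H1" and g: "g \<in> H1" and i: "i \<in> Basis"
  shows "AE x in lborel. weak_partial i (\<lambda>x. f x + k * g x) x = weak_partial i f x + k * weak_partial i g x"
proof -
  note fg = H1_add_cmult(1)[OF f g, of k]
  note L = H1_D(1)[OF f] H1_D(1)[OF g] H1_D(1)[OF fg] H1_D(3)[OF f i] H1_D(3)[OF g i] H1_D(3)[OF fg i]
  have "AE \<xi> in lborel. fourier (weak_partial i (\<lambda>x. f x + k * g x)) \<xi> = 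
     fourier (\<lambda>x. weak_partial i f x + k * weak_partial i g x) \<xi>"
    using weak_partial_fourier[OF L(1) H1_D(2)[OF f i] i] weak_partial_fourier[OF L(2) H1_D(2)[OF g i] i]
      weak_partial_fourier[OF L(3) H1_D(2)[OF fg i] i] fourier_add_cmult[OF L(4,5), of k] 
      fourier_add_cmult[OF L(1,2), of k]
    by eventually_elim (simp add: algebra_simps)
  then show ?thesis
    using fourier_AE_eq_iff[OF L(6) L2_add[OF L(4) L2_cmult[OF L(5), of k]]] by simp
qed

section \<open>Fourier multipliers: the fractional Laplacian and frequency projections\<close>

definition multiplier :: "('a::euclidean_space \<Rightarrow> complex) \<Rightarrow> ('a \<Rightarrow> complex) \<Rightarrow> 'a \<Rightarrow> complex" where
  "multiplier m f = (SOME h. h \<in> L2 \<and> (AE \<xi> in lborel. fourier h \<xi> = m \<xi> * fourier f \<xi>))"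

lemma multiplier_works:
  assumes "(\<lambda>\<xi>. m \<xi> * fourier f \<xi>) \<in> L2"
  shows "multiplier m f \<in> L2" "AE \<xi> in lborel. fourier (multiplier m f) \<xi> = m \<xi> * fourier f \<xi>"
proof -
  have "\<exists>h. h \<in> L2 \<and> (AE \<xi> in lborel. fourier h \<xi> = m \<xi> * fourier f \<xi>)"
    using fourier_surj[OF assms] by blast
  from someI_ex[OF this] show "multiplier m f \<in> L2" "AE \<xi> in lborel. fourier (multiplier m f) \<xi> = m \<xi> * fourier f \<xi>"
    unfolding multiplier_def[symmetric] by blast+
qed

lemma multiplier_norm:
  fixes f :: "'a::euclidean_space \<Rightarrow> complex"
  assumes "(\<lambda>\<xi>. m \<xi> * fourier f \<xi>) \<in> L2"
  shows "pconst TYPE('a) * L2_norm (multiplier m f) = L2_norm (\<lambda>\<xi>. m \<xi> * fourier f \<xi>)"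
  using fourier_norm[OF multiplier_works(1)[OF assms]] 
    L2_norm_cong_AE[OF fourier_L2[OF multiplier_works(1)[OF assms]] assms multiplier_works(2)[OF assms]] by simp

lemma multiplier_add_cmult:
  assumes f: "f \<in> L2" and g: "g \<in> L2" and mf: "(\<lambda>\<xi>. m \<xi> * fourier f \<xi>) \<in> L2" 
    and mg: "(\<lambda>\<xi>. m \<xi> * fourier g \<xi>) \<in> L2" and m: "m \<in> borel_measurable borel"
  shows "AE x in lborel. multiplier m (\<lambda>x. f x + k * g x) x = multiplier m f x + k * multiplier m g x"
proof -
  have L: "(\<lambda>x. f x + k * g x) \<in> L2" using f g by (intro L2_add L2_cmult)
  have "(\<lambda>\<xi>. m \<xi> * fourier (\<lambda>x. f x + k * g x) \<xi>) \<in> L2"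
  proof (rule L2_AE[OF L2_add[OF mf L2_cmult[OF mg, of k]]])
    show "AE \<xi> in lborel. m \<xi> * fourier (\<lambda>x. f x + k * g x) \<xi> = m \<xi> * fourier f \<xi> + k * (m \<xi> * fourier g \<xi>)"
      using fourier_add_cmult[OF f g, of k] by eventually_elim (simp add: algebra_simps)
  qed (use m L2_measurable[OF fourier_L2[OF L]] in measurable)
  note M = multiplier_works[OF mf] multiplier_works[OF mg] multiplier_works[OF this]
  have "AE \<xi> in lborel. fourier (multiplier m (\<lambda>x. f x + k * g x)) \<xi> = fourier (\<lambda>x. multiplier m f x + k * multiplier m g x) \<xi>"
    using M(2,4,6) fourier_add_cmult[OF f g, of k] fourier_add_cmult[OF M(1) M(3), of k]
    by eventually_elim (simp add: algebra_simps)
  then show ?thesis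
    using fourier_AE_eq_iff[OF M(5) L2_add[OF M(1) L2_cmult[OF M(3), of k]]] by simp
qed

lemma half_lap_multiplier: "half_lap s = multiplier (\<lambda>\<xi>. complex_of_real (norm \<xi> powr s))"
  by (rule ext) (simp add: half_lap_def multiplier_def)

text \<open>For 0 < s < 1 the symbol is at most 1 on the unit ball and at most |\<xi>| outside,
  hence below the weight of H1 everywhere.\<close>

lemma half_lap_symbol_L2:
  fixes f :: "'a::euclidean_space \<Rightarrow> complex"
  assumes f: "f \<in> H1" and s: "0 < s" "s < 1"
  shows "(\<lambda>\<xi>. complex_of_real (norm \<xi> powr s) * fourier f \<xi>) \<in> L2"
    "L2_norm (\<lambda>\<xi>. complex_of_real (norm \<xi> powr s) * fourier f \<xi>) \<le> L2_norm (wf f)"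
proof -
  have m[measurable]: "fourier f \<in> borel_measurable borel" by (rule L2_measurable[OF fourier_L2[OF H1_D(1)[OF f]]])
  have le: "norm \<xi> powr s \<le> sqrt (1 + (norm \<xi>)\<^sup>2)" for \<xi> :: 'a
  proof (cases "norm \<xi> \<le> 1")
    case True
    then have "norm \<xi> powr s \<le> 1" using s powr_mono2[of s "norm \<xi>" 1] by simp
    also have "1 \<le> sqrt (1 + (norm \<xi>)\<^sup>2)" by simp
    finally show ?thesis .
  next
    case False
    then have "norm \<xi> powr s \<le> norm \<xi> powr 1" using s by (intro powr_mono) auto
    also have "\<dots> \<le> sqrt (1 + (norm \<xi>)\<^sup>2)" by (simp add: real_le_rsqrt)
    finally show ?thesis .
  qed
  have c: "cmod (complex_of_real (norm \<xi> powr s) * fourier f \<xi>) \<le> cmod (wf f \<xi>)" for \<xi>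
    using le[of \<xi>] by (simp add: wf_def norm_mult mult_right_mono)
  show "(\<lambda>\<xi>. complex_of_real (norm \<xi> powr s) * fourier f \<xi>) \<in> L2"
    by (rule L2_bound[OF _ L2_integrable_sq[OF H1_wf[OF f]]]) (use c in \<open>auto intro!: power_mono\<close>)
  show "L2_norm (\<lambda>\<xi>. complex_of_real (norm \<xi> powr s) * fourier f \<xi>) \<le> L2_norm (wf f)"
    by (rule L2_norm_mono[OF _ H1_wf[OF f]]) (use c in auto)
qed

lemma half_lap_L2: "f \<in> H1 \<Longrightarrow> 0 < s \<Longrightarrow> s < 1 \<Longrightarrow> half_lap s f \<in> L2"
  unfolding half_lap_multiplier by (rule multiplier_works(1)[OF half_lap_symbol_L2(1)])

lemma half_lap_norm_le:
  fixes f :: "'a::euclidean_space \<Rightarrow> complex"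
  assumes f: "f \<in> H1" and s: "0 < s" "s < 1" shows "L2_norm (half_lap s f) \<le> H1_norm f"
proof -
  have "pconst TYPE('a) * L2_norm (half_lap s f) \<le> pconst TYPE('a) * H1_norm f"
    using multiplier_norm[OF half_lap_symbol_L2(1)[OF f s]] half_lap_symbol_L2(2)[OF f s] 
    by (simp add: half_lap_multiplier wf_norm[OF f])
  then show ?thesis using pconst_pos[where 'a='a] by simp
qed

lemma half_lap_add_cmult:
  assumes f: "f \<in> H1" and g: "g \<in> H1" and s: "0 < s" "s < 1"
  shows "AE x in lborel. half_lap s (\<lambda>x. f x + k * g x) x = half_lap s f x + k * half_lap s g x"
  unfolding half_lap_multiplier
  by (intro multiplier_add_cmult half_lap_symbol_L2 H1_D(1) f g s) measurable

text \<open>Sharp restriction to frequencies in a ball: an orthogonal projection of L2 whose range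
  lies in H1.\<close>

definition low :: "real \<Rightarrow> ('a::euclidean_space \<Rightarrow> complex) \<Rightarrow> 'a \<Rightarrow> complex" where
  "low R = multiplier (indicator (cball 0 R))"

lemma low_works:
  assumes f: "f \<in> L2"
  shows "low R f \<in> L2" "AE \<xi> in lborel. fourier (low R f) \<xi> = indicator (cball 0 R) \<xi> * fourier f \<xi>"
  unfolding low_def using multiplier_works[OF L2_indicator[OF fourier_L2[OF f], of "cball 0 R"]] by auto

text \<open>The symbol is real and idempotent, so on the Fourier side one of the two indicators is
  redundant.\<close>

lemma low_ip:
  fixes f :: "'a::euclidean_space \<Rightarrow> complex"
  assumes f: "f \<in> L2" and g: "g \<in> L2"
  shows "ip (low R f) (low R g) = ip f (low R g)"
proof -
  let ?c = "complex_of_real ((pconst TYPE('a))\<^sup>2)"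
  note L = low_works(1)[OF f, of R] low_works(1)[OF g, of R]
  have "ip (fourier (low R f)) (fourier (low R g)) = ip (fourier f) (fourier (low R g))"
    unfolding ip_def
  proof (rule integral_cong_AE)
    show "AE \<xi> in lborel. fourier (low R f) \<xi> * cnj (fourier (low R g) \<xi>) = fourier f \<xi> * cnj (fourier (low R g) \<xi>)"
      using low_works(2)[OF f, of R] low_works(2)[OF g, of R] by eventually_elim (simp add: indicator_def)
  qed (use L2_measurable[OF fourier_L2[OF f]] L2_measurable[OF fourier_L2[OF L(1)]] L2_measurable[OF fourier_L2[OF L(2)]] in measurable)
  then have "?c * ip (low R f) (low R g) = ?c * ip f (low R g)"
    using fourier_ip L f by metis
  moreover have "?c \<noteq> 0" using pconst_pos[where 'a='a] by simp
  ultimately show ?thesis by simp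
qed

text \<open>On the frequency ball the H1 weight is bounded by its value at radius R; this bound
  turns continuity in L2 into continuity in H1.\<close>

lemma low_H1:
  fixes f :: "'a::euclidean_space \<Rightarrow> complex"
  assumes f: "f \<in> L2"
  shows "low R f \<in> H1" "H1_norm (low R f) \<le> sqrt (1 + R\<^sup>2) * L2_norm f"
proof -
  note L = low_works(1)[OF f, of R]
  have [measurable]: "wf (low R f) \<in> borel_measurable borel" by (rule wf_measurable[OF L])
  have ae: "AE \<xi> in lborel. cmod (wf (low R f) \<xi>) \<le> cmod (of_real (sqrt (1 + R\<^sup>2)) * fourier f \<xi>)"
    using low_works(2)[OF f, of R]
  proof eventually_elim
    case (elim \<xi>)
    show ?case
    proof (cases "norm \<xi> \<le> R")
      case True
      then have "(norm \<xi>)\<^sup>2 \<le> R\<^sup>2" by (intro power_mono) auto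
      then have "sqrt (1 + (norm \<xi>)\<^sup>2) \<le> sqrt (1 + R\<^sup>2)" by simp
      then show ?thesis using True elim by (simp add: wf_def norm_mult mult_right_mono)
    qed (use elim in \<open>simp add: wf_def\<close>)
  qed
  have c: "(\<lambda>\<xi>. of_real (sqrt (1 + R\<^sup>2)) * fourier f \<xi>) \<in> L2" by (intro L2_cmult fourier_L2 f)
  have "wf (low R f) \<in> L2"
    by (rule L2_bound[OF _ L2_integrable_sq[OF c]]) (use ae in \<open>auto elim!: eventually_mono intro!: power_mono\<close>)
  with L show H: "low R f \<in> H1" by (simp add: H1_iff_wf)
  have "L2_norm (wf (low R f)) \<le> L2_norm (\<lambda>\<xi>. of_real (sqrt (1 + R\<^sup>2)) * fourier f \<xi>)"
    by (rule L2_norm_mono[OF _ c ae]) measurable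
  also have "\<dots> = pconst TYPE('a) * (sqrt (1 + R\<^sup>2) * L2_norm f)"
    by (simp add: L2_norm_cmult fourier_norm[OF f])
  finally show "H1_norm (low R f) \<le> sqrt (1 + R\<^sup>2) * L2_norm f"
    using pconst_pos[where 'a='a] unfolding wf_norm[OF H] by simp
qed

lemma low_norm_le:
  fixes f :: "'a::euclidean_space \<Rightarrow> complex"
  assumes f: "f \<in> H1" shows "H1_norm (low R f) \<le> H1_norm f"
proof -
  note L = H1_D(1)[OF f]
  have "L2_norm (wf (low R f)) \<le> L2_norm (wf f)"
    using low_works(2)[OF L, of R]
    by (intro L2_norm_mono wf_measurable low_works L H1_wf f) (auto elim!: eventually_mono simp: wf_def indicator_def norm_mult)
  then show ?thesis
    using pconst_pos[where 'a='a] unfolding wf_norm[OF low_H1(1)[OF L]] wf_norm[OF f] by simp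
qed

lemma low_diff:
  assumes f: "f \<in> L2" and g: "g \<in> L2"
  shows "AE x in lborel. low R (\<lambda>x. f x - g x) x = low R f x - low R g x"
proof -
  have "AE x in lborel. multiplier (indicator (cball 0 R)) (\<lambda>x. f x + (-1) * g x) x = 
     multiplier (indicator (cball 0 R)) f x + (-1) * multiplier (indicator (cball 0 R)) g x"
    by (rule multiplier_add_cmult[OF f g]) 
       (auto intro!: L2_indicator fourier_L2 f g borel_measurable_indicator)
  then show ?thesis by (simp add: low_def)
qed

text \<open>Membership of \<open>g\<close> in L2 supplies Borel measurability, which almost
  everywhere equality alone does not transfer.\<close>

lemma H1_cong_AE:
  fixes f :: "'a::euclidean_space \<Rightarrow> complex"
  assumes f: "f \<in> H1" and g: "g \<in> L2" and e: "AE x in lborel. f x = g x"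
  shows "g \<in> H1" "H1_norm g = H1_norm f"
proof -
  have ae: "AE \<xi> in lborel. wf g \<xi> = wf f \<xi>"
    using fourier_AE_eq_iff[OF H1_D(1)[OF f] g] e by (auto elim!: eventually_mono simp: wf_def)
  have w: "wf g \<in> L2" by (rule L2_AE[OF H1_wf[OF f] wf_measurable[OF g] ae])
  with g show gH: "g \<in> H1" by (simp add: H1_iff_wf)
  have "pconst TYPE('a) * H1_norm g = pconst TYPE('a) * H1_norm f"
    using L2_norm_cong_AE[OF w H1_wf[OF f] ae] by (simp add: wf_norm gH f)
  then show "H1_norm g = H1_norm f" using pconst_pos[where 'a='a] by simp
qed

lemma low_diff_H1_norm:
  assumes f: "f \<in> L2" and g: "g \<in> L2"
  shows "H1_norm (\<lambda>x. low R f x - low R g x) \<le> sqrt (1 + R\<^sup>2) * L2_norm (\<lambda>x. f x - g x)"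
proof -
  note d = low_diff[OF f g, of R]
  have "H1_norm (\<lambda>x. low R f x - low R g x) = H1_norm (low R (\<lambda>x. f x - g x))"
    by (rule H1_cong_AE(2)[OF low_H1(1)[OF L2_diff[OF f g]] _ d]) (intro L2_diff low_works f g)
  then show ?thesis using low_H1(2)[OF L2_diff[OF f g], of R] by simp
qed

lemma low_tendsto:
  fixes f :: "'a::euclidean_space \<Rightarrow> complex"
  assumes f: "f \<in> H1"
  shows "(\<lambda>n. H1_norm (\<lambda>x. low (real n) f x - f x)) \<longlonglongrightarrow> 0"
proof -
  let ?c = "pconst TYPE('a)"
  note L = H1_D(1)[OF f]
  have lH: "low R f \<in> H1" for R by (rule low_H1(1)[OF L])
  have "(\<lambda>n. L2_norm (\<lambda>\<xi>. wf (low (real n) f) \<xi> - wf f \<xi>)) \<longlonglongrightarrow> 0"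
  proof (rule L2_tendsto_dominated(2)[OF _ _ H1_wf[OF f]])
    have ae: "AE \<xi> in lborel. \<forall>n::nat. fourier (low (real n) f) \<xi> = indicator (cball 0 (real n)) \<xi> * fourier f \<xi>"
      unfolding AE_all_countable using low_works(2)[OF L] by blast
    then show "AE \<xi> in lborel. (\<lambda>n. wf (low (real n) f) \<xi>) \<longlonglongrightarrow> wf f \<xi>"
    proof eventually_elim
      case (elim \<xi>)
      have "eventually (\<lambda>n. real n \<ge> norm \<xi>) sequentially" by real_asymp
      then have "eventually (\<lambda>n. wf (low (real n) f) \<xi> = wf f \<xi>) sequentially"
        by eventually_elim (simp add: wf_def elim)
      then show ?case by (rule tendsto_eventually)
    qed
    show "AE \<xi> in lborel. cmod (wf (low (real n) f) \<xi>) \<le> cmod (wf f \<xi>)" for n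
      using ae by eventually_elim (simp add: wf_def norm_mult indicator_def)
  qed (intro wf_measurable low_works L)+
  moreover have "L2_norm (\<lambda>\<xi>. wf (low R f) \<xi> - wf f \<xi>) = ?c * H1_norm (\<lambda>x. low R f x - f x)" for R
  proof -
    note d = H1_add_cmult[OF lH[of R] f, of "-1"]
    have "L2_norm (\<lambda>\<xi>. wf (low R f) \<xi> + (-1) * wf f \<xi>) = L2_norm (wf (\<lambda>x. low R f x + (-1) * f x))"
      by (rule L2_norm_cong_AE) 
         (use d H1_wf[OF lH[of R]] H1_wf[OF f] in \<open>auto intro!: L2_diff H1_wf elim!: eventually_mono\<close>)
    then show ?thesis using wf_norm[OF d(1)] by simp
  qed
  ultimately have "(\<lambda>n. inverse ?c * (?c * H1_norm (\<lambda>x. low (real n) f x - f x))) \<longlonglongrightarrow> inverse ?c * 0"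
    by (intro tendsto_intros) simp
  then show ?thesis using pconst_pos[where 'a='a] by (simp add: mult.assoc[symmetric])
qed

subsection \<open>The elliptic form\<close>

definition wint :: "('a::euclidean_space \<Rightarrow> real) \<Rightarrow> ('a \<Rightarrow> complex) \<Rightarrow> ('a \<Rightarrow> complex) \<Rightarrow> complex" where
  "wint \<alpha> p q = (\<integral>x. of_real (\<alpha> x) * p x * cnj (q x) \<partial>lborel)"

text \<open>A real bound in place of the extended real \<open>Linf_norm\<close>, so that the
  estimates for the form stay within the reals.\<close>

definition coeff_le :: "('a::euclidean_space \<Rightarrow> real) \<Rightarrow> real \<Rightarrow> bool" where
  "coeff_le \<alpha> M \<longleftrightarrow> \<alpha> \<in> borel_measurable borel \<and> (AE x in lborel. \<bar>\<alpha> x\<bar> \<le> M)"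

lemma coeff_le_nonneg: "coeff_le (\<alpha> :: 'a::euclidean_space \<Rightarrow> real) M \<Longrightarrow> 0 \<le> M"
proof (rule ccontr)
  assume "coeff_le \<alpha> M" "\<not> 0 \<le> M"
  then have "AE x in (lborel :: 'a measure). False" unfolding coeff_le_def by auto
  then show False by (simp add: eventually_False ae_filter_eq_bot_iff)
qed

lemma coeff_le_mono: "coeff_le \<alpha> M \<Longrightarrow> M \<le> N \<Longrightarrow> coeff_le \<alpha> N"
  unfolding coeff_le_def by (auto elim!: eventually_mono)

lemma Linf_coeff_le:
  assumes "\<alpha> \<in> Linf" obtains M where "coeff_le \<alpha> M"
proof -
  have m: "\<alpha> \<in> borel_measurable borel" and l: "Linf_norm \<alpha> < \<infinity>" using assms by (auto simp: Linf_def)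
  have ae: "AE x in lborel. ereal \<bar>\<alpha> x\<bar> \<le> Linf_norm \<alpha>" unfolding Linf_norm_def by (rule esssup_AE)
  from l obtain M where M: "Linf_norm \<alpha> \<le> ereal M" by (cases "Linf_norm \<alpha>") auto
  have "AE x in lborel. \<bar>\<alpha> x\<bar> \<le> M"
    using ae by eventually_elim (metis M ereal_less_eq(3) order_trans)
  with m show ?thesis by (intro that) (simp add: coeff_le_def)
qed

lemma Linf_norm_le_coeff_le:
  assumes "\<alpha> \<in> borel_measurable borel" "Linf_norm \<alpha> \<le> ereal M" shows "coeff_le \<alpha> M"
proof -
  have ae: "AE x in lborel. ereal \<bar>\<alpha> x\<bar> \<le> Linf_norm \<alpha>" unfolding Linf_norm_def by (rule esssup_AE)
  have "AE x in lborel. \<bar>\<alpha> x\<bar> \<le> M"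
    using ae by eventually_elim (metis assms(2) ereal_less_eq(3) order_trans)
  with assms(1) show ?thesis by (simp add: coeff_le_def)
qed

lemma coeff_mult_L2: 
  assumes \<alpha>: "coeff_le \<alpha> M" and p: "p \<in> L2"
  shows "(\<lambda>x. of_real (\<alpha> x) * p x) \<in> L2" "L2_norm (\<lambda>x. of_real (\<alpha> x) * p x) \<le> M * L2_norm p"
proof -
  have [measurable]: "\<alpha> \<in> borel_measurable borel" using \<alpha> by (simp add: coeff_le_def)
  have ae: "AE x in lborel. cmod (of_real (\<alpha> x)) \<le> M" using \<alpha> by (simp add: coeff_le_def)
  show L: "(\<lambda>x. of_real (\<alpha> x) * p x) \<in> L2"
    by (rule L2_mult_bounded[OF p _ ae]) measurable
  have "L2_norm (\<lambda>x. of_real (\<alpha> x) * p x) \<le> L2_norm (\<lambda>x. of_real M * p x)"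
  proof (rule L2_norm_mono[OF L2_measurable[OF L] L2_cmult[OF p]])
    show "AE x in lborel. cmod (of_real (\<alpha> x) * p x) \<le> cmod (of_real M * p x)"
      using ae by eventually_elim (use coeff_le_nonneg[OF \<alpha>] in \<open>simp add: norm_mult mult_right_mono\<close>)
  qed
  then show "L2_norm (\<lambda>x. of_real (\<alpha> x) * p x) \<le> M * L2_norm p"
    using coeff_le_nonneg[OF \<alpha>] by (simp add: L2_norm_cmult)
qed

lemma wint_eq_ip: "wint \<alpha> p q = ip (\<lambda>x. of_real (\<alpha> x) * p x) q"
  by (simp add: wint_def ip_def)

lemma wint_le:
  assumes \<alpha>: "coeff_le \<alpha> M" and p: "p \<in> L2" and q: "q \<in> L2"
  shows "cmod (wint \<alpha> p q) \<le> M * L2_norm p * L2_norm q"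
proof -
  have "cmod (wint \<alpha> p q) \<le> L2_norm (\<lambda>x. of_real (\<alpha> x) * p x) * L2_norm q"
    unfolding wint_eq_ip by (intro ip_le coeff_mult_L2[OF \<alpha>] p q)
  also have "\<dots> \<le> M * L2_norm p * L2_norm q"
    by (intro mult_right_mono coeff_mult_L2[OF \<alpha>] p) simp
  finally show ?thesis .
qed

lemma wint_add_cmult_left:
  assumes \<alpha>: "coeff_le \<alpha> M" and "p \<in> L2" "p1 \<in> L2" "p2 \<in> L2" "q \<in> L2" 
    and ae: "AE x in lborel. p x = p1 x + k * p2 x"
  shows "wint \<alpha> p q = wint \<alpha> p1 q + k * wint \<alpha> p2 q"
proof -
  note L = coeff_mult_L2(1)[OF \<alpha> assms(2)] coeff_mult_L2(1)[OF \<alpha> assms(3)] coeff_mult_L2(1)[OF \<alpha> assms(4)]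
  have "ip (\<lambda>x. of_real (\<alpha> x) * p x) q = ip (\<lambda>x. of_real (\<alpha> x) * p1 x + k * (of_real (\<alpha> x) * p2 x)) q"
    by (rule ip_cong_AE[OF L(1) assms(5) L2_add[OF L(2) L2_cmult[OF L(3)]] assms(5)])
       (use ae in \<open>auto elim!: eventually_mono simp: algebra_simps\<close>)
  then show ?thesis
    unfolding wint_eq_ip by (simp add: ip_add_left ip_cmult_left L assms L2_cmult)
qed

lemma wint_add_cmult_right:
  assumes \<alpha>: "coeff_le \<alpha> M" and "p \<in> L2" "q \<in> L2" "q1 \<in> L2" "q2 \<in> L2" 
    and ae: "AE x in lborel. q x = q1 x + k * q2 x"
  shows "wint \<alpha> p q = wint \<alpha> p q1 + cnj k * wint \<alpha> p q2"
proof -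
  note L = coeff_mult_L2(1)[OF \<alpha> assms(2)]
  have "ip (\<lambda>x. of_real (\<alpha> x) * p x) q = ip (\<lambda>x. of_real (\<alpha> x) * p x) (\<lambda>x. q1 x + k * q2 x)"
    by (rule ip_cong_AE[OF L assms(3) L L2_add[OF assms(4) L2_cmult[OF assms(5)]] _ ae]) simp
  then show ?thesis
    unfolding wint_eq_ip by (simp add: ip_add_right ip_cmult_right L assms L2_cmult)
qed

lemma wint_coeff_diff:
  assumes \<alpha>: "coeff_le \<alpha> M" and \<alpha>': "coeff_le \<alpha>' M'" and p: "p \<in> L2" and q: "q \<in> L2"
  shows "wint \<alpha> p q - wint \<alpha>' p q = wint (\<lambda>x. \<alpha> x - \<alpha>' x) p q"
  unfolding wint_eq_ip ip_diff_left[OF coeff_mult_L2(1)[OF \<alpha> p] coeff_mult_L2(1)[OF \<alpha>' p] q, symmetric]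
  by (simp add: left_diff_distrib)

lemma wint_self_ge:
  assumes \<alpha>: "coeff_le \<alpha> M" and p: "p \<in> L2" and lb: "AE x in lborel. \<alpha> x \<ge> m"
  shows "Re (wint \<alpha> p p) \<ge> m * (L2_norm p)\<^sup>2"
proof -
  have [measurable]: "\<alpha> \<in> borel_measurable borel" "p \<in> borel_measurable borel" 
    using \<alpha> p by (auto simp: coeff_le_def)
  have i: "integrable lborel (\<lambda>x. of_real (\<alpha> x) * p x * cnj (p x))"
    by (rule ip_integrable[OF coeff_mult_L2(1)[OF \<alpha> p] p])
  have r: "Re (of_real (\<alpha> x) * p x * cnj (p x)) = \<alpha> x * (cmod (p x))\<^sup>2" for x
    unfolding cmod_power2 by (simp add: power2_eq_square algebra_simps)
  have "m * (L2_norm p)\<^sup>2 = (\<integral>x. m * (cmod (p x))\<^sup>2 \<partial>lborel)" by (simp add: L2_norm_sq)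
  also have "\<dots> \<le> (\<integral>x. \<alpha> x * (cmod (p x))\<^sup>2 \<partial>lborel)"
  proof (rule integral_mono_AE)
    show "integrable lborel (\<lambda>x. \<alpha> x * (cmod (p x))\<^sup>2)"
      using integrable_Re[OF i] unfolding r .
    show "AE x in lborel. m * (cmod (p x))\<^sup>2 \<le> \<alpha> x * (cmod (p x))\<^sup>2"
      using lb by eventually_elim (simp add: mult_right_mono)
  qed (use L2_integrable_sq[OF p] in simp)
  also have "\<dots> = Re (wint \<alpha> p p)"
    unfolding wint_def integral_Re[OF i, symmetric] r ..
  finally show ?thesis .
qed

text \<open>The sum over coordinates stands outside the integral, unlike in
  \<open>weak_solution\<close>, so that every summand is a weighted product of two L2 functions;
  \<open>form_eq\<close> reconciles the two versions.\<close>

definition form ::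
  "real \<Rightarrow> ('a::euclidean_space \<Rightarrow> real) \<Rightarrow> ('a \<Rightarrow> real) \<Rightarrow> ('a \<Rightarrow> real) \<Rightarrow> ('a \<Rightarrow> complex) \<Rightarrow> ('a \<Rightarrow> complex) \<Rightarrow> complex"
  where
  "form s \<alpha> \<beta> \<gamma> f g = (\<Sum>i\<in>Basis. wint \<alpha> (weak_partial i f) (weak_partial i g)) + 
     wint \<beta> (half_lap s f) (half_lap s g) + wint \<gamma> f g"

lemma form_eq:
  fixes f :: "'a::euclidean_space \<Rightarrow> complex"
  assumes \<alpha>: "coeff_le \<alpha> M" and f: "f \<in> H1" and g: "g \<in> H1"
  shows "form s \<alpha> \<beta> \<gamma> f g =
    (\<integral>x. complex_of_real (\<alpha> x) * (\<Sum>i\<in>Basis. weak_partial i f x * cnj (weak_partial i g x)) \<partial>lborel) +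
    (\<integral>x. complex_of_real (\<beta> x) * half_lap s f x * cnj (half_lap s g x) \<partial>lborel) + 
    (\<integral>x. complex_of_real (\<gamma> x) * f x * cnj (g x) \<partial>lborel)"
proof -
  have "(\<integral>x. complex_of_real (\<alpha> x) * (\<Sum>i\<in>Basis. weak_partial i f x * cnj (weak_partial i g x)) \<partial>lborel) = 
    (\<integral>x. (\<Sum>i\<in>Basis. complex_of_real (\<alpha> x) * weak_partial i f x * cnj (weak_partial i g x)) \<partial>lborel)"
    by (simp add: sum_distrib_left mult.assoc)
  also have "\<dots> = (\<Sum>i\<in>Basis. wint \<alpha> (weak_partial i f) (weak_partial i g))"
    unfolding wint_def using f g
    by (intro Bochner_Integration.integral_sum ip_integrable coeff_mult_L2[OF \<alpha>] H1_D(3))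
  finally show ?thesis by (simp add: form_def wint_def)
qed

locale elliptic =
  fixes s :: real and \<alpha> \<beta> \<gamma> :: "'a::euclidean_space \<Rightarrow> real" and M :: real
  assumes s: "0 < s" "s < 1" and \<alpha>: "coeff_le \<alpha> M" and \<beta>: "coeff_le \<beta> M" and \<gamma>: "coeff_le \<gamma> M"
begin

abbreviation "B \<equiv> form s \<alpha> \<beta> \<gamma>"

lemma form_le:
  assumes f: "f \<in> H1" and g: "g \<in> H1"
  shows "cmod (B f g) \<le> M * (real DIM('a) + 2) * H1_norm f * H1_norm g"
proof -
  note M = coeff_le_nonneg[OF \<alpha>]
  have b: "M * L2_norm p * L2_norm q \<le> M * H1_norm f * H1_norm g" 
    if "L2_norm p \<le> H1_norm f" "L2_norm q \<le> H1_norm g" for p q :: "'a \<Rightarrow> complex"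
    using M that by (intro mult_mono) auto
  have "cmod (B f g) \<le> (\<Sum>i\<in>(Basis::'a set). M * H1_norm f * H1_norm g) + M * H1_norm f * H1_norm g + M * H1_norm f * H1_norm g"
    unfolding form_def
  proof (intro norm_triangle_le add_mono)
    show "cmod (\<Sum>i\<in>Basis. wint \<alpha> (weak_partial i f) (weak_partial i g)) \<le> (\<Sum>i\<in>(Basis::'a set). M * H1_norm f * H1_norm g)"
      by (rule sum_norm_le, rule order_trans[OF wint_le[OF \<alpha>] b]) (auto intro: H1_D f g weak_partial_norm_le)
    show "cmod (wint \<beta> (half_lap s f) (half_lap s g)) \<le> M * H1_norm f * H1_norm g"
      by (rule order_trans[OF wint_le[OF \<beta>] b]) (intro half_lap_L2 half_lap_norm_le f g s)+
    show "cmod (wint \<gamma> f g) \<le> M * H1_norm f * H1_norm g"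
      by (rule order_trans[OF wint_le[OF \<gamma>] b]) (intro H1_D f g L2_norm_le_H1_norm)+
  qed
  then show ?thesis by (simp add: algebra_simps)
qed

lemma form_add_cmult_left:
  assumes f: "f \<in> H1" and f': "f' \<in> H1" and g: "g \<in> H1"
  shows "B (\<lambda>x. f x + k * f' x) g = B f g + k * B f' g"
proof -
  note ff = H1_add_cmult(1)[OF f f', of k]
  have "wint \<alpha> (weak_partial i (\<lambda>x. f x + k * f' x)) (weak_partial i g) = 
     wint \<alpha> (weak_partial i f) (weak_partial i g) + k * wint \<alpha> (weak_partial i f') (weak_partial i g)" if "i \<in> Basis" for i
    by (rule wint_add_cmult_left[OF \<alpha>]) (intro H1_D(3) ff f f' g that weak_partial_add_cmult)+
  moreover have "wint \<beta> (half_lap s (\<lambda>x. f x + k * f' x)) (half_lap s g) = 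
      wint \<beta> (half_lap s f) (half_lap s g) + k * wint \<beta> (half_lap s f') (half_lap s g)"
    by (rule wint_add_cmult_left[OF \<beta>]) (intro half_lap_L2 ff f f' g s half_lap_add_cmult)+
  moreover have "wint \<gamma> (\<lambda>x. f x + k * f' x) g = wint \<gamma> f g + k * wint \<gamma> f' g"
    by (rule wint_add_cmult_left[OF \<gamma>]) (use H1_D(1)[OF ff] H1_D(1)[OF f] H1_D(1)[OF f'] H1_D(1)[OF g] in auto)
  ultimately show ?thesis
    by (simp add: form_def sum.distrib sum_distrib_left algebra_simps)
qed

lemma form_add_cmult_right:
  assumes f: "f \<in> H1" and g: "g \<in> H1" and g': "g' \<in> H1"
  shows "B f (\<lambda>x. g x + k * g' x) = B f g + cnj k * B f g'"
proof -
  note gg = H1_add_cmult(1)[OF g g', of k]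
  have "wint \<alpha> (weak_partial i f) (weak_partial i (\<lambda>x. g x + k * g' x)) = 
     wint \<alpha> (weak_partial i f) (weak_partial i g) + cnj k * wint \<alpha> (weak_partial i f) (weak_partial i g')" if "i \<in> Basis" for i
    by (rule wint_add_cmult_right[OF \<alpha>]) (intro H1_D(3) gg f g' g that weak_partial_add_cmult)+
  moreover have "wint \<beta> (half_lap s f) (half_lap s (\<lambda>x. g x + k * g' x)) = 
      wint \<beta> (half_lap s f) (half_lap s g) + cnj k * wint \<beta> (half_lap s f) (half_lap s g')"
    by (rule wint_add_cmult_right[OF \<beta>]) (intro half_lap_L2 gg f g' g s half_lap_add_cmult)+
  moreover have "wint \<gamma> f (\<lambda>x. g x + k * g' x) = wint \<gamma> f g + cnj k * wint \<gamma> f g'"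
    by (rule wint_add_cmult_right[OF \<gamma>]) (use H1_D(1)[OF gg] H1_D(1)[OF f] H1_D(1)[OF g'] H1_D(1)[OF g] in auto)
  ultimately show ?thesis
    by (simp add: form_def sum.distrib sum_distrib_left algebra_simps)
qed

lemma form_coercive:
  assumes f: "f \<in> H1" and a: "AE x in lborel. \<alpha> x \<ge> k" and b: "AE x in lborel. \<beta> x \<ge> 0" and c: "AE x in lborel. \<gamma> x \<ge> k"
  shows "k * (H1_norm f)\<^sup>2 \<le> Re (B f f)"
proof -
  \<comment> \<open>The summand with factor 0 stands for the lower bound 0 of \<beta>; it gives all
    three lines the shape to which \<open>wint_self_ge\<close> applies.\<close>
  have "k * (H1_norm f)\<^sup>2 = (\<Sum>i\<in>Basis. k * (L2_norm (weak_partial i f))\<^sup>2) + 0 * (L2_norm (half_lap s f))\<^sup>2 + k * (L2_norm f)\<^sup>2"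
    by (simp add: H1_norm_sq sum_distrib_left distrib_left)
  also have "\<dots> \<le> (\<Sum>i\<in>Basis. Re (wint \<alpha> (weak_partial i f) (weak_partial i f))) + 
      Re (wint \<beta> (half_lap s f) (half_lap s f)) + Re (wint \<gamma> f f)"
    by (intro add_mono sum_mono wint_self_ge[OF \<alpha>] wint_self_ge[OF \<beta>] wint_self_ge[OF \<gamma>] H1_D f half_lap_L2 s a b c)
  finally show ?thesis by (simp add: form_def)
qed

end

lemma form_coeff_diff:
  assumes "elliptic s \<alpha> \<beta> \<gamma> M" "elliptic s \<alpha>' \<beta>' \<gamma>' M'" and f: "f \<in> H1" and g: "g \<in> H1"
  shows "form s \<alpha> \<beta> \<gamma> f g - form s \<alpha>' \<beta>' \<gamma>' f g = 
     form s (\<lambda>x. \<alpha> x - \<alpha>' x) (\<lambda>x. \<beta> x - \<beta>' x) (\<lambda>x. \<gamma> x - \<gamma>' x) f g"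
proof -
  interpret A: elliptic s \<alpha> \<beta> \<gamma> M by fact
  interpret A': elliptic s \<alpha>' \<beta>' \<gamma>' M' by fact
  show ?thesis
    unfolding form_def using f g A.s
    by (simp add: wint_coeff_diff[OF A.\<alpha> A'.\<alpha>, symmetric] wint_coeff_diff[OF A.\<beta> A'.\<beta>, symmetric] 
      wint_coeff_diff[OF A.\<gamma> A'.\<gamma>, symmetric] H1_D half_lap_L2 sum_subtractf)
qed

subsection \<open>Weak time derivatives\<close>

text \<open>Half-open intervals make the integral additive without boundary terms. Keeping (0,T) as
  the underlying space means that integrability is stated once, for all subintervals.\<close>

definition J :: "real \<Rightarrow> real \<Rightarrow> real \<Rightarrow> (real \<Rightarrow> 'b::{banach, second_countable_topology}) \<Rightarrow> 'b" where
  "J T a b f = (\<integral>\<tau>. indicator {a<..b} \<tau> *\<^sub>R f \<tau> \<partial>lebesgue_on {0<..<T})"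

lemma borel_measurable_lebesgue_onI:
  "f \<in> borel_measurable borel \<Longrightarrow> f \<in> borel_measurable (lebesgue_on S)"
  by (intro measurable_restrict_space1 measurable_completion) auto

lemma J_integrable:
  fixes f :: "real \<Rightarrow> 'b::{banach, second_countable_topology}"
  assumes "integrable (lebesgue_on {0<..<T}) f"
  shows "integrable (lebesgue_on {0<..<T}) (\<lambda>\<tau>. indicator {a<..b} \<tau> *\<^sub>R f \<tau>)"
proof (rule Bochner_Integration.integrable_bound[OF assms])
  have "(indicator {a<..b} :: real \<Rightarrow> real) \<in> borel_measurable (lebesgue_on {0<..<T})"
    by (intro borel_measurable_lebesgue_onI) simp
  then show "(\<lambda>\<tau>. indicator {a<..b} \<tau> *\<^sub>R f \<tau>) \<in> borel_measurable (lebesgue_on {0<..<T})"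
    using assms by (intro borel_measurable_scaleR) auto
qed (auto simp: indicator_def)

lemma J_split:
  assumes "integrable (lebesgue_on {0<..<T}) f" "a \<le> b" "b \<le> c"
  shows "J T a c f = J T a b f + J T b c f"
proof -
  have "(\<lambda>\<tau>. indicator {a<..c} \<tau> *\<^sub>R f \<tau>) = (\<lambda>\<tau>. indicator {a<..b} \<tau> *\<^sub>R f \<tau> + indicator {b<..c} \<tau> *\<^sub>R f \<tau>)"
    using assms by (auto simp: indicator_def)
  then show ?thesis unfolding J_def using assms by (simp add: J_integrable)
qed

lemma J_diff:
  assumes "integrable (lebesgue_on {0<..<T}) f" "integrable (lebesgue_on {0<..<T}) g"
  shows "J T a b (\<lambda>\<tau>. f \<tau> - g \<tau>) = J T a b f - J T a b g"
  unfolding J_def scaleR_right_diff_distrib using assms by (simp add: J_integrable)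

lemma J_cmult: "J T a b (\<lambda>\<tau>. c * f \<tau>) = c * J T a b (f :: real \<Rightarrow> real)"
  unfolding J_def by (simp add: mult.left_commute)

lemma J_Re:
  assumes "integrable (lebesgue_on {0<..<T}) f"
  shows "Re (J T a b f) = J T a b (\<lambda>\<tau>. Re (f \<tau>))"
  unfolding J_def by (subst integral_Re[OF J_integrable[OF assms], symmetric]) simp

lemma J_mono:
  assumes "integrable (lebesgue_on {0<..<T}) f" "integrable (lebesgue_on {0<..<T}) g"
    "\<And>\<tau>. \<tau> \<in> {0<..<T} \<Longrightarrow> a < \<tau> \<Longrightarrow> \<tau> \<le> b \<Longrightarrow> f \<tau> \<le> (g \<tau> :: real)"
  shows "J T a b f \<le> J T a b g"
  unfolding J_def using assms by (intro integral_mono J_integrable) (auto simp: indicator_def)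

lemma J_abs_le:
  assumes f: "integrable (lebesgue_on {0<..<T}) f" and g: "integrable (lebesgue_on {0<..<T}) g"
    and le: "\<And>\<tau>. \<tau> \<in> {0<..<T} \<Longrightarrow> a < \<tau> \<Longrightarrow> \<tau> \<le> b \<Longrightarrow> \<bar>f \<tau>\<bar> \<le> (g \<tau> :: real)"
  shows "\<bar>J T a b f\<bar> \<le> J T a b g"
proof -
  have "- J T a b f = J T a b (\<lambda>\<tau>. - f \<tau>)" by (simp add: J_def)
  moreover have "J T a b (\<lambda>\<tau>. - f \<tau>) \<le> J T a b g" using f le by (intro J_mono g) (auto simp: abs_le_iff)
  moreover have "J T a b f \<le> J T a b g" using le by (intro J_mono f g) (auto simp: abs_le_iff)
  ultimately show ?thesis by linarith
qed

lemma J_endpoints_tendsto: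
  assumes f: "integrable (lebesgue_on {0<..<T}) f"
    and lim: "\<And>\<tau>. \<tau> \<in> {0<..<T} \<Longrightarrow> eventually (\<lambda>n. \<tau> \<in> {a' n<..b' n} \<longleftrightarrow> \<tau> \<in> {a<..b}) sequentially"
  shows "(\<lambda>n. J T (a' n) (b' n) f) \<longlonglongrightarrow> J T a b f"
  unfolding J_def
proof (rule integral_dominated_convergence)
  show "integrable (lebesgue_on {0<..<T}) (\<lambda>\<tau>. norm (f \<tau>))" using f by (rule integrable_norm)
  show "(\<lambda>\<tau>. indicator {a<..b} \<tau> *\<^sub>R f \<tau>) \<in> borel_measurable (lebesgue_on {0<..<T})"
    "(\<lambda>\<tau>. indicator {a' n<..b' n} \<tau> *\<^sub>R f \<tau>) \<in> borel_measurable (lebesgue_on {0<..<T})" for n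
    by (rule borel_measurable_integrable[OF J_integrable[OF f]])+
  show "AE \<tau> in lebesgue_on {0<..<T}. (\<lambda>n. indicator {a' n<..b' n} \<tau> *\<^sub>R f \<tau>) \<longlonglongrightarrow> indicator {a<..b} \<tau> *\<^sub>R f \<tau>"
  proof (rule AE_I2)
    fix \<tau> assume "\<tau> \<in> space (lebesgue_on {0<..<T})"
    then have "eventually (\<lambda>n. \<tau> \<in> {a' n<..b' n} \<longleftrightarrow> \<tau> \<in> {a<..b}) sequentially" by (intro lim) simp
    then have "eventually (\<lambda>n. indicator {a' n<..b' n} \<tau> *\<^sub>R f \<tau> = indicator {a<..b} \<tau> *\<^sub>R f \<tau>) sequentially"
      by eventually_elim (simp add: indicator_def)
    then show "(\<lambda>n. indicator {a' n<..b' n} \<tau> *\<^sub>R f \<tau>) \<longlonglongrightarrow> indicator {a<..b} \<tau> *\<^sub>R f \<tau>"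
      by (rule tendsto_eventually)
  qed
qed (auto simp: indicator_def)

lemma step'_measurable[measurable]: "step' \<in> borel_measurable borel"
  by (rule borel_measurable_continuous_onI[OF Ck_step'[where k=0, unfolded Ck.simps(1)]])

text \<open>The mass is -1 because the step descends from 1 to 0.\<close>

lemma integral_step': "integrable lborel step'" "(\<integral>x. step' x \<partial>lborel) = -1"
proof -
  have "has_bochner_integral lborel (\<lambda>x. step' x * indicator {0..1} x) (step 1 - step 0)"
    by (rule has_bochner_integral_FTC_Icc_real)
       (use step_deriv Ck_step'[of 0] in \<open>auto intro: DERIV_subset continuous_on_interior simp: continuous_on_eq_continuous_at\<close>)
  moreover have "AE x in lborel. step' x * indicator {0..1} x = step' x"
  proof (rule AE_I2)
    show "step' x * indicator {0..1} x = step' x" for x using step'_0[of x] by (cases "x \<in> {0..1}") auto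
  qed
  then have "has_bochner_integral lborel (\<lambda>x. step' x * indicator {0..1} x) y \<longleftrightarrow> has_bochner_integral lborel step' y" for y
    by (intro has_bochner_integral_cong_AE) auto
  ultimately show "integrable lborel step'" "(\<integral>x. step' x \<partial>lborel) = -1"
    by (auto simp: has_bochner_integral_iff step_simps)
qed

text \<open>The rescaled derivative is an approximate point mass of weight -1 living on an interval
  that starts at \<open>c\<close> and has length at most \<open>d\<close>; the assumptions keep that
  interval inside (0,T).\<close>

lemma step'_concentrates:
  fixes F :: "real \<Rightarrow> complex"
  assumes F: "continuous_on {0..T} F" and c: "0 < c" "c + d < T" and d: "d > 0"
  shows "(\<lambda>n. \<integral>t. of_real (step' ((t - c) / (d / real (Suc n))) / (d / real (Suc n))) * F t \<partial>lebesgue_on {0<..<T}) \<longlonglongrightarrow> - F c"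
proof -
  \<comment> \<open>Constant continuation of \<open>F\<close> beyond [0,T], so that the substituted
    argument may range over the whole line.\<close>
  define G where "G t = F (max 0 (min T t))" for t
  have T: "0 < T" using c d by linarith
  have Gc: "continuous_on UNIV G" unfolding G_def
    by (rule continuous_on_compose2[OF F]) (use T in \<open>auto intro!: continuous_intros\<close>)
  have GF: "t \<in> {0..T} \<Longrightarrow> G t = F t" for t by (simp add: G_def)
  have [measurable]: "G \<in> borel_measurable borel" using Gc by (rule borel_measurable_continuous_onI)
  have "bounded (F ` {0..T})" using F by (intro compact_imp_bounded compact_continuous_image) auto
  then obtain S where "\<forall>t\<in>{0..T}. cmod (F t) \<le> S" by (auto simp: bounded_iff)
  then have S: "\<And>t. t \<in> {0..T} \<Longrightarrow> cmod (F t) \<le> S" by blast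
  have GS: "cmod (G t) \<le> S" for t unfolding G_def using T by (intro S) auto
  define \<delta> where "\<delta> n = d / real (Suc n)" for n
  have \<delta>: "0 < \<delta> n" "\<delta> n \<le> d" for n using d by (auto simp: \<delta>_def field_simps)
  have \<delta>0: "\<delta> \<longlonglongrightarrow> 0" unfolding \<delta>_def by real_asymp
  have e: "(\<integral>t. of_real (step' ((t - c) / \<delta> n) / \<delta> n) * F t \<partial>lebesgue_on {0<..<T}) = 
     (\<integral>x. of_real (step' x) * G (c + \<delta> n * x) \<partial>lborel)" for n
  proof -
    let ?k = "\<lambda>t. of_real (step' ((t - c) / \<delta> n) / \<delta> n) * G t"
    have [measurable]: "?k \<in> borel_measurable borel" by measurable
    have z: "?k t = 0" if "t \<notin> {0<..<T}" for t
    proof -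
      have "(t - c) / \<delta> n < 0 \<or> 1 < (t - c) / \<delta> n"
        using that c \<delta>[of n] by (auto simp: field_simps)
      then show ?thesis using step'_0 by simp
    qed
    have "(\<integral>t. of_real (step' ((t - c) / \<delta> n) / \<delta> n) * F t \<partial>lebesgue_on {0<..<T}) = (\<integral>t. ?k t \<partial>lebesgue_on {0<..<T})"
      by (rule Bochner_Integration.integral_cong) (auto simp: GF)
    also have "\<dots> = (\<integral>t. indicator {0<..<T} t *\<^sub>R ?k t \<partial>lebesgue)"
      by (rule integral_restrict_space) auto
    also have "\<dots> = (\<integral>t. ?k t \<partial>lebesgue)"
      by (rule Bochner_Integration.integral_cong[OF refl]) (use z in \<open>auto simp: indicator_def\<close>)
    also have "\<dots> = (\<integral>t. ?k t \<partial>lborel)" by (rule integral_completion) simp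
    also have "\<dots> = \<bar>\<delta> n\<bar> *\<^sub>R (\<integral>x. ?k (c + \<delta> n * x) \<partial>lborel)"
      by (rule lborel_integral_real_affine) (use \<delta>[of n] in simp)
    also have "(\<integral>x. ?k (c + \<delta> n * x) \<partial>lborel) = (\<integral>x. inverse (\<delta> n) *\<^sub>R (of_real (step' x) * G (c + \<delta> n * x)) \<partial>lborel)"
      using \<delta>[of n] by (intro Bochner_Integration.integral_cong[OF refl]) (simp add: scaleR_conv_of_real field_simps)
    also have "\<bar>\<delta> n\<bar> *\<^sub>R \<dots> = (\<integral>x. of_real (step' x) * G (c + \<delta> n * x) \<partial>lborel)"
      using \<delta>[of n] by simp
    finally show ?thesis .
  qed
  have "(\<lambda>n. \<integral>x. of_real (step' x) * G (c + \<delta> n * x) \<partial>lborel) \<longlonglongrightarrow> (\<integral>x. of_real (step' x) * G c \<partial>lborel)"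
  proof (rule integral_dominated_convergence)
    show "integrable lborel (\<lambda>x. S * \<bar>step' x\<bar>)" using integral_step'(1) by simp
    show "AE x in lborel. (\<lambda>n. of_real (step' x) * G (c + \<delta> n * x)) \<longlonglongrightarrow> of_real (step' x) * G c"
    proof (rule AE_I2, rule tendsto_mult[OF tendsto_const], rule continuous_on_tendsto_compose[OF Gc])
      fix x
      have "(\<lambda>n. c + \<delta> n * x) \<longlonglongrightarrow> c + 0 * x" by (intro tendsto_intros \<delta>0)
      then show "(\<lambda>n. c + \<delta> n * x) \<longlonglongrightarrow> c" by simp
    qed auto
    show "AE x in lborel. norm (of_real (step' x) * G (c + \<delta> n * x)) \<le> S * \<bar>step' x\<bar>" for n
    proof (rule AE_I2)
      show "norm (of_real (step' x) * G (c + \<delta> n * x)) \<le> S * \<bar>step' x\<bar>" for x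
        using mult_left_mono[OF GS[of "c + \<delta> n * x"], of "\<bar>step' x\<bar>"] by (simp add: norm_mult mult.commute[of S])
    qed
  qed measurable
  moreover have "(\<integral>x. of_real (step' x) * G c \<partial>lborel) = - G c"
  proof -
    have "(\<integral>x. of_real (step' x) * G c \<partial>lborel) = (\<integral>x. complex_of_real (step' x) \<partial>lborel) * G c" by simp
    also have "(\<integral>x. complex_of_real (step' x) \<partial>lborel) = of_real (\<integral>x. step' x \<partial>lborel)"
      by (rule integral_complex_of_real)
    finally show ?thesis by (simp add: integral_step')
  qed
  moreover have "G c = F c" using c d by (intro GF) auto
  ultimately show ?thesis unfolding e[unfolded \<delta>_def, symmetric] \<delta>_def by simp
qed

text \<open>The fundamental theorem of calculus follows by testing with smooth approximations of the
  indicator of the interval from \<open>a\<close> to \<open>b\<close>. Their derivatives are two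
  approximate point masses, which pick out the end point values of the continuous
  \<open>F\<close>.\<close>

lemma weak_derivative_imp_AC_open:
  fixes F G :: "real \<Rightarrow> complex"
  assumes F: "continuous_on {0..T} F" and G: "integrable (lebesgue_on {0<..<T}) G"
    and w: "\<And>\<eta> :: real \<Rightarrow> real. \<eta> \<in> test_functions {0<..<T} \<Longrightarrow> 
      (\<integral>t. of_real (vector_derivative \<eta> (at t)) * F t \<partial>lebesgue_on {0<..<T}) = 
      - (\<integral>t. of_real (\<eta> t) * G t \<partial>lebesgue_on {0<..<T})"
    and ab: "0 < a" "a < b" "b < T"
  shows "F b - F a = J T a b G"
proof -
  \<comment> \<open>Room to the right of \<open>b\<close>, where the descending ramp is
    placed.\<close>
  define d where "d = (T - b) / 2"
  have d: "d > 0" "b + d < T" "a + d < T" using ab by (auto simp: d_def field_simps)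
  define \<delta> where "\<delta> n = d / real (Suc n)" for n
  have \<delta>: "0 < \<delta> n" "\<delta> n \<le> d" for n using d by (auto simp: \<delta>_def field_simps)
  have \<delta>0: "\<delta> \<longlonglongrightarrow> 0" unfolding \<delta>_def by real_asymp
  define \<eta> where "\<eta> n t = step ((t - b) / \<delta> n) - step ((t - a) / \<delta> n)" for n t
  have Cl: "Ck k (\<lambda>t. step ((t - c) / \<delta> n))" for k c n
  proof -
    have "Ck k (\<lambda>t::real. (t - c) * inverse (\<delta> n))"
      by (intro Ck_mult Ck_diff Ck_const Ck_linear bounded_linear_ident)
    from Ck_compose_real[OF Ck_step this] show ?thesis by (simp add: divide_inverse)
  qed
  have \<eta>T: "\<eta> n \<in> test_functions {0<..<T}" for n
  proof -
    have "\<eta> n t = 0" if "t \<notin> {a..b + d}" for t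
    proof (cases "t < a")
      case True
      then have "(t - b) / \<delta> n \<le> 0" "(t - a) / \<delta> n \<le> 0"
        using ab \<delta>[of n] by (auto simp: field_simps)
      then show ?thesis by (simp add: \<eta>_def step_simps)
    next
      case False
      then have "t > b + \<delta> n" using that \<delta>[of n] by auto
      then have "1 \<le> (t - b) / \<delta> n" "1 \<le> (t - a) / \<delta> n"
        using ab \<delta>[of n] by (auto simp: field_simps)
      then show ?thesis by (simp add: \<eta>_def step_simps)
    qed
    moreover have "{a..b + d} \<subseteq> {0<..<T}" using ab d by auto
    ultimately show ?thesis
      unfolding test_functions_def \<eta>_def using Cl
      by (auto intro!: Ck_diff exI[of _ "{a..b + d}"])
  qed
  have der: "vector_derivative (\<eta> n) (at t) = step' ((t - b) / \<delta> n) / \<delta> n - step' ((t - a) / \<delta> n) / \<delta> n" for n t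
  proof (rule vector_derivative_at)
    have 1: "((\<lambda>t. step ((t - c) / \<delta> n)) has_real_derivative step' ((t - c) / \<delta> n) * (1 / \<delta> n)) (at t)" for c
      by (rule DERIV_chain2[OF step_deriv]) (use \<delta>[of n] in \<open>auto intro!: derivative_eq_intros\<close>)
    show "(\<eta> n has_vector_derivative step' ((t - b) / \<delta> n) / \<delta> n - step' ((t - a) / \<delta> n) / \<delta> n) (at t)"
      using DERIV_diff[OF 1[of b] 1[of a]] unfolding \<eta>_def[abs_def] has_real_derivative_iff_has_vector_derivative by simp
  qed
  have Fi: "integrable (lebesgue_on {0<..<T}) (\<lambda>t. of_real (step' ((t - c) / \<delta> n) / \<delta> n) * F t)" for c n
  proof -
    obtain C where C: "\<And>x. \<bar>step' x\<bar> \<le> C" using step'_bounded by blast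
    have "bounded (F ` {0..T})" using F by (intro compact_imp_bounded compact_continuous_image) auto
    then obtain S where "\<forall>t\<in>{0..T}. cmod (F t) \<le> S" by (auto simp: bounded_iff)
  then have S: "\<And>t. t \<in> {0..T} \<Longrightarrow> cmod (F t) \<le> S" by blast
    have Fm: "F \<in> borel_measurable (lebesgue_on {0<..<T})"
      by (rule continuous_imp_measurable_on_sets_lebesgue[OF continuous_on_subset[OF F]]) auto
    have sm: "(\<lambda>t. complex_of_real (step' ((t - c) / \<delta> n) / \<delta> n)) \<in> borel_measurable (lebesgue_on {0<..<T})"
      by (intro borel_measurable_lebesgue_onI) measurable
    show ?thesis
    proof (rule Bochner_Integration.integrable_bound)
      show "integrable (lebesgue_on {0<..<T}) (\<lambda>t. C / \<delta> n * S)"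
        by (intro finite_measure.integrable_const finite_measure_lebesgue_on) (use ab in \<open>auto simp: fmeasurable_def\<close>)
      show "AE t in lebesgue_on {0<..<T}. norm (of_real (step' ((t - c) / \<delta> n) / \<delta> n) * F t) \<le> norm (C / \<delta> n * S)"
      proof (rule AE_I2)
        fix t assume "t \<in> space (lebesgue_on {0<..<T})"
        then have "cmod (F t) \<le> S" by (intro S) auto
        moreover have "\<bar>step' ((t - c) / \<delta> n)\<bar> / \<delta> n \<le> C / \<delta> n" using C \<delta>[of n] by (simp add: divide_right_mono)
        moreover have "0 \<le> C" using C[of 0] by linarith
        ultimately have "\<bar>step' ((t - c) / \<delta> n)\<bar> / \<delta> n * cmod (F t) \<le> C / \<delta> n * S"
          using \<delta>[of n] by (intro mult_mono) auto
        moreover have n: "norm (of_real (step' ((t - c) / \<delta> n) / \<delta> n) * F t) = \<bar>step' ((t - c) / \<delta> n)\<bar> / \<delta> n * cmod (F t)"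
          using \<delta>[of n] by (simp add: norm_mult norm_divide)
        ultimately show "norm (of_real (step' ((t - c) / \<delta> n) / \<delta> n) * F t) \<le> norm (C / \<delta> n * S)"
          unfolding n real_norm_def by linarith
      qed
    qed (intro borel_measurable_times sm Fm)
  qed
  have L: "(\<lambda>n. \<integral>t. of_real (vector_derivative (\<eta> n) (at t)) * F t \<partial>lebesgue_on {0<..<T}) \<longlonglongrightarrow> - F b - - F a"
  proof -
    have "(\<integral>t. of_real (vector_derivative (\<eta> n) (at t)) * F t \<partial>lebesgue_on {0<..<T}) = 
      (\<integral>t. of_real (step' ((t - b) / \<delta> n) / \<delta> n) * F t \<partial>lebesgue_on {0<..<T}) - 
      (\<integral>t. of_real (step' ((t - a) / \<delta> n) / \<delta> n) * F t \<partial>lebesgue_on {0<..<T})" for n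
      unfolding der of_real_diff left_diff_distrib by (rule Bochner_Integration.integral_diff[OF Fi Fi])
    then show ?thesis
      using tendsto_diff[OF step'_concentrates[OF F, of b d] step'_concentrates[OF F, of a d]] ab d
      by (simp add: \<delta>_def del: of_nat_Suc)
  qed
  have R: "(\<lambda>n. \<integral>t. of_real (\<eta> n t) * G t \<partial>lebesgue_on {0<..<T}) \<longlonglongrightarrow> J T a b G"
    unfolding J_def
  proof (rule integral_dominated_convergence)
    show "integrable (lebesgue_on {0<..<T}) (\<lambda>t. norm (G t))" using G by (rule integrable_norm)
    show "(\<lambda>\<tau>. indicator {a<..b} \<tau> *\<^sub>R G \<tau>) \<in> borel_measurable (lebesgue_on {0<..<T})" 
      by (rule borel_measurable_integrable[OF J_integrable[OF G]])
    have "continuous_on UNIV (\<eta> n)" for n using test_functions_def \<eta>T[of n] Ck.simps(1)[of "\<eta> n"] by blast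
    then have [measurable]: "\<eta> n \<in> borel_measurable borel" for n by (rule borel_measurable_continuous_onI)
    have "(\<lambda>t. complex_of_real (\<eta> n t)) \<in> borel_measurable (lebesgue_on {0<..<T})" for n
      by (intro borel_measurable_lebesgue_onI) measurable
    then show "(\<lambda>t. of_real (\<eta> n t) * G t) \<in> borel_measurable (lebesgue_on {0<..<T})" for n
      using G by (intro borel_measurable_times) auto
    show "AE t in lebesgue_on {0<..<T}. norm (of_real (\<eta> n t) * G t) \<le> norm (G t)" for n
    proof (rule AE_I2)
      fix t
      have "\<bar>\<eta> n t\<bar> \<le> 1" unfolding \<eta>_def
        using step_range[of "(t - b) / \<delta> n"] step_range[of "(t - a) / \<delta> n"] by linarith
      then show "norm (of_real (\<eta> n t) * G t) \<le> norm (G t)" by (simp add: norm_mult mult_left_le_one_le)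
    qed
    \<comment> \<open>Both ramps lie to the right of their base points, so at \<open>a\<close> the
      value is always 0 and at \<open>b\<close> eventually 1: the limit is the half-open indicator
      used in \<open>J\<close>.\<close>
    show "AE t in lebesgue_on {0<..<T}. (\<lambda>n. of_real (\<eta> n t) * G t) \<longlonglongrightarrow> indicator {a<..b} t *\<^sub>R G t"
    proof (rule AE_I2, rule tendsto_eventually)
      fix t :: real
      have ev: "eventually (\<lambda>n. c < t \<longrightarrow> \<delta> n < t - c) sequentially" for c
        using order_tendstoD(2)[OF \<delta>0, of "t - c"] by (cases "c < t") auto
      have "eventually (\<lambda>n. \<eta> n t = indicator {a<..b} t) sequentially"
        using ev[of a] ev[of b]
      proof eventually_elim
        case (elim n)
        consider "t \<le> a" | "a < t" "t \<le> b" | "b < t" by linarith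
        then show ?case
        proof cases
          case 1
          then have "(t - b) / \<delta> n \<le> 0" "(t - a) / \<delta> n \<le> 0" using ab \<delta>[of n] by (auto simp: field_simps)
          then show ?thesis using 1 by (simp add: \<eta>_def step_simps)
        next
          case 2
          then have "(t - b) / \<delta> n \<le> 0" "1 \<le> (t - a) / \<delta> n" using elim ab \<delta>[of n] by (auto simp: field_simps)
          then show ?thesis using 2 by (simp add: \<eta>_def step_simps)
        next
          case 3
          then have "1 \<le> (t - b) / \<delta> n" "1 \<le> (t - a) / \<delta> n" using elim ab \<delta>[of n] by (auto simp: field_simps)
          then show ?thesis using 3 by (simp add: \<eta>_def step_simps)
        qed
      qed
      then show "eventually (\<lambda>n. of_real (\<eta> n t) * G t = indicator {a<..b} t *\<^sub>R G t) sequentially"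
        by eventually_elim (simp add: scaleR_conv_of_real)
    qed
  qed
  have "- F b - - F a = - J T a b G"
    using LIMSEQ_unique[OF L[unfolded w[OF \<eta>T]] tendsto_minus[OF R]] .
  then show ?thesis by (simp add: algebra_simps)
qed

text \<open>Test functions vanish near 0 and T, so these end points are reached only through
  continuity of \<open>F\<close> and dominated convergence of the integrals.\<close>

lemma weak_derivative_imp_AC:
  fixes F G :: "real \<Rightarrow> complex"
  assumes F: "continuous_on {0..T} F" and G: "integrable (lebesgue_on {0<..<T}) G"
    and w: "\<And>\<eta> :: real \<Rightarrow> real. \<eta> \<in> test_functions {0<..<T} \<Longrightarrow> 
      (\<integral>t. of_real (vector_derivative \<eta> (at t)) * F t \<partial>lebesgue_on {0<..<T}) = 
      - (\<integral>t. of_real (\<eta> t) * G t \<partial>lebesgue_on {0<..<T})"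
    and ab: "0 \<le> a" "a \<le> b" "b \<le> T"
  shows "F b - F a = J T a b G"
proof (cases "a = b")
  case True then show ?thesis by (simp add: J_def)
next
  case False
  \<comment> \<open>The shift 3 keeps \<open>h n\<close> below a third of the length, so that both
    end points can be moved inwards.\<close>
  define h where "h n = (b - a) / (real n + 3)" for n
  have h: "0 < h n" "a + h n < b - h n" for n
  proof -
    have "h n \<le> (b - a) / 3" unfolding h_def by (rule divide_left_mono) (use ab in auto)
    then have "3 * h n \<le> b - a" by simp
    moreover show "0 < h n" using False ab by (simp add: h_def)
    moreover have "a < b" using False ab by simp
    ultimately show "a + h n < b - h n" by linarith
  qed
  have h0: "h \<longlonglongrightarrow> 0" unfolding h_def by real_asymp
  have 1: "F (b - h m) - F a = J T a (b - h m) G" for m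
  proof (rule LIMSEQ_unique)
    have small: "eventually (\<lambda>n. a + h n < b - h m) sequentially"
    proof -
      have "(\<lambda>n. a + h n) \<longlonglongrightarrow> a + 0" by (intro tendsto_intros h0)
      then show ?thesis using order_tendstoD(2)[of _ a sequentially "b - h m"] h[of m] by simp
    qed
    have "(\<lambda>n. F (a + h n)) \<longlonglongrightarrow> F a"
    proof (rule continuous_on_tendsto_compose[OF F])
      have "(\<lambda>n. a + h n) \<longlonglongrightarrow> a + 0" by (intro tendsto_intros h0)
      then show "(\<lambda>n. a + h n) \<longlonglongrightarrow> a" by simp
      show "eventually (\<lambda>n. a + h n \<in> {0..T}) sequentially"
        by (rule always_eventually) (smt (verit) h ab atLeastAtMost_iff)
    qed (use ab in auto)
    then have "(\<lambda>n. F (b - h m) - F (a + h n)) \<longlonglongrightarrow> F (b - h m) - F a" by (intro tendsto_intros)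
    then show "(\<lambda>n. J T (a + h n) (b - h m) G) \<longlonglongrightarrow> F (b - h m) - F a"
    proof (rule Lim_transform_eventually)
      show "eventually (\<lambda>n. F (b - h m) - F (a + h n) = J T (a + h n) (b - h m) G) sequentially"
        using small by eventually_elim 
          (rule weak_derivative_imp_AC_open[OF F G w], use ab h in \<open>auto simp: add_nonneg_pos\<close>, smt (verit) h ab)
    qed
    show "(\<lambda>n. J T (a + h n) (b - h m) G) \<longlonglongrightarrow> J T a (b - h m) G"
    proof (rule J_endpoints_tendsto[OF G])
      fix \<tau>
      have "eventually (\<lambda>n. a < \<tau> \<longrightarrow> h n < \<tau> - a) sequentially"
        using order_tendstoD(2)[OF h0, of "\<tau> - a"] by (cases "a < \<tau>") auto
      then show "eventually (\<lambda>n. (\<tau> \<in> {a + h n<..b - h m}) = (\<tau> \<in> {a<..b - h m})) sequentially"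
        by eventually_elim (smt (verit) greaterThanAtMost_iff h(1))
    qed
  qed
  \<comment> \<open>For b < T the right end is already covered by the open case. For b = T the
    intervals ending at \<open>b - h n\<close> never contain \<open>b\<close>, which is harmless
    because T itself lies outside the domain of integration.\<close>
  show ?thesis
  proof (cases "b = T")
    case False
    define a1 where "a1 = b - h 0"
    have a1: "0 < a1" "a1 < b" using h[of 0] ab by (auto simp: a1_def)
    have "F b - F a1 = J T a1 b G"
      by (rule weak_derivative_imp_AC_open[OF F G w]) (use a1 ab False in auto)
    moreover have "F a1 - F a = J T a a1 G" unfolding a1_def by (rule 1)
    moreover have "J T a b G = J T a a1 G + J T a1 b G"
      by (rule J_split[OF G]) (use a1 h[of 0] in \<open>auto simp: a1_def\<close>)
    ultimately show ?thesis by (simp add: algebra_simps)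
  next
    case True
    show ?thesis
    proof (rule LIMSEQ_unique)
      have "(\<lambda>n. F (b - h n)) \<longlonglongrightarrow> F b"
      proof (rule continuous_on_tendsto_compose[OF F])
        have "(\<lambda>n. b - h n) \<longlonglongrightarrow> b - 0" by (intro tendsto_intros h0)
        then show "(\<lambda>n. b - h n) \<longlonglongrightarrow> b" by simp
        show "eventually (\<lambda>n. b - h n \<in> {0..T}) sequentially"
          by (rule always_eventually) (smt (verit) h ab atLeastAtMost_iff)
      qed (use ab in auto)
      then show "(\<lambda>n. F (b - h n) - F a) \<longlonglongrightarrow> F b - F a" by (intro tendsto_intros)
      show "(\<lambda>n. F (b - h n) - F a) \<longlonglongrightarrow> J T a b G" unfolding 1
      proof (rule J_endpoints_tendsto[OF G])
        fix \<tau> assume \<tau>: "\<tau> \<in> {0<..<T}"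
        have "eventually (\<lambda>n. h n < b - \<tau>) sequentially"
          by (rule order_tendstoD(2)[OF h0]) (use \<tau> True in auto)
        then show "eventually (\<lambda>n. (\<tau> \<in> {a<..b - h n}) = (\<tau> \<in> {a<..b})) sequentially"
          by eventually_elim (smt (verit) greaterThanAtMost_iff h(1))
      qed
    qed
  qed
qed

subsection \<open>The energy identity\<close>

lemma low_tendsto_L2:
  fixes f :: "'a::euclidean_space \<Rightarrow> complex"
  assumes f: "f \<in> L2"
  shows "(\<lambda>n. L2_norm (\<lambda>x. low (real n) f x - f x)) \<longlonglongrightarrow> 0"
proof -
  let ?c = "pconst TYPE('a)"
  have "(\<lambda>n. L2_norm (\<lambda>\<xi>. fourier (low (real n) f) \<xi> - fourier f \<xi>)) \<longlonglongrightarrow> 0"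
  proof (rule L2_tendsto_dominated(2)[OF _ _ fourier_L2[OF f]])
    have ae: "AE \<xi> in lborel. \<forall>n::nat. fourier (low (real n) f) \<xi> = indicator (cball 0 (real n)) \<xi> * fourier f \<xi>"
      unfolding AE_all_countable using low_works(2)[OF f] by blast
    then show "AE \<xi> in lborel. (\<lambda>n. fourier (low (real n) f) \<xi>) \<longlonglongrightarrow> fourier f \<xi>"
    proof eventually_elim
      case (elim \<xi>)
      have "eventually (\<lambda>n. real n \<ge> norm \<xi>) sequentially" by real_asymp
      then have "eventually (\<lambda>n. fourier (low (real n) f) \<xi> = fourier f \<xi>) sequentially"
        by eventually_elim (simp add: elim)
      then show ?case by (rule tendsto_eventually)
    qed
    show "AE \<xi> in lborel. cmod (fourier (low (real n) f) \<xi>) \<le> cmod (fourier f \<xi>)" for n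
      using ae by eventually_elim (simp add: norm_mult indicator_def)
  qed (intro L2_measurable fourier_L2 low_works f)+
  then have "(\<lambda>n. inverse ?c * (?c * L2_norm (\<lambda>x. low (real n) f x - f x))) \<longlonglongrightarrow> inverse ?c * 0"
    unfolding fourier_norm_diff[OF low_works(1)[OF f] f] by (intro tendsto_intros)
  then show ?thesis using pconst_pos[where 'a='a] by (simp add: mult.assoc[symmetric])
qed

text \<open>For a self-adjoint projection P the difference of energies is the real part of (f - g,
  Pf + Pg). The second argument is one element of H1, hence an admissible test function for the
  integrated equation.\<close>

lemma low_energy_difference:
  fixes f g :: "'a::euclidean_space \<Rightarrow> complex"
  assumes f: "f \<in> L2" and g: "g \<in> L2"
  shows "(L2_norm (low R f))\<^sup>2 - (L2_norm (low R g))\<^sup>2 = 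
     Re (ip f (\<lambda>x. low R f x + low R g x) - ip g (\<lambda>x. low R f x + low R g x))"
proof -
  note L = low_works(1)[OF f, of R] low_works(1)[OF g, of R]
  have "ip f (\<lambda>x. low R f x + low R g x) - ip g (\<lambda>x. low R f x + low R g x) = 
    ip (low R f) (low R f) - ip (low R g) (low R g) + (ip (low R f) (low R g) - cnj (ip (low R f) (low R g)))"
    unfolding ip_cnj unfolding low_ip[OF f f] low_ip[OF f g] low_ip[OF g f] low_ip[OF g g]
    using f g L by (simp add: ip_add_right)
  then show ?thesis by (simp add: ip_self)
qed

lemma tendsto_at_within_compose_same:
  fixes f :: "real \<Rightarrow> real"
  assumes "(f \<longlongrightarrow> f x) (at x within S)" "r \<longlonglongrightarrow> x" "\<And>n. r n \<in> S" "f x = y"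
  shows "(\<lambda>n. f (r n)) \<longlonglongrightarrow> y"
proof -
  have "continuous (at x within S) f" using assms(1) by (simp add: continuous_within)
  then show ?thesis using assms(2-4) by (auto simp: continuous_within_sequentially comp_def)
qed

text \<open>
  Frequency truncation commutes with both inner products and maps L2 continuously to H1, so the
  truncated function is norm continuous in time with values in H1 and its energy can be
  differentiated directly; the cut-off is removed by dominated convergence.
\<close>

locale energy =
  fixes T :: real and z :: "real \<Rightarrow> 'a::euclidean_space \<Rightarrow> complex"
    and l :: "real \<Rightarrow> ('a \<Rightarrow> complex) \<Rightarrow> complex" and K D :: "real \<Rightarrow> real"
  assumes T: "0 < T"
    and zL: "\<And>t. t \<in> {0..T} \<Longrightarrow> z t \<in> L2"
    and zc: "\<And>t. t \<in> {0..T} \<Longrightarrow> ((\<lambda>\<tau>. L2_norm (\<lambda>x. z \<tau> x - z t x)) \<longlongrightarrow> 0) (at t within {0..T})"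
    and meas: "\<And>\<phi>. \<phi> \<in> H1 \<Longrightarrow> (\<lambda>\<tau>. l \<tau> \<phi>) \<in> borel_measurable (lebesgue_on {0<..<T})"
    and lin: "\<And>\<tau> \<phi> \<psi> k. \<tau> \<in> {0<..<T} \<Longrightarrow> \<phi> \<in> H1 \<Longrightarrow> \<psi> \<in> H1 \<Longrightarrow> l \<tau> (\<lambda>x. \<phi> x + k * \<psi> x) = l \<tau> \<phi> + cnj k * l \<tau> \<psi>"
    and bd: "\<And>\<tau> \<phi>. \<tau> \<in> {0<..<T} \<Longrightarrow> \<phi> \<in> H1 \<Longrightarrow> cmod (l \<tau> \<phi>) \<le> K \<tau> * H1_norm \<phi>"
    and K: "integrable (lebesgue_on {0<..<T}) K" "\<And>\<tau>. 0 \<le> K \<tau>"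
    and zH: "\<And>\<tau>. \<tau> \<in> {0<..<T} \<Longrightarrow> (z \<tau> \<in> H1 \<and> K \<tau> * H1_norm (z \<tau>) \<le> D \<tau>) \<or> l \<tau> = (\<lambda>\<phi>. 0)"
    and D: "integrable (lebesgue_on {0<..<T}) D" "\<And>\<tau>. 0 \<le> D \<tau>"
    and ac: "\<And>\<phi> a b. \<phi> \<in> H1 \<Longrightarrow> 0 \<le> a \<Longrightarrow> a \<le> b \<Longrightarrow> b \<le> T \<Longrightarrow> ip (z b) \<phi> - ip (z a) \<phi> = J T a b (\<lambda>\<tau>. l \<tau> \<phi>)"
begin

abbreviation "\<mu> \<equiv> lebesgue_on {0<..<T}"

lemma l_add: "\<tau> \<in> {0<..<T} \<Longrightarrow> \<phi> \<in> H1 \<Longrightarrow> \<psi> \<in> H1 \<Longrightarrow> l \<tau> (\<lambda>x. \<phi> x + \<psi> x) = l \<tau> \<phi> + l \<tau> \<psi>"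
  using lin[of \<tau> \<phi> \<psi> 1] by simp

lemma l_diff: "\<tau> \<in> {0<..<T} \<Longrightarrow> \<phi> \<in> H1 \<Longrightarrow> \<psi> \<in> H1 \<Longrightarrow> l \<tau> (\<lambda>x. \<phi> x - \<psi> x) = l \<tau> \<phi> - l \<tau> \<psi>"
  using lin[of \<tau> \<phi> \<psi> "-1"] by simp

lemma l_diff_le:
  "\<tau> \<in> {0<..<T} \<Longrightarrow> \<phi> \<in> H1 \<Longrightarrow> \<psi> \<in> H1 \<Longrightarrow> cmod (l \<tau> \<phi> - l \<tau> \<psi>) \<le> K \<tau> * H1_norm (\<lambda>x. \<phi> x - \<psi> x)"
  using bd[OF _ H1_diff] l_diff by metis

lemma l_integrable: "\<phi> \<in> H1 \<Longrightarrow> integrable \<mu> (\<lambda>\<tau>. l \<tau> \<phi>)"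
  by (rule Bochner_Integration.integrable_bound[OF integrable_mult_left[OF K(1), of "H1_norm \<phi>"] meas])
     (use bd K(2) in \<open>auto intro!: AE_I2\<close>)

abbreviation g :: "real \<Rightarrow> real \<Rightarrow> 'a \<Rightarrow> complex" where "g R t \<equiv> low R (z t)"

lemma g_H1: "t \<in> {0..T} \<Longrightarrow> g R t \<in> H1"
  by (intro low_H1 zL)

lemma l_g_diff_le:
  assumes "\<tau> \<in> {0<..<T}" "t \<in> {0..T}" "t' \<in> {0..T}"
  shows "cmod (l \<tau> (g R t) - l \<tau> (g R t')) \<le> K \<tau> * (sqrt (1 + R\<^sup>2) * L2_norm (\<lambda>x. z t x - z t' x))"
  by (rule order_trans[OF l_diff_le[OF assms(1) g_H1[OF assms(2)] g_H1[OF assms(3)]]])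
     (intro mult_left_mono low_diff_H1_norm zL assms K)

text \<open>Measurability is available only for a fixed test function. Sampling the moving one at
  grid points just below \<tau> involves countably many test functions for each mesh, and continuity
  of the truncated function in H1 gives the limit.\<close>

lemma l_g_measurable: "(\<lambda>\<tau>. l \<tau> (g R \<tau>)) \<in> borel_measurable \<mu>"
proof (rule borel_measurable_LIMSEQ_metric)
  define r where "r n i = real_of_int i / real (Suc n)" for n i
  define r' where "r' n \<tau> = r n \<lfloor>real (Suc n) * \<tau>\<rfloor>" for n \<tau>
  \<comment> \<open>The value 0 is a default for grid points outside [0,T]; the points relevant to a
    given \<tau> all lie in [0,T].\<close>
  let ?f = "\<lambda>n i \<tau>. if r n i \<in> {0..T} then l \<tau> (g R (r n i)) else 0"
  show "(\<lambda>\<tau>. ?f n \<lfloor>real (Suc n) * \<tau>\<rfloor> \<tau>) \<in> borel_measurable \<mu>" for n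
  proof (rule measurable_compose_countable)
    show "(\<lambda>\<tau>. ?f n i \<tau>) \<in> borel_measurable \<mu>" for i using meas[OF g_H1, of "r n i" R] by (cases "r n i \<in> {0..T}") (simp_all del: atLeastAtMost_iff)
    have "(\<lambda>\<tau>. \<lfloor>real (Suc n) * \<tau>\<rfloor>) \<in> measurable borel (count_space UNIV)" by measurable
    then show "(\<lambda>\<tau>. \<lfloor>real (Suc n) * \<tau>\<rfloor>) \<in> measurable \<mu> (count_space UNIV)"
      by (intro measurable_restrict_space1 measurable_completion) simp
  qed
  fix \<tau> assume "\<tau> \<in> space \<mu>"
  then have \<tau>: "\<tau> \<in> {0<..<T}" by simp
  have r: "0 \<le> r' n \<tau>" "r' n \<tau> \<le> \<tau>" "\<tau> - 1 / real (Suc n) \<le> r' n \<tau>" for n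
  proof -
    have "0 \<le> real (Suc n) * \<tau>" using \<tau> by simp
    then show "0 \<le> r' n \<tau>" by (simp add: r'_def r_def del: of_nat_Suc)
    have "real_of_int \<lfloor>real (Suc n) * \<tau>\<rfloor> \<le> real (Suc n) * \<tau>" by simp
    then show "r' n \<tau> \<le> \<tau>" by (simp add: r'_def r_def divide_le_eq mult.commute del: of_nat_Suc)
    have "real (Suc n) * \<tau> - 1 \<le> real_of_int \<lfloor>real (Suc n) * \<tau>\<rfloor>" by linarith
    then have "(real (Suc n) * \<tau> - 1) / real (Suc n) \<le> r' n \<tau>"
      unfolding r'_def r_def by (rule divide_right_mono) simp
    then show "\<tau> - 1 / real (Suc n) \<le> r' n \<tau>" by (simp add: diff_divide_distrib del: of_nat_Suc)
  qed
  have rT: "r' n \<tau> \<in> {0..T}" for n using r[of n] \<tau> by auto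
  have "(\<lambda>n. r' n \<tau>) \<longlonglongrightarrow> \<tau>"
  proof (rule tendsto_sandwich[OF _ _ _ tendsto_const])
    show "(\<lambda>n. \<tau> - 1 / real (Suc n)) \<longlonglongrightarrow> \<tau>" by real_asymp
  qed (use r in auto)
  then have "(\<lambda>n. L2_norm (\<lambda>x. z (r' n \<tau>) x - z \<tau> x)) \<longlonglongrightarrow> 0"
    using zc[of \<tau>] rT \<tau> 
    by (intro tendsto_at_within_compose_same[where f="\<lambda>t. L2_norm (\<lambda>x. z t x - z \<tau> x)"]) auto
  then have "(\<lambda>n. K \<tau> * (sqrt (1 + R\<^sup>2) * L2_norm (\<lambda>x. z (r' n \<tau>) x - z \<tau> x))) \<longlonglongrightarrow> K \<tau> * (sqrt (1 + R\<^sup>2) * 0)"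
    by (intro tendsto_intros)
  then have 0: "(\<lambda>n. K \<tau> * (sqrt (1 + R\<^sup>2) * L2_norm (\<lambda>x. z (r' n \<tau>) x - z \<tau> x))) \<longlonglongrightarrow> 0" by simp
  have "(\<lambda>n. l \<tau> (g R (r' n \<tau>))) \<longlonglongrightarrow> l \<tau> (g R \<tau>)"
    by (rule LIM_zero_cancel, rule Lim_null_comparison[OF _ 0])
       (use l_g_diff_le[OF \<tau> rT] \<tau> in auto)
  then show "(\<lambda>n. ?f n \<lfloor>real (Suc n) * \<tau>\<rfloor> \<tau>) \<longlonglongrightarrow> l \<tau> (g R \<tau>)"
    using rT unfolding r'_def by simp
qed

text \<open>The bound does not depend on \<open>R\<close>, which is what allows the cut-off to be
  removed. At exceptional times \<open>z \<tau>\<close> may lie outside H1; there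
  \<open>l \<tau>\<close> is the zero functional.\<close>

lemma l_g_le:
  assumes \<tau>: "\<tau> \<in> {0<..<T}" shows "cmod (l \<tau> (g R \<tau>)) \<le> D \<tau>"
proof (cases "l \<tau> = (\<lambda>\<phi>. 0)")
  case False
  then have z: "z \<tau> \<in> H1" "K \<tau> * H1_norm (z \<tau>) \<le> D \<tau>" using zH[OF \<tau>] by auto
  have "cmod (l \<tau> (g R \<tau>)) \<le> K \<tau> * H1_norm (g R \<tau>)" using \<tau> by (intro bd g_H1) auto
  also have "\<dots> \<le> K \<tau> * H1_norm (z \<tau>)" by (intro mult_left_mono low_norm_le z K)
  finally show ?thesis using z(2) by linarith
qed (simp add: D(2))

lemma l_g_integrable: "integrable \<mu> (\<lambda>\<tau>. l \<tau> (g R \<tau>))"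
  by (rule Bochner_Integration.integrable_bound[OF D(1) l_g_measurable]) (use l_g_le D(2) in auto)

text \<open>Bisection replaces differentiation of the energy: the claim adds up over adjacent
  intervals, because its error term is itself an integral, and it holds on all short intervals
  around a point.\<close>

lemma truncated_identity_approx:
  assumes e: "e > 0" and ab: "0 \<le> a" "a \<le> b" "b \<le> T"
  shows "\<bar>(L2_norm (g R b))\<^sup>2 - (L2_norm (g R a))\<^sup>2 - J T a b (\<lambda>\<tau>. 2 * Re (l \<tau> (g R \<tau>)))\<bar> \<le> e * J T a b K"
proof -
  define q where "q \<tau> = 2 * Re (l \<tau> (g R \<tau>))" for \<tau>
  have q: "integrable \<mu> q" unfolding q_def using l_g_integrable by (intro integrable_mult_right integrable_Re)
  \<comment> \<open>The guards are needed because the intervals around a point in the bisection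
    principle range over all reals.\<close>
  define P where "P a b \<longleftrightarrow> (0 \<le> a \<longrightarrow> b \<le> T \<longrightarrow> \<bar>(L2_norm (g R b))\<^sup>2 - (L2_norm (g R a))\<^sup>2 - J T a b q\<bar> \<le> e * J T a b K)" for a b
  define C where "C = sqrt (1 + R\<^sup>2)"
  have C: "C > 0" by (simp add: C_def add_pos_nonneg)
  have "P a b"
  proof (rule Bolzano)
    show "a \<le> b" by fact
  next
    fix a b c assume P: "P a b" "P b c" and o: "a \<le> b" "b \<le> c"
    show "P a c" unfolding P_def
    proof (intro impI)
      assume "0 \<le> a" "c \<le> T"
      with P o have "\<bar>(L2_norm (g R b))\<^sup>2 - (L2_norm (g R a))\<^sup>2 - J T a b q\<bar> \<le> e * J T a b K"
        "\<bar>(L2_norm (g R c))\<^sup>2 - (L2_norm (g R b))\<^sup>2 - J T b c q\<bar> \<le> e * J T b c K" by (auto simp: P_def)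
      then show "\<bar>(L2_norm (g R c))\<^sup>2 - (L2_norm (g R a))\<^sup>2 - J T a c q\<bar> \<le> e * J T a c K"
        unfolding J_split[OF q o] J_split[OF K(1) o] distrib_left by linarith
    qed
  next
    fix x assume x: "a \<le> x" "x \<le> b"
    then have xT: "x \<in> {0..T}" using ab by auto
    \<comment> \<open>Passing through \<open>x\<close> doubles the distance, \<open>C\<close> is the
      cost of going from L2 to H1, and there are two such differences: together the factor 4
      C.\<close>
    define e' where "e' = e / (4 * C)"
    have e': "e' > 0" using e C by (simp add: e'_def)
    from tendstoD[OF zc[OF xT] e'] obtain d where d: "d > 0" 
      "\<And>t. t \<in> {0..T} \<Longrightarrow> t \<noteq> x \<Longrightarrow> dist t x < d \<Longrightarrow> L2_norm (\<lambda>y. z t y - z x y) < e'"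
      by (auto simp: eventually_at)
    have dx: "L2_norm (\<lambda>y. z t y - z x y) \<le> e'" if "t \<in> {0..T}" "\<bar>t - x\<bar> < d" for t
      using d(2)[OF that(1)] that(2) e' by (cases "t = x") (auto simp: dist_real_def less_imp_le)
    have dd: "L2_norm (\<lambda>y. z t y - z t' y) \<le> 2 * e'" if "t \<in> {0..T}" "\<bar>t - x\<bar> < d" "t' \<in> {0..T}" "\<bar>t' - x\<bar> < d" for t t'
      using L2_norm_triangle3[OF zL[OF that(1)] zL[OF that(3)] zL[OF xT]] dx[OF that(1,2)] dx[OF that(3,4)]
        L2_norm_minus_commute[of "z x" "z t'"] by linarith
    show "\<exists>d>0. \<forall>a b. a \<le> x \<and> x \<le> b \<and> b - a < d \<longrightarrow> P a b"
    proof (intro exI[of _ d] conjI d(1) allI impI)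
      fix a b assume ax: "a \<le> x \<and> x \<le> b \<and> b - a < d"
      show "P a b" unfolding P_def
      proof (intro impI)
        assume o: "0 \<le> a" "b \<le> T"
        have aT: "a \<in> {0..T}" "b \<in> {0..T}" using o ax by auto
        \<comment> \<open>On a short interval the moving test function, twice the truncated
          \<open>z\<close>, is frozen to the sum of its end point values, for which the scalar
          identity is available.\<close>
        let ?\<psi> = "\<lambda>x. g R b x + g R a x"
        have \<psi>: "?\<psi> \<in> H1" by (intro H1_add g_H1 aT)
        have "(L2_norm (g R b))\<^sup>2 - (L2_norm (g R a))\<^sup>2 = Re (J T a b (\<lambda>\<tau>. l \<tau> ?\<psi>))"
          unfolding low_energy_difference[OF zL[OF aT(2)] zL[OF aT(1)]]
          by (subst ac[OF \<psi>]) (use o ax in auto)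
        also have "\<dots> = J T a b (\<lambda>\<tau>. Re (l \<tau> ?\<psi>))" by (rule J_Re[OF l_integrable[OF \<psi>]])
        finally have "(L2_norm (g R b))\<^sup>2 - (L2_norm (g R a))\<^sup>2 - J T a b q = J T a b (\<lambda>\<tau>. Re (l \<tau> ?\<psi>) - q \<tau>)"
          using J_diff[OF integrable_Re[OF l_integrable[OF \<psi>]] q] by simp
        also have "\<bar>J T a b (\<lambda>\<tau>. Re (l \<tau> ?\<psi>) - q \<tau>)\<bar> \<le> J T a b (\<lambda>\<tau>. e * K \<tau>)"
        proof (rule J_abs_le)
          show "integrable \<mu> (\<lambda>\<tau>. Re (l \<tau> ?\<psi>) - q \<tau>)"
            by (intro Bochner_Integration.integrable_diff q integrable_Re l_integrable \<psi>)
          show "integrable \<mu> (\<lambda>\<tau>. e * K \<tau>)" using K(1) by simp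
          fix \<tau> assume \<tau>: "\<tau> \<in> {0<..<T}" "a < \<tau>" "\<tau> \<le> b"
          then have \<tau>': "\<tau> \<in> {0..T}" "\<bar>\<tau> - x\<bar> < d" "\<bar>a - x\<bar> < d" "\<bar>b - x\<bar> < d" using ax by auto
          have "Re (l \<tau> ?\<psi>) - q \<tau> = Re ((l \<tau> (g R b) - l \<tau> (g R \<tau>)) + (l \<tau> (g R a) - l \<tau> (g R \<tau>)))"
            by (simp add: l_add[OF \<tau>(1) g_H1[OF aT(2)] g_H1[OF aT(1)]] q_def)
          also have "\<bar>\<dots>\<bar> \<le> cmod (l \<tau> (g R b) - l \<tau> (g R \<tau>)) + cmod (l \<tau> (g R a) - l \<tau> (g R \<tau>))"
            by (rule order_trans[OF abs_Re_le_cmod norm_triangle_ineq])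
          also have "\<dots> \<le> K \<tau> * (C * (2 * e')) + K \<tau> * (C * (2 * e'))"
            using C unfolding C_def[symmetric]
            by (intro add_mono order_trans[OF l_g_diff_le[OF \<tau>(1)]] mult_left_mono K(2))
               (use dd aT \<tau>' in \<open>auto simp: C_def[symmetric]\<close>)
          also have "\<dots> = e * K \<tau>" using C by (simp add: e'_def)
          finally show "\<bar>Re (l \<tau> ?\<psi>) - q \<tau>\<bar> \<le> e * K \<tau>" .
        qed
        finally show "\<bar>(L2_norm (g R b))\<^sup>2 - (L2_norm (g R a))\<^sup>2 - J T a b q\<bar> \<le> e * J T a b K"
          by (simp only: J_cmult)
      qed
    qed
  qed
  then show ?thesis using ab by (simp add: P_def q_def[abs_def])
qed

lemma truncated_identity:
  assumes ab: "0 \<le> a" "a \<le> b" "b \<le> T"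
  shows "(L2_norm (g R b))\<^sup>2 - (L2_norm (g R a))\<^sup>2 = J T a b (\<lambda>\<tau>. 2 * Re (l \<tau> (g R \<tau>)))"
proof -
  let ?x = "\<bar>(L2_norm (g R b))\<^sup>2 - (L2_norm (g R a))\<^sup>2 - J T a b (\<lambda>\<tau>. 2 * Re (l \<tau> (g R \<tau>)))\<bar>"
  have "?x \<le> 0"
  proof (rule field_le_epsilon)
    fix e :: real assume e: "e > 0"
    have J: "0 \<le> J T a b K" unfolding J_def using K(2) by (intro Bochner_Integration.integral_nonneg) simp
    \<comment> \<open>Adding 1 avoids division by a vanishing integral.\<close>
    have "?x \<le> e / (J T a b K + 1) * J T a b K"
      using e J by (intro truncated_identity_approx ab) simp
    also have "\<dots> \<le> e" using e J by (simp add: field_simps)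
    finally show "?x \<le> 0 + e" by simp
  qed
  then show ?thesis by simp
qed

lemma l_g_tendsto:
  assumes \<tau>: "\<tau> \<in> {0<..<T}"
  shows "(\<lambda>n. l \<tau> (g (real n) \<tau>)) \<longlonglongrightarrow> l \<tau> (z \<tau>)"
proof (cases "l \<tau> = (\<lambda>\<phi>. 0)")
  case False
  then have z: "z \<tau> \<in> H1" using zH[OF \<tau>] by auto
  have 0: "(\<lambda>n. K \<tau> * H1_norm (\<lambda>x. g (real n) \<tau> x - z \<tau> x)) \<longlonglongrightarrow> 0"
    using tendsto_mult_left[OF low_tendsto[OF z], of "K \<tau>"] by simp
  show ?thesis
    by (rule LIM_zero_cancel, rule Lim_null_comparison[OF _ 0])
       (use l_diff_le[OF \<tau> g_H1 z] \<tau> in auto)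
qed simp

theorem energy_identity:
  shows "integrable \<mu> (\<lambda>\<tau>. Re (l \<tau> (z \<tau>)))"
    and "t \<in> {0..T} \<Longrightarrow> (L2_norm (z t))\<^sup>2 - (L2_norm (z 0))\<^sup>2 = J T 0 t (\<lambda>\<tau>. 2 * Re (l \<tau> (z \<tau>)))"
proof -
  have m: "(\<lambda>\<tau>. l \<tau> (z \<tau>)) \<in> borel_measurable \<mu>"
    by (rule borel_measurable_LIMSEQ_metric[OF l_g_measurable]) (use l_g_tendsto in simp)
  have le: "cmod (l \<tau> (z \<tau>)) \<le> D \<tau>" if \<tau>: "\<tau> \<in> {0<..<T}" for \<tau>
    by (rule tendsto_upperbound[OF tendsto_norm[OF l_g_tendsto[OF \<tau>]]]) (use l_g_le[OF \<tau>] in auto)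
  have i: "integrable \<mu> (\<lambda>\<tau>. l \<tau> (z \<tau>))"
    by (rule Bochner_Integration.integrable_bound[OF D(1) m]) (use le D(2) in auto)
  then show i2: "integrable \<mu> (\<lambda>\<tau>. Re (l \<tau> (z \<tau>)))" by (rule integrable_Re)
  assume t: "t \<in> {0..T}"
  have n: "(\<lambda>n. L2_norm (g (real n) t)) \<longlonglongrightarrow> L2_norm (z t)" if t: "t \<in> {0..T}" for t
    by (rule LIM_zero_cancel, rule Lim_null_comparison[OF _ low_tendsto_L2[OF zL[OF t]]])
       (use L2_norm_diff_ge[OF low_works(1)[OF zL[OF t]] zL[OF t]] in auto)
  have "(\<lambda>n. (L2_norm (g (real n) t))\<^sup>2 - (L2_norm (g (real n) 0))\<^sup>2) \<longlonglongrightarrow> (L2_norm (z t))\<^sup>2 - (L2_norm (z 0))\<^sup>2"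
    using T t by (intro tendsto_intros n) auto
  moreover have "(\<lambda>n. J T 0 t (\<lambda>\<tau>. 2 * Re (l \<tau> (g (real n) \<tau>)))) \<longlonglongrightarrow> J T 0 t (\<lambda>\<tau>. 2 * Re (l \<tau> (z \<tau>)))"
    unfolding J_def
  proof (rule integral_dominated_convergence)
    show "integrable \<mu> (\<lambda>\<tau>. 2 * D \<tau>)" using D(1) by simp
    show "(\<lambda>\<tau>. indicator {0<..t} \<tau> *\<^sub>R (2 * Re (l \<tau> (z \<tau>)))) \<in> borel_measurable \<mu>"
      using borel_measurable_integrable[OF J_integrable[OF integrable_mult_right[OF i2]]] .
    show "(\<lambda>\<tau>. indicator {0<..t} \<tau> *\<^sub>R (2 * Re (l \<tau> (g (real n) \<tau>)))) \<in> borel_measurable \<mu>" for n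
      using borel_measurable_integrable[OF J_integrable[OF integrable_mult_right[OF integrable_Re[OF l_g_integrable]]]] .
    show "AE \<tau> in \<mu>. (\<lambda>n. indicator {0<..t} \<tau> *\<^sub>R (2 * Re (l \<tau> (g (real n) \<tau>)))) \<longlonglongrightarrow> indicator {0<..t} \<tau> *\<^sub>R (2 * Re (l \<tau> (z \<tau>)))"
      by (intro AE_I2 tendsto_intros l_g_tendsto) simp
    show "AE \<tau> in \<mu>. norm (indicator {0<..t} \<tau> *\<^sub>R (2 * Re (l \<tau> (g (real n) \<tau>)))) \<le> 2 * D \<tau>" for n
    proof (rule AE_I2)
      fix \<tau> assume "\<tau> \<in> space \<mu>"
      then have "\<bar>Re (l \<tau> (g (real n) \<tau>))\<bar> \<le> D \<tau>" using l_g_le order_trans[OF abs_Re_le_cmod] by simp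
      then show "norm (indicator {0<..t} \<tau> *\<^sub>R (2 * Re (l \<tau> (g (real n) \<tau>)))) \<le> 2 * D \<tau>"
        using D(2)[of \<tau>] by (auto simp: indicator_def)
    qed
  qed
  moreover have "(L2_norm (g (real n) t))\<^sup>2 - (L2_norm (g (real n) 0))\<^sup>2 = J T 0 t (\<lambda>\<tau>. 2 * Re (l \<tau> (g (real n) \<tau>)))" for n
    using t by (intro truncated_identity) auto
  ultimately show "(L2_norm (z t))\<^sup>2 - (L2_norm (z 0))\<^sup>2 = J T 0 t (\<lambda>\<tau>. 2 * Re (l \<tau> (z \<tau>)))"
    using LIMSEQ_unique by force
qed

end

subsection \<open>Stability of weak solutions\<close>

lemma finite_measure_interval: "finite_measure (lebesgue_on {0<..<T::real})"
  by (intro finite_measure_lebesgue_on) (cases "0 \<le> T"; auto simp: fmeasurable_def)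

text \<open>On a finite interval f is dominated by 1 + f^2. Measurability is recovered as that of
  the square root of the square.\<close>

lemma integrable_of_integrable_sq:
  fixes f :: "real \<Rightarrow> real"
  assumes f: "integrable (lebesgue_on {0<..<T}) (\<lambda>t. (f t)\<^sup>2)" and nn: "\<And>t. 0 \<le> f t"
  shows "integrable (lebesgue_on {0<..<T}) f"
proof (rule Bochner_Integration.integrable_bound)
  show "integrable (lebesgue_on {0<..<T}) (\<lambda>t. 1 + (f t)\<^sup>2)"
    by (intro Bochner_Integration.integrable_add f finite_measure.integrable_const finite_measure_interval)
  have "(\<lambda>t. sqrt ((f t)\<^sup>2)) \<in> borel_measurable (lebesgue_on {0<..<T})"
    using borel_measurable_integrable[OF f] by measurable
  then show "f \<in> borel_measurable (lebesgue_on {0<..<T})" using nn by simp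
  have "f t \<le> 1 + (f t)\<^sup>2" for t
    using zero_le_power2[of "f t - 1"] nn[of t] by (simp add: power2_diff)
  then show "AE t in lebesgue_on {0<..<T}. norm (f t) \<le> norm (1 + (f t)\<^sup>2)"
    using nn by (intro AE_I2) (simp add: add_nonneg_nonneg)
qed

text \<open>Time carries the completed measure, so here measurability does pass along almost
  everywhere equality.\<close>

lemma borel_measurable_lebesgue_on_AE:
  fixes f g :: "real \<Rightarrow> 'b::euclidean_space"
  assumes f: "f \<in> borel_measurable (lebesgue_on S)" and S: "S \<in> sets lebesgue" and e: "AE x in lebesgue_on S. f x = g x"
  shows "g \<in> borel_measurable (lebesgue_on S)"
proof -
  have "(\<lambda>x. if x \<in> S then f x else 0) \<in> borel_measurable lebesgue"
    by (rule borel_measurable_if_I[OF f S])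
  moreover have "AE x in lebesgue. (if x \<in> S then f x else 0) = (if x \<in> S then g x else 0)"
    using e S by (simp add: AE_restrict_space_iff)
  ultimately have "(\<lambda>x. if x \<in> S then g x else 0) \<in> borel_measurable lebesgue"
    by (rule borel_measurable_AE)
  then show ?thesis by (rule borel_measurable_if_D)
qed

lemma integral_lebesgue_on_cong_AE:
  fixes f g :: "real \<Rightarrow> 'b::euclidean_space"
  assumes f: "f \<in> borel_measurable (lebesgue_on S)" and S: "S \<in> sets lebesgue" and e: "AE x in lebesgue_on S. f x = g x"
  shows "(\<integral>x. f x \<partial>lebesgue_on S) = (\<integral>x. g x \<partial>lebesgue_on S)"
  by (rule integral_cong_AE[OF f borel_measurable_lebesgue_on_AE[OF f S e] e])

lemma bochner_L2_integrable:
  assumes "v \<in> bochner_L2 T H1 H1_norm"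
  shows "integrable (lebesgue_on {0<..<T}) (\<lambda>t. (H1_norm (v t))\<^sup>2)" "integrable (lebesgue_on {0<..<T}) (\<lambda>t. H1_norm (v t))"
proof -
  show "integrable (lebesgue_on {0<..<T}) (\<lambda>t. (H1_norm (v t))\<^sup>2)" using assms by (simp add: bochner_L2_def)
  then show "integrable (lebesgue_on {0<..<T}) (\<lambda>t. H1_norm (v t))" by (rule integrable_of_integrable_sq) simp
qed

text \<open>The definition of a solution allows several exceptional sets of times; one null set
  \<open>N\<close> is extracted that serves all test functions at once. The derivative
  \<open>w\<close> is replaced by the form itself, whose measurability in time follows from the
  approximating simple functions.\<close>

lemma weak_solution_regular_times:
  assumes E: "elliptic s \<alpha> \<beta> \<gamma> M" and sol: "weak_solution T s \<alpha> \<beta> \<gamma> v0 v"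
  obtains N \<sigma> b where "N \<in> null_sets (lebesgue_on {0<..<T})" 
    "\<And>n::nat. simple_function (lebesgue_on {0<..<T}) (\<sigma> n)" "\<And>n t. t \<in> {0<..<T} \<Longrightarrow> \<sigma> n t \<in> H1"
    "\<And>t. t \<in> {0<..<T} - N \<Longrightarrow> v t \<in> H1"
    "\<And>t. t \<in> {0<..<T} - N \<Longrightarrow> (\<lambda>n. H1_norm (\<lambda>x. \<sigma> n t x - v t x)) \<longlonglongrightarrow> 0"
    "\<And>\<phi> t. t \<in> {0<..<T} - N \<Longrightarrow> \<phi> \<in> H1 \<Longrightarrow> b \<phi> t = - form s \<alpha> \<beta> \<gamma> (v t) \<phi>"
    "\<And>\<phi>. \<phi> \<in> H1 \<Longrightarrow> integrable (lebesgue_on {0<..<T}) (b \<phi>)"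
    "\<And>\<phi> x y. \<phi> \<in> H1 \<Longrightarrow> 0 \<le> x \<Longrightarrow> x \<le> y \<Longrightarrow> y \<le> T \<Longrightarrow> ip (v y) \<phi> - ip (v x) \<phi> = J T x y (b \<phi>)"
proof -
  interpret elliptic s \<alpha> \<beta> \<gamma> M by (rule E)
  let ?\<mu> = "lebesgue_on {0<..<T}"
  from sol obtain w where wd: "is_weak_time_derivative T v w" 
    and eq: "AE t in ?\<mu>. \<forall>\<phi>\<in>H1.
           w t \<phi>
           + (\<integral>x. complex_of_real (\<alpha> x) *
                  (\<Sum>i\<in>Basis. weak_partial i (v t) x * cnj (weak_partial i \<phi> x)) \<partial>lborel)
           + (\<integral>x. complex_of_real (\<beta> x) * half_lap s (v t) x * cnj (half_lap s \<phi> x) \<partial>lborel)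
           + (\<integral>x. complex_of_real (\<gamma> x) * v t x * cnj (\<phi> x) \<partial>lborel) = 0"
    unfolding weak_solution_def by blast
  from sol have vB: "v \<in> bochner_L2 T H1 H1_norm" by (simp add: weak_solution_def)
  then have vH: "AE t in ?\<mu>. v t \<in> H1" and "strongly_measurable T H1 H1_norm v" 
    by (auto simp: bochner_L2_def)
  then obtain \<sigma> where \<sigma>: "\<And>n::nat. simple_function ?\<mu> (\<sigma> n)" "\<And>n. \<sigma> n ` {0<..<T} \<subseteq> H1" 
    and lim: "AE t in ?\<mu>. (\<lambda>n. H1_norm (\<lambda>x. \<sigma> n t x - v t x)) \<longlonglongrightarrow> 0"
    unfolding strongly_measurable_def by blast
  have ae: "AE t in ?\<mu>. v t \<in> H1 \<and> (\<lambda>n. H1_norm (\<lambda>x. \<sigma> n t x - v t x)) \<longlonglongrightarrow> 0 \<and> 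
      (\<forall>\<phi>\<in>H1. w t \<phi> = - form s \<alpha> \<beta> \<gamma> (v t) \<phi>)"
    using vH lim eq
  proof eventually_elim
    case (elim t)
    have "w t \<phi> = - form s \<alpha> \<beta> \<gamma> (v t) \<phi>" if "\<phi> \<in> H1" for \<phi>
      using bspec[OF elim(3) that] unfolding form_eq[OF \<alpha> elim(1) that] by (simp only: eq_neg_iff_add_eq_0 add.assoc)
    with elim show ?case by blast
  qed
  then obtain N where N: "N \<in> null_sets ?\<mu>" "{t \<in> space ?\<mu>. \<not> (v t \<in> H1 \<and> (\<lambda>n. H1_norm (\<lambda>x. \<sigma> n t x - v t x)) \<longlonglongrightarrow> 0 \<and> 
      (\<forall>\<phi>\<in>H1. w t \<phi> = - form s \<alpha> \<beta> \<gamma> (v t) \<phi>))} \<subseteq> N"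
    unfolding eventually_ae_filter by blast
  have good: "v t \<in> H1 \<and> (\<lambda>n. H1_norm (\<lambda>x. \<sigma> n t x - v t x)) \<longlonglongrightarrow> 0 \<and> 
      (\<forall>\<phi>\<in>H1. w t \<phi> = - form s \<alpha> \<beta> \<gamma> (v t) \<phi>)" if "t \<in> {0<..<T} - N" for t
    using N(2) that by auto
  \<comment> \<open>The value 0 on \<open>N\<close> is a default making the integrability bound hold
    at every time.\<close>
  define b where "b \<phi> t = (if t \<in> N then 0 else - form s \<alpha> \<beta> \<gamma> (v t) \<phi>)" for \<phi> t
  have \<sigma>H: "\<sigma> n t \<in> H1" if "t \<in> {0<..<T}" for n t using \<sigma>(2) that by blast
  have NS: "N \<inter> space ?\<mu> \<in> sets ?\<mu>" by (rule sets.Int[OF null_setsD2[OF N(1)] sets.top])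
  have form_diff: "cmod (form s \<alpha> \<beta> \<gamma> f \<phi> - form s \<alpha> \<beta> \<gamma> f' \<phi>) \<le> M * (real DIM('a) + 2) * H1_norm (\<lambda>x. f x - f' x) * H1_norm \<phi>"
    if "f \<in> H1" "f' \<in> H1" "\<phi> \<in> H1" for f f' \<phi>
    using form_le[OF H1_diff[OF that(1,2)] that(3)] form_add_cmult_left[OF that, of "-1"] by simp
  \<comment> \<open>The form of a simple function is simple, and boundedness of the form transfers
    convergence in H1 to convergence of its values.\<close>
  have bm: "b \<phi> \<in> borel_measurable ?\<mu>" if \<phi>: "\<phi> \<in> H1" for \<phi>
  proof (rule borel_measurable_LIMSEQ_metric)
    show "(\<lambda>t. if t \<in> N then 0 else - form s \<alpha> \<beta> \<gamma> (\<sigma> n t) \<phi>) \<in> borel_measurable ?\<mu>" for n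
      by (intro measurable_If_set NS borel_measurable_const borel_measurable_simple_function 
         simple_function_compose1[OF \<sigma>(1), of "\<lambda>f. - form s \<alpha> \<beta> \<gamma> f \<phi>"])
    fix t assume "t \<in> space ?\<mu>"
    then have t: "t \<in> {0<..<T}" by simp
    show "(\<lambda>n. if t \<in> N then 0 else - form s \<alpha> \<beta> \<gamma> (\<sigma> n t) \<phi>) \<longlonglongrightarrow> b \<phi> t"
    proof (cases "t \<in> N")
      case False
      with t good have g: "v t \<in> H1" "(\<lambda>n. H1_norm (\<lambda>x. \<sigma> n t x - v t x)) \<longlonglongrightarrow> 0" by auto
      have "(\<lambda>n. M * (real DIM('a) + 2) * H1_norm (\<lambda>x. \<sigma> n t x - v t x) * H1_norm \<phi>) \<longlonglongrightarrow> M * (real DIM('a) + 2) * 0 * H1_norm \<phi>"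
        by (intro tendsto_intros g)
      then have 0: "(\<lambda>n. M * (real DIM('a) + 2) * H1_norm (\<lambda>x. \<sigma> n t x - v t x) * H1_norm \<phi>) \<longlonglongrightarrow> 0" by simp
      have "(\<lambda>n. form s \<alpha> \<beta> \<gamma> (\<sigma> n t) \<phi>) \<longlonglongrightarrow> form s \<alpha> \<beta> \<gamma> (v t) \<phi>"
        by (rule LIM_zero_cancel, rule Lim_null_comparison[OF _ 0])
           (use form_diff[OF \<sigma>H[OF t] g(1) \<phi>] in auto)
      then show ?thesis using False by (simp add: b_def tendsto_minus)
    qed (simp add: b_def)
  qed
  have vc: "v \<in> C_L2 T" using sol by (simp add: weak_solution_def)
  have bi: "integrable ?\<mu> (b \<phi>)" if \<phi>: "\<phi> \<in> H1" for \<phi>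
  proof (rule Bochner_Integration.integrable_bound[OF _ bm[OF \<phi>]])
    show "integrable ?\<mu> (\<lambda>t. M * (real DIM('a) + 2) * H1_norm (v t) * H1_norm \<phi>)"
      using bochner_L2_integrable(2)[OF vB] by simp
    show "AE t in ?\<mu>. norm (b \<phi> t) \<le> norm (M * (real DIM('a) + 2) * H1_norm (v t) * H1_norm \<phi>)"
    proof (rule AE_I2)
      fix t assume "t \<in> space ?\<mu>"
      then have "cmod (b \<phi> t) \<le> M * (real DIM('a) + 2) * H1_norm (v t) * H1_norm \<phi>"
        using good[of t] form_le[of "v t" \<phi>] \<phi> coeff_le_nonneg[OF \<alpha>] by (simp add: b_def)
      then show "norm (b \<phi> t) \<le> norm (M * (real DIM('a) + 2) * H1_norm (v t) * H1_norm \<phi>)" by simp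
    qed
  qed
  show ?thesis
  proof (rule that[where N=N and \<sigma>=\<sigma> and b=b, OF N(1) \<sigma>(1) \<sigma>H])
    fix \<phi> :: "'a \<Rightarrow> complex" and x y assume \<phi>: "\<phi> \<in> H1" and xy: "0 \<le> x" "x \<le> y" "y \<le> T"
    show "ip (v y) \<phi> - ip (v x) \<phi> = J T x y (b \<phi>)"
    proof (rule weak_derivative_imp_AC[OF _ bi[OF \<phi>] _ xy])
      show "continuous_on {0..T} (\<lambda>t. ip (v t) \<phi>)"
        unfolding continuous_on_def
      proof
        fix t assume t: "t \<in> {0..T}"
        have 0: "((\<lambda>r. L2_norm (\<lambda>x. v r x - v t x) * L2_norm \<phi>) \<longlongrightarrow> 0) (at t within {0..T})"
          using vc t tendsto_mult_right[of "\<lambda>r. L2_norm (\<lambda>x. v r x - v t x)" 0 _ "L2_norm \<phi>"] by (simp add: C_L2_def)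
        have L: "r \<in> {0..T} \<Longrightarrow> v r \<in> L2" for r using vc by (simp add: C_L2_def)
        have "\<forall>\<^sub>F r in at t within {0..T}. norm (ip (v r) \<phi> - ip (v t) \<phi>) \<le> L2_norm (\<lambda>x. v r x - v t x) * L2_norm \<phi>"
          unfolding eventually_at_filter
          by (intro always_eventually allI impI) 
             (use ip_le[OF L2_diff[OF L L[OF t]] H1_D(1)[OF \<phi>]] L t H1_D(1)[OF \<phi>] in \<open>simp add: ip_diff_left\<close>)
        then show "((\<lambda>t. ip (v t) \<phi>) \<longlongrightarrow> ip (v t) \<phi>) (at t within {0..T})"
          by (rule LIM_zero_cancel[OF Lim_null_comparison[OF _ 0]])
      qed
      fix \<eta> :: "real \<Rightarrow> real" assume \<eta>: "\<eta> \<in> test_functions {0<..<T}"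
      have "continuous_on UNIV \<eta>" using \<eta> Ck.simps(1)[of \<eta>] unfolding test_functions_def by blast
      then have [measurable]: "\<eta> \<in> borel_measurable borel" by (rule borel_measurable_continuous_onI)
      \<comment> \<open>Off \<open>N\<close> the equation identifies \<open>b \<phi>\<close> with
        \<open>w\<close>, so the weak derivative may be written with the measurable
        representative.\<close>
      have "(\<integral>t. of_real (\<eta> t) * b \<phi> t \<partial>?\<mu>) = (\<integral>t. of_real (\<eta> t) * w t \<phi> \<partial>?\<mu>)"
      proof (rule integral_lebesgue_on_cong_AE)
        have "(\<lambda>t. complex_of_real (\<eta> t)) \<in> borel_measurable ?\<mu>" by (intro borel_measurable_lebesgue_onI) measurable
        then show "(\<lambda>t. of_real (\<eta> t) * b \<phi> t) \<in> borel_measurable ?\<mu>" by (intro borel_measurable_times bm \<phi>)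
        show "AE t in ?\<mu>. of_real (\<eta> t) * b \<phi> t = of_real (\<eta> t) * w t \<phi>"
          using AE_not_in[OF N(1)] AE_space by eventually_elim (use good \<phi> in \<open>simp add: b_def\<close>)
      qed simp
      then show "(\<integral>t. of_real (vector_derivative \<eta> (at t)) * ip (v t) \<phi> \<partial>?\<mu>) = - (\<integral>t. of_real (\<eta> t) * b \<phi> t \<partial>?\<mu>)"
        using wd \<eta> \<phi> unfolding is_weak_time_derivative_def ip_def by simp
    qed
  qed (use good bi in \<open>simp_all add: b_def\<close>)
qed

text \<open>Primed data belong to the perturbed problem. The third instance treats the coefficient
  differences as coefficients with bound \<delta>, so the perturbation is estimated by the same
  lemma as the forms.\<close>

locale two_solutions =
  A: elliptic s \<alpha> \<beta> \<gamma> M + A': elliptic s \<alpha>' \<beta>' \<gamma>' M' +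
  D: elliptic s "\<lambda>x. \<alpha>' x - \<alpha> x" "\<lambda>x. \<beta>' x - \<beta> x" "\<lambda>x. \<gamma>' x - \<gamma> x" \<delta>
  for s and \<alpha> \<beta> \<gamma> \<alpha>' \<beta>' \<gamma>' :: "'a::euclidean_space \<Rightarrow> real" and M M' \<delta> :: real +
  fixes T k :: real and v0 v0' :: "'a \<Rightarrow> complex" and v v' :: "real \<Rightarrow> 'a \<Rightarrow> complex"
  assumes T: "0 < T" and k: "0 < k"
    and sol: "weak_solution T s \<alpha> \<beta> \<gamma> v0 v" and sol': "weak_solution T s \<alpha>' \<beta>' \<gamma>' v0' v'"
    and v0L: "v0 \<in> L2" "v0' \<in> L2"
    and lb: "AE x in lborel. \<alpha>' x \<ge> k" "AE x in lborel. \<beta>' x \<ge> 0" "AE x in lborel. \<gamma>' x \<ge> k"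
begin

abbreviation "\<mu> \<equiv> lebesgue_on {0<..<T}"

definition bound :: real where
  "bound = (L2_norm (\<lambda>x. v0' x - v0 x))\<^sup>2 + (\<delta> * (real DIM('a) + 2))\<^sup>2 / k * (\<integral>t. (H1_norm (v t))\<^sup>2 \<partial>\<mu>)"

lemma energy_inequality:
  assumes f: "f \<in> H1" and f': "f' \<in> H1"
  defines "z \<equiv> \<lambda>x. f' x - f x"
  shows "2 * Re (A.B f z - A'.B f' z) \<le> - k * (H1_norm z)\<^sup>2 + (\<delta> * (real DIM('a) + 2))\<^sup>2 / k * (H1_norm f)\<^sup>2"
proof -
  define d where "d = \<delta> * (real DIM('a) + 2)"
  have z: "z \<in> H1" unfolding z_def by (rule H1_diff[OF f' f])
  have "A'.B z z = A'.B f' z - A'.B f z"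
    using A'.form_add_cmult_left[OF f' f z, of "-1"] by (simp add: z_def)
  moreover have "A'.B f z - A.B f z = D.B f z"
    by (rule form_coeff_diff[OF A'.elliptic_axioms A.elliptic_axioms f z])
  ultimately have "A.B f z - A'.B f' z = - A'.B z z - D.B f z" by (simp add: algebra_simps)
  moreover have "k * (H1_norm z)\<^sup>2 \<le> Re (A'.B z z)" by (rule A'.form_coercive[OF z lb])
  moreover have "- Re (D.B f z) \<le> d * H1_norm f * H1_norm z"
    using D.form_le[OF f z] abs_Re_le_cmod[of "D.B f z"] by (simp add: d_def)
  ultimately have "2 * Re (A.B f z - A'.B f' z) \<le> - 2 * (k * (H1_norm z)\<^sup>2) + 2 * (d * H1_norm f * H1_norm z)"
    by simp
  \<comment> \<open>Young's inequality weighted by \<open>k\<close>: it consumes exactly one of the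
    two copies of \<open>k * (H1_norm z)\<^sup>2\<close> provided by coercivity.\<close>
  also have "2 * (d * H1_norm f * H1_norm z) \<le> k * (H1_norm z)\<^sup>2 + d\<^sup>2 / k * (H1_norm f)\<^sup>2"
  proof -
    have "0 \<le> (k * H1_norm z - d * H1_norm f)\<^sup>2 / k" using k by simp
    also have "\<dots> = k * (H1_norm z)\<^sup>2 + d\<^sup>2 / k * (H1_norm f)\<^sup>2 - 2 * (d * H1_norm f * H1_norm z)"
      using k by (simp add: power2_eq_square field_simps)
    finally show ?thesis by simp
  qed
  finally show ?thesis by (simp add: d_def)
qed

lemma stability:
  shows "t \<in> {0..T} \<Longrightarrow> (L2_norm (\<lambda>x. v' t x - v t x))\<^sup>2 \<le> bound"
    and "k * (bochner_L2_norm T H1_norm (\<lambda>t x. v' t x - v t x))\<^sup>2 \<le> bound"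
proof -
  obtain N \<sigma> b where N: "N \<in> null_sets \<mu>" 
    and \<sigma>: "\<And>n::nat. simple_function \<mu> (\<sigma> n)" "\<And>n t. t \<in> {0<..<T} \<Longrightarrow> \<sigma> n t \<in> H1"
    and vH: "\<And>t. t \<in> {0<..<T} - N \<Longrightarrow> v t \<in> H1"
    and lim: "\<And>t. t \<in> {0<..<T} - N \<Longrightarrow> (\<lambda>n. H1_norm (\<lambda>x. \<sigma> n t x - v t x)) \<longlonglongrightarrow> 0"
    and b: "\<And>\<phi> t. t \<in> {0<..<T} - N \<Longrightarrow> \<phi> \<in> H1 \<Longrightarrow> b \<phi> t = - A.B (v t) \<phi>"
    and bi: "\<And>\<phi>. \<phi> \<in> H1 \<Longrightarrow> integrable \<mu> (b \<phi>)"
    and ac: "\<And>\<phi> x y. \<phi> \<in> H1 \<Longrightarrow> 0 \<le> x \<Longrightarrow> x \<le> y \<Longrightarrow> y \<le> T \<Longrightarrow> ip (v y) \<phi> - ip (v x) \<phi> = J T x y (b \<phi>)"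
    by (rule weak_solution_regular_times[OF A.elliptic_axioms sol]) blast
  obtain N' \<sigma>' b' where N': "N' \<in> null_sets \<mu>" 
    and \<sigma>': "\<And>n::nat. simple_function \<mu> (\<sigma>' n)" "\<And>n t. t \<in> {0<..<T} \<Longrightarrow> \<sigma>' n t \<in> H1"
    and vH': "\<And>t. t \<in> {0<..<T} - N' \<Longrightarrow> v' t \<in> H1"
    and lim': "\<And>t. t \<in> {0<..<T} - N' \<Longrightarrow> (\<lambda>n. H1_norm (\<lambda>x. \<sigma>' n t x - v' t x)) \<longlonglongrightarrow> 0"
    and b': "\<And>\<phi> t. t \<in> {0<..<T} - N' \<Longrightarrow> \<phi> \<in> H1 \<Longrightarrow> b' \<phi> t = - A'.B (v' t) \<phi>"
    and bi': "\<And>\<phi>. \<phi> \<in> H1 \<Longrightarrow> integrable \<mu> (b' \<phi>)"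
    and ac': "\<And>\<phi> x y. \<phi> \<in> H1 \<Longrightarrow> 0 \<le> x \<Longrightarrow> x \<le> y \<Longrightarrow> y \<le> T \<Longrightarrow> ip (v' y) \<phi> - ip (v' x) \<phi> = J T x y (b' \<phi>)"
    by (rule weak_solution_regular_times[OF A'.elliptic_axioms sol']) blast
  define E where "E = N \<union> N'"
  have E: "E \<in> null_sets \<mu>" unfolding E_def using N N' by (rule null_sets.Un)
  have ES: "E \<inter> space \<mu> \<in> sets \<mu>" by (rule sets.Int[OF null_setsD2[OF E] sets.top])
  have good: "t \<in> {0<..<T} - N" "t \<in> {0<..<T} - N'" if "t \<in> {0<..<T}" "t \<notin> E" for t
    using that by (auto simp: E_def)
  define z where "z t x = v' t x - v t x" for t x
  have zeq: "z t = (\<lambda>x. v' t x - v t x)" for t by (simp add: z_def[abs_def])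
  have zH: "z t \<in> H1" if "t \<in> {0<..<T}" "t \<notin> E" for t
    unfolding zeq by (intro H1_diff vH vH' good that)
  \<comment> \<open>The functional that drives the difference \<open>z\<close>. Setting it to 0 on
    \<open>E\<close> lets the energy argument hold at every time, with no condition on
    \<open>z\<close> at exceptional ones.\<close>
  define l where "l t \<phi> = (if t \<in> E then 0 else A.B (v t) \<phi> - A'.B (v' t) \<phi>)" for t \<phi>
  define C where "C = (M + M') * (real DIM('a) + 2)"
  have M: "0 \<le> M" "0 \<le> M'" using coeff_le_nonneg A.\<alpha> A'.\<alpha> by blast+
  have C: "0 \<le> C" using M by (simp add: C_def)
  \<comment> \<open>\<open>K\<close> bounds the dual norm of \<open>l\<close>; \<open>D\<close>
    below bounds \<open>K\<close> times the H1 norm of \<open>z\<close>, through the inequality (x +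
    y)^2 \<le> 2 x^2 + 2 y^2.\<close>
  define K where "K t = C * (H1_norm (v' t) + H1_norm (v t))" for t
  define D where "D t = C * (2 * (H1_norm (v' t))\<^sup>2 + 2 * (H1_norm (v t))\<^sup>2)" for t
  have vB: "v \<in> bochner_L2 T H1 H1_norm" "v' \<in> bochner_L2 T H1 H1_norm"
    and vC: "v \<in> C_L2 T" "v' \<in> C_L2 T"
    using sol sol' by (auto simp: weak_solution_def)
  have vL: "t \<in> {0..T} \<Longrightarrow> v t \<in> L2" "t \<in> {0..T} \<Longrightarrow> v' t \<in> L2" for t using vC by (auto simp: C_L2_def)
  have zL: "t \<in> {0..T} \<Longrightarrow> z t \<in> L2" for t unfolding zeq by (intro L2_diff vL)
  have lm: "(\<lambda>t. l t \<phi>) \<in> borel_measurable \<mu>" and lb': "AE t in \<mu>. l t \<phi> = b' \<phi> t - b \<phi> t" if \<phi>: "\<phi> \<in> H1" for \<phi>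
  proof -
    show ae: "AE t in \<mu>. l t \<phi> = b' \<phi> t - b \<phi> t"
      using AE_not_in[OF E] AE_space 
      by eventually_elim (use good b b' \<phi> in \<open>simp add: l_def\<close>)
    show "(\<lambda>t. l t \<phi>) \<in> borel_measurable \<mu>"
    proof (rule borel_measurable_lebesgue_on_AE)
      show "(\<lambda>t. b' \<phi> t - b \<phi> t) \<in> borel_measurable \<mu>"
        using bi[OF \<phi>] bi'[OF \<phi>] by (intro borel_measurable_diff borel_measurable_integrable)
      show "AE t in \<mu>. b' \<phi> t - b \<phi> t = l t \<phi>" using ae by eventually_elim simp
    qed simp
  qed
  have "energy T z l K D"
  proof
    show "0 < T" by (rule T)
    show "z t \<in> L2" if "t \<in> {0..T}" for t by (rule zL[OF that])
    show "((\<lambda>\<tau>. L2_norm (\<lambda>x. z \<tau> x - z t x)) \<longlongrightarrow> 0) (at t within {0..T})" if t: "t \<in> {0..T}" for t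
    proof (rule Lim_null_comparison)
      show "((\<lambda>\<tau>. L2_norm (\<lambda>x. v' \<tau> x - v' t x) + L2_norm (\<lambda>x. v \<tau> x - v t x)) \<longlongrightarrow> 0) (at t within {0..T})"
        using vC t by (auto simp: C_L2_def intro!: tendsto_add_zero)
      have "L2_norm (\<lambda>x. z \<tau> x - z t x) \<le> L2_norm (\<lambda>x. v' \<tau> x - v' t x) + L2_norm (\<lambda>x. v \<tau> x - v t x)" if "\<tau> \<in> {0..T}" for \<tau>
      proof -
        have "(\<lambda>x. z \<tau> x - z t x) = (\<lambda>x. (v' \<tau> x - v' t x) - (v \<tau> x - v t x))" by (auto simp: z_def)
        then show ?thesis using L2_norm_triangle_diff[OF L2_diff[OF vL(2)[OF that] vL(2)[OF t]] L2_diff[OF vL(1)[OF that] vL(1)[OF t]]]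
          by simp
      qed
      then show "\<forall>\<^sub>F \<tau> in at t within {0..T}. norm (L2_norm (\<lambda>x. z \<tau> x - z t x)) \<le> L2_norm (\<lambda>x. v' \<tau> x - v' t x) + L2_norm (\<lambda>x. v \<tau> x - v t x)"
        unfolding eventually_at_filter by (intro always_eventually allI impI) simp
    qed
    show "(\<lambda>\<tau>. l \<tau> \<phi>) \<in> borel_measurable \<mu>" if "\<phi> \<in> H1" for \<phi> by (rule lm[OF that])
    show "l \<tau> (\<lambda>x. \<phi> x + c * \<psi> x) = l \<tau> \<phi> + cnj c * l \<tau> \<psi>" if "\<tau> \<in> {0<..<T}" "\<phi> \<in> H1" "\<psi> \<in> H1" for \<tau> \<phi> \<psi> c
    proof (cases "\<tau> \<in> E")
      case False
      then show ?thesis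
        using A.form_add_cmult_right[OF vH[OF good(1)[OF that(1) False]] that(2,3), of c]
          A'.form_add_cmult_right[OF vH'[OF good(2)[OF that(1) False]] that(2,3), of c]
        by (simp add: l_def algebra_simps)
    qed (simp add: l_def)
    show "cmod (l \<tau> \<phi>) \<le> K \<tau> * H1_norm \<phi>" if "\<tau> \<in> {0<..<T}" "\<phi> \<in> H1" for \<tau> \<phi>
    proof (cases "\<tau> \<in> E")
      case False
      let ?d = "real DIM('a) + 2"
      have 1: "cmod (A.B (v \<tau>) \<phi>) \<le> M * ?d * H1_norm (v \<tau>) * H1_norm \<phi>"
        by (rule A.form_le[OF vH[OF good(1)[OF that(1) False]] that(2)])
      have 2: "cmod (A'.B (v' \<tau>) \<phi>) \<le> M' * ?d * H1_norm (v' \<tau>) * H1_norm \<phi>"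
        by (rule A'.form_le[OF vH'[OF good(2)[OF that(1) False]] that(2)])
      have 3: "M * ?d * H1_norm (v \<tau>) * H1_norm \<phi> \<le> C * H1_norm (v \<tau>) * H1_norm \<phi>"
        "M' * ?d * H1_norm (v' \<tau>) * H1_norm \<phi> \<le> C * H1_norm (v' \<tau>) * H1_norm \<phi>"
        using M by (auto simp: C_def intro!: mult_right_mono)
      have "cmod (l \<tau> \<phi>) \<le> cmod (A.B (v \<tau>) \<phi>) + cmod (A'.B (v' \<tau>) \<phi>)"
        using False by (simp add: l_def norm_triangle_ineq4)
      then show ?thesis using 1 2 3 by (simp add: K_def algebra_simps)
    qed (use C in \<open>simp add: l_def K_def\<close>)
    show "integrable \<mu> K" unfolding K_def using vB
      by (intro integrable_mult_right Bochner_Integration.integrable_add bochner_L2_integrable)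
    show "0 \<le> K \<tau>" for \<tau> using C by (simp add: K_def)
    show "(z \<tau> \<in> H1 \<and> K \<tau> * H1_norm (z \<tau>) \<le> D \<tau>) \<or> l \<tau> = (\<lambda>\<phi>. 0)" if \<tau>: "\<tau> \<in> {0<..<T}" for \<tau>
    proof (cases "\<tau> \<in> E")
      case False
      let ?n = "H1_norm (v' \<tau>) + H1_norm (v \<tau>)"
      have "H1_norm (z \<tau>) \<le> ?n" 
        unfolding zeq by (intro H1_norm_triangle_diff vH vH' good \<tau> False)
      then have "K \<tau> * H1_norm (z \<tau>) \<le> C * ?n * ?n"
        unfolding K_def using C by (intro mult_left_mono) auto
      also have "\<dots> = C * ?n\<^sup>2" by (simp add: power2_eq_square)
      also have "\<dots> \<le> D \<tau>" unfolding D_def by (intro mult_left_mono sq_add_le C)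
      finally show ?thesis using zH[OF \<tau> False] by simp
    qed (simp add: l_def fun_eq_iff)
    show "integrable \<mu> D" unfolding D_def using vB
      by (intro integrable_mult_right Bochner_Integration.integrable_add bochner_L2_integrable)
    show "0 \<le> D \<tau>" for \<tau> using C by (simp add: D_def)
    show "ip (z y) \<phi> - ip (z x) \<phi> = J T x y (\<lambda>\<tau>. l \<tau> \<phi>)" if \<phi>: "\<phi> \<in> H1" and xy: "0 \<le> x" "x \<le> y" "y \<le> T" for \<phi> x y
    proof -
      have "ip (z y) \<phi> - ip (z x) \<phi> = (ip (v' y) \<phi> - ip (v' x) \<phi>) - (ip (v y) \<phi> - ip (v x) \<phi>)"
        unfolding zeq using xy H1_D(1)[OF \<phi>] by (simp add: ip_diff_left vL)
      also have "\<dots> = J T x y (\<lambda>t. b' \<phi> t - b \<phi> t)"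
        by (simp add: ac[OF \<phi> xy] ac'[OF \<phi> xy] J_diff bi bi' \<phi>)
      also have "\<dots> = J T x y (\<lambda>\<tau>. l \<tau> \<phi>)"
        unfolding J_def
      proof (rule integral_lebesgue_on_cong_AE)
        show "(\<lambda>t. indicator {x<..y} t *\<^sub>R (b' \<phi> t - b \<phi> t)) \<in> borel_measurable \<mu>"
          by (intro borel_measurable_integrable J_integrable Bochner_Integration.integrable_diff bi bi' \<phi>)
        show "AE t in \<mu>. indicator {x<..y} t *\<^sub>R (b' \<phi> t - b \<phi> t) = indicator {x<..y} t *\<^sub>R l t \<phi>"
          using lb'[OF \<phi>] by eventually_elim simp
      qed simp
      finally show ?thesis .
    qed
  qed
  then interpret en: energy T z l K D .
  \<comment> \<open>The norm of \<open>z\<close>, altered on \<open>E\<close> so that it is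
    everywhere a limit of simple functions and thus measurable.\<close>
  define m where "m t = (if t \<in> E then 0 else H1_norm (z t))" for t
  have mm: "m \<in> borel_measurable \<mu>"
  proof (rule borel_measurable_LIMSEQ_metric)
    show "(\<lambda>t. if t \<in> E then 0 else H1_norm (\<lambda>x. \<sigma>' n t x - \<sigma> n t x)) \<in> borel_measurable \<mu>" for n
      by (intro measurable_If_set ES borel_measurable_const borel_measurable_simple_function 
         simple_function_compose2[OF \<sigma>'(1) \<sigma>(1), of "\<lambda>f f'. H1_norm (\<lambda>x. f x - f' x)"])
    fix t assume "t \<in> space \<mu>"
    then have t: "t \<in> {0<..<T}" by simp
    show "(\<lambda>n. if t \<in> E then 0 else H1_norm (\<lambda>x. \<sigma>' n t x - \<sigma> n t x)) \<longlonglongrightarrow> m t"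
    proof (cases "t \<in> E")
      case False
      note g = good[OF t False]
      note H = \<sigma>'(2)[OF t] \<sigma>(2)[OF t] vH[OF g(1)] vH'[OF g(2)]
      have 0: "(\<lambda>n. H1_norm (\<lambda>x. \<sigma>' n t x - v' t x) + H1_norm (\<lambda>x. \<sigma> n t x - v t x)) \<longlonglongrightarrow> 0"
        by (intro tendsto_add_zero lim lim' g)
      have "norm (H1_norm (\<lambda>x. \<sigma>' n t x - \<sigma> n t x) - H1_norm (z t)) \<le> 
         H1_norm (\<lambda>x. \<sigma>' n t x - v' t x) + H1_norm (\<lambda>x. \<sigma> n t x - v t x)" for n
      proof -
        have "norm (H1_norm (\<lambda>x. \<sigma>' n t x - \<sigma> n t x) - H1_norm (z t)) \<le> H1_norm (\<lambda>x. (\<sigma>' n t x - \<sigma> n t x) - z t x)"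
          unfolding real_norm_def by (intro H1_norm_diff_ge H1_diff H zH t False)
        also have "(\<lambda>x. (\<sigma>' n t x - \<sigma> n t x) - z t x) = (\<lambda>x. (\<sigma>' n t x - v' t x) - (\<sigma> n t x - v t x))"
          by (auto simp: z_def)
        also have "H1_norm \<dots> \<le> H1_norm (\<lambda>x. \<sigma>' n t x - v' t x) + H1_norm (\<lambda>x. \<sigma> n t x - v t x)"
          by (intro H1_norm_triangle_diff H1_diff H)
        finally show ?thesis .
      qed
      then have "(\<lambda>n. H1_norm (\<lambda>x. \<sigma>' n t x - \<sigma> n t x)) \<longlonglongrightarrow> H1_norm (z t)"
        by (intro LIM_zero_cancel[OF Lim_null_comparison[OF _ 0]]) simp
      then show ?thesis using False by (simp add: m_def)
    qed (simp add: m_def)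
  qed
  have mi: "integrable \<mu> (\<lambda>t. (m t)\<^sup>2)"
  proof (rule Bochner_Integration.integrable_bound)
    show "integrable \<mu> (\<lambda>t. 2 * (H1_norm (v' t))\<^sup>2 + 2 * (H1_norm (v t))\<^sup>2)"
      using vB by (intro integrable_mult_right Bochner_Integration.integrable_add bochner_L2_integrable)
    show "(\<lambda>t. (m t)\<^sup>2) \<in> borel_measurable \<mu>" using mm by measurable
    show "AE t in \<mu>. norm ((m t)\<^sup>2) \<le> norm (2 * (H1_norm (v' t))\<^sup>2 + 2 * (H1_norm (v t))\<^sup>2)"
    proof (rule AE_I2)
      fix t assume "t \<in> space \<mu>"
      then have t: "t \<in> {0<..<T}" by simp
      have "(m t)\<^sup>2 \<le> (H1_norm (v' t) + H1_norm (v t))\<^sup>2"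
      proof (cases "t \<in> E")
        case False
        have "H1_norm (z t) \<le> H1_norm (v' t) + H1_norm (v t)" 
          unfolding zeq by (intro H1_norm_triangle_diff vH vH' good t False)
        then show ?thesis using False by (simp add: m_def power_mono)
      qed (simp add: m_def)
      then show "norm ((m t)\<^sup>2) \<le> norm (2 * (H1_norm (v' t))\<^sup>2 + 2 * (H1_norm (v t))\<^sup>2)"
        using sq_add_le[of "H1_norm (v' t)" "H1_norm (v t)"] by simp
    qed
  qed
  define c where "c = (\<delta> * (real DIM('a) + 2))\<^sup>2 / k"
  have c: "0 \<le> c" using k by (simp add: c_def)
  have vi: "integrable \<mu> (\<lambda>t. (H1_norm (v t))\<^sup>2)" by (rule bochner_L2_integrable(1)[OF vB(1)])
  define V where "V = (\<integral>t. (H1_norm (v t))\<^sup>2 \<partial>\<mu>)"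
  have z0: "L2_norm (z 0) = L2_norm (\<lambda>x. v0' x - v0 x)"
  proof (rule L2_norm_cong_AE)
    have "AE x in lborel. v 0 x = v0 x" "AE x in lborel. v' 0 x = v0' x" using sol sol' by (auto simp: weak_solution_def)
    then show "AE x in lborel. z 0 x = v0' x - v0 x" by eventually_elim (simp add: z_def)
  qed (use T zL L2_diff v0L in auto)
  have main: "(L2_norm (z t))\<^sup>2 + k * J T 0 t (\<lambda>\<tau>. (m \<tau>)\<^sup>2) \<le> bound" if t: "t \<in> {0..T}" for t
  proof -
    have "(L2_norm (z t))\<^sup>2 - (L2_norm (z 0))\<^sup>2 = J T 0 t (\<lambda>\<tau>. 2 * Re (l \<tau> (z \<tau>)))"
      by (rule en.energy_identity(2)[OF t])
    also have "\<dots> \<le> J T 0 t (\<lambda>\<tau>. c * (H1_norm (v \<tau>))\<^sup>2 - k * (m \<tau>)\<^sup>2)"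
    proof (rule J_mono)
      show "integrable \<mu> (\<lambda>\<tau>. 2 * Re (l \<tau> (z \<tau>)))" by (intro integrable_mult_right en.energy_identity(1))
      show "integrable \<mu> (\<lambda>\<tau>. c * (H1_norm (v \<tau>))\<^sup>2 - k * (m \<tau>)\<^sup>2)"
        using vi mi by (intro Bochner_Integration.integrable_diff integrable_mult_right)
      fix \<tau> assume \<tau>: "\<tau> \<in> {0<..<T}"
      show "2 * Re (l \<tau> (z \<tau>)) \<le> c * (H1_norm (v \<tau>))\<^sup>2 - k * (m \<tau>)\<^sup>2"
      proof (cases "\<tau> \<in> E")
        case False
        show ?thesis using energy_inequality[OF vH[OF good(1)[OF \<tau> False]] vH'[OF good(2)[OF \<tau> False]]] False
          by (simp add: l_def m_def c_def zeq)
      qed (use c in \<open>simp add: l_def m_def\<close>)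
    qed
    also have "\<dots> = c * J T 0 t (\<lambda>\<tau>. (H1_norm (v \<tau>))\<^sup>2) - k * J T 0 t (\<lambda>\<tau>. (m \<tau>)\<^sup>2)"
      using vi mi by (simp add: J_diff J_cmult)
    finally have fin: "(L2_norm (z t))\<^sup>2 - (L2_norm (z 0))\<^sup>2 \<le> 
       c * J T 0 t (\<lambda>\<tau>. (H1_norm (v \<tau>))\<^sup>2) - k * J T 0 t (\<lambda>\<tau>. (m \<tau>)\<^sup>2)" .
    \<comment> \<open>Extending this integral to all of (0,T) makes the bound independent of
      \<open>t\<close>, as a supremum over time requires.\<close>
    have "J T 0 t (\<lambda>\<tau>. (H1_norm (v \<tau>))\<^sup>2) \<le> V"
      unfolding J_def V_def by (intro integral_mono J_integrable vi) (auto simp: indicator_def)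
    from mult_left_mono[OF this c] fin show ?thesis 
      unfolding bound_def c_def[symmetric] V_def[symmetric] z0 by linarith
  qed
  have Jm: "0 \<le> J T 0 t (\<lambda>\<tau>. (m \<tau>)\<^sup>2)" for t
    unfolding J_def by (intro Bochner_Integration.integral_nonneg) simp
  show "(L2_norm (\<lambda>x. v' t x - v t x))\<^sup>2 \<le> bound" if "t \<in> {0..T}" for t
    using main[OF that] mult_nonneg_nonneg[OF less_imp_le[OF k] Jm[of t]] unfolding zeq by linarith
  have "(\<integral>t. (m t)\<^sup>2 \<partial>\<mu>) = (\<integral>t. (H1_norm (z t))\<^sup>2 \<partial>\<mu>)"
  proof (rule integral_lebesgue_on_cong_AE)
    show "AE t in \<mu>. (m t)\<^sup>2 = (H1_norm (z t))\<^sup>2"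
      using AE_not_in[OF E] by eventually_elim (simp add: m_def)
    show "(\<lambda>t. (m t)\<^sup>2) \<in> borel_measurable \<mu>" using mm by measurable
  qed simp
  then have "(bochner_L2_norm T H1_norm (\<lambda>t x. v' t x - v t x))\<^sup>2 = (\<integral>t. (m t)\<^sup>2 \<partial>\<mu>)"
    unfolding bochner_L2_norm_def zeq[symmetric] by simp
  also have "\<dots> = J T 0 T (\<lambda>\<tau>. (m \<tau>)\<^sup>2)"
    unfolding J_def by (rule Bochner_Integration.integral_cong) auto
  finally have eq: "(bochner_L2_norm T H1_norm (\<lambda>t x. v' t x - v t x))\<^sup>2 = J T 0 T (\<lambda>\<tau>. (m \<tau>)\<^sup>2)" .
  have "T \<in> {0..T}" using T by simp
  from main[OF this] show "k * (bochner_L2_norm T H1_norm (\<lambda>t x. v' t x - v t x))\<^sup>2 \<le> bound"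
    using zero_le_power2[of "L2_norm (z T)"] unfolding eq by linarith
qed

end

section \<open>Convergence of the regularised solutions\<close>

lemma Linf_diff_real:
  assumes "f \<in> Linf" "g \<in> Linf" "Linf_norm (\<lambda>x. f x - g x) < \<infinity>"
  shows "coeff_le (\<lambda>x. f x - g x) (max 0 (real_of_ereal (Linf_norm (\<lambda>x. f x - g x))))"
proof (rule Linf_norm_le_coeff_le)
  show "(\<lambda>x. f x - g x) \<in> borel_measurable borel"
    using assms(1,2) by (auto simp: Linf_def)
  \<comment> \<open>\<open>real_of_ereal\<close> sends infinity to 0, so the bound would fail there;
    this is the case that the finiteness assumption rules out.\<close>
  show "Linf_norm (\<lambda>x. f x - g x) \<le> ereal (max 0 (real_of_ereal (Linf_norm (\<lambda>x. f x - g x))))"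
    using assms(3) by (cases "Linf_norm (\<lambda>x. f x - g x)") auto
qed

theorem theorem4p3:
  fixes T s a0 b0 c0 :: real
    and a b c :: "'a::euclidean_space \<Rightarrow> real"
    and u0 :: "'a \<Rightarrow> complex"
    and u :: "real \<Rightarrow> 'a \<Rightarrow> complex"
    and a_reg b_reg c_reg :: "real \<Rightarrow> 'a \<Rightarrow> real"
    and u0_reg :: "real \<Rightarrow> 'a \<Rightarrow> complex"
    and u_reg :: "real \<Rightarrow> real \<Rightarrow> 'a \<Rightarrow> complex"
  assumes "T > 0" and "0 < s" and "s < 1"
    and "a \<in> Linf" and "b \<in> Linf" and "c \<in> Linf"
    and "a0 > 0" and "b0 > 0" and "c0 > 0"
    and "AE x in lborel. a x \<ge> a0" and "AE x in lborel. b x \<ge> b0" and "AE x in lborel. c x \<ge> c0"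
    and "u0 \<in> H1"
    and "weak_solution T s a b c u0 u"
    and "\<And>\<epsilon>. \<epsilon> \<in> {0<..1} \<Longrightarrow> a_reg \<epsilon> \<in> Linf"
    and "\<And>\<epsilon>. \<epsilon> \<in> {0<..1} \<Longrightarrow> b_reg \<epsilon> \<in> Linf"
    and "\<And>\<epsilon>. \<epsilon> \<in> {0<..1} \<Longrightarrow> c_reg \<epsilon> \<in> Linf"
    and "\<And>\<epsilon>. \<epsilon> \<in> {0<..1} \<Longrightarrow> u0_reg \<epsilon> \<in> H1"
    and "((\<lambda>\<epsilon>. Linf_norm (\<lambda>x. a_reg \<epsilon> x - a x)) \<longlongrightarrow> 0) (at_right 0)"
    and "((\<lambda>\<epsilon>. Linf_norm (\<lambda>x. b_reg \<epsilon> x - b x)) \<longlongrightarrow> 0) (at_right 0)"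
    and "((\<lambda>\<epsilon>. Linf_norm (\<lambda>x. c_reg \<epsilon> x - c x)) \<longlongrightarrow> 0) (at_right 0)"
    and "((\<lambda>\<epsilon>. H1_norm (\<lambda>x. u0_reg \<epsilon> x - u0 x)) \<longlongrightarrow> 0) (at_right 0)"
    and "\<And>\<epsilon>. \<epsilon> \<in> {0<..1} \<Longrightarrow> AE x in lborel. a_reg \<epsilon> x \<ge> a0"
    and "\<And>\<epsilon>. \<epsilon> \<in> {0<..1} \<Longrightarrow> AE x in lborel. b_reg \<epsilon> x \<ge> b0"
    and "\<And>\<epsilon>. \<epsilon> \<in> {0<..1} \<Longrightarrow> AE x in lborel. c_reg \<epsilon> x \<ge> c0"
    and "\<And>\<epsilon>. \<epsilon> \<in> {0<..1} \<Longrightarrow>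
           weak_solution T s (a_reg \<epsilon>) (b_reg \<epsilon>) (c_reg \<epsilon>) (u0_reg \<epsilon>) (u_reg \<epsilon>)"
  shows "((\<lambda>\<epsilon>. C_L2_norm T (\<lambda>t x. u_reg \<epsilon> t x - u t x)) \<longlongrightarrow> 0) (at_right 0) \<and>
         ((\<lambda>\<epsilon>. bochner_L2_norm T H1_norm (\<lambda>t x. u_reg \<epsilon> t x - u t x)) \<longlongrightarrow> 0) (at_right 0)"
proof -
  note as = assms
  define k where "k = min a0 c0"
  have k: "0 < k" using as by (simp add: k_def)
  define \<delta>a where "\<delta>a \<epsilon> = max 0 (real_of_ereal (Linf_norm (\<lambda>x. a_reg \<epsilon> x - a x)))" for \<epsilon>
  define \<delta>b where "\<delta>b \<epsilon> = max 0 (real_of_ereal (Linf_norm (\<lambda>x. b_reg \<epsilon> x - b x)))" for \<epsilon>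
  define \<delta>c where "\<delta>c \<epsilon> = max 0 (real_of_ereal (Linf_norm (\<lambda>x. c_reg \<epsilon> x - c x)))" for \<epsilon>
  define \<delta> where "\<delta> \<epsilon> = max (\<delta>a \<epsilon>) (max (\<delta>b \<epsilon>) (\<delta>c \<epsilon>))" for \<epsilon>
  have lim0: "((\<lambda>\<epsilon>. max 0 (real_of_ereal (f \<epsilon>))) \<longlongrightarrow> 0) (at_right (0::real))" 
    if "(f \<longlongrightarrow> 0) (at_right 0)" for f :: "real \<Rightarrow> ereal"
  proof -
    have "((\<lambda>\<epsilon>. max 0 (real_of_ereal (f \<epsilon>))) \<longlongrightarrow> max 0 0) (at_right (0::real))"
      using that by (intro tendsto_intros lim_real_of_ereal) (simp add: zero_ereal_def)
    then show ?thesis by simp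
  qed
  have \<delta>0: "(\<delta> \<longlongrightarrow> 0) (at_right 0)"
  proof -
    have "(\<delta> \<longlongrightarrow> max 0 (max 0 0)) (at_right 0)"
      unfolding \<delta>_def \<delta>a_def \<delta>b_def \<delta>c_def by (intro tendsto_max lim0 as)
    then show ?thesis by simp
  qed
  define V where "V = (\<integral>t. (H1_norm (u t))\<^sup>2 \<partial>lebesgue_on {0<..<T})"
  \<comment> \<open>The stability bound with the L2 distance of the initial data enlarged to the H1
    distance, whose convergence is assumed. The integral \<open>V\<close> does not depend on
    \<epsilon>.\<close>
  define e where "e \<epsilon> = (H1_norm (\<lambda>x. u0_reg \<epsilon> x - u0 x))\<^sup>2 + (\<delta> \<epsilon> * (real DIM('a) + 2))\<^sup>2 / k * V" for \<epsilon>
  have "(e \<longlongrightarrow> 0\<^sup>2 + (0 * (real DIM('a) + 2))\<^sup>2 / k * V) (at_right 0)"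
    unfolding e_def using k by (intro tendsto_intros as \<delta>0) auto
  then have e0: "(e \<longlongrightarrow> 0) (at_right 0)" by simp
  obtain M1 M2 M3 where "coeff_le a M1" "coeff_le b M2" "coeff_le c M3"
    using Linf_coeff_le as(4-6) by metis
  then have el: "elliptic s a b c (max M1 (max M2 M3))"
    using as(2,3) by unfold_locales (auto elim!: coeff_le_mono)
  \<comment> \<open>The limits at 0 concern arbitrarily small positive \<epsilon> only: near 0 the
    index is admissible and all three extended real distances are finite.\<close>
  have "eventually (\<lambda>\<epsilon>. \<epsilon> \<in> {0<..<1::real}) (at_right 0)" by (rule eventually_at_right_real) simp
  moreover have "eventually (\<lambda>\<epsilon>. Linf_norm (\<lambda>x. a_reg \<epsilon> x - a x) < \<infinity>) (at_right 0)"
    "eventually (\<lambda>\<epsilon>. Linf_norm (\<lambda>x. b_reg \<epsilon> x - b x) < \<infinity>) (at_right 0)"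
    "eventually (\<lambda>\<epsilon>. Linf_norm (\<lambda>x. c_reg \<epsilon> x - c x) < \<infinity>) (at_right 0)"
    by (rule order_tendstoD(2)[OF as(19)], simp, rule order_tendstoD(2)[OF as(20)], simp, 
        rule order_tendstoD(2)[OF as(21)], simp)
  ultimately have ev: "eventually (\<lambda>\<epsilon>. (\<forall>t\<in>{0..T}. (L2_norm (\<lambda>x. u_reg \<epsilon> t x - u t x))\<^sup>2 \<le> e \<epsilon>) \<and>
     k * (bochner_L2_norm T H1_norm (\<lambda>t x. u_reg \<epsilon> t x - u t x))\<^sup>2 \<le> e \<epsilon>) (at_right 0)"
  proof eventually_elim
    case (elim \<epsilon>)
    then have \<epsilon>: "\<epsilon> \<in> {0<..1}" by simp
    obtain N1 N2 N3 where "coeff_le (a_reg \<epsilon>) N1" "coeff_le (b_reg \<epsilon>) N2" "coeff_le (c_reg \<epsilon>) N3"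
      using Linf_coeff_le as(15)[OF \<epsilon>] as(16)[OF \<epsilon>] as(17)[OF \<epsilon>] by metis
    then have el': "elliptic s (a_reg \<epsilon>) (b_reg \<epsilon>) (c_reg \<epsilon>) (max N1 (max N2 N3))"
      using as(2,3) by unfold_locales (auto elim!: coeff_le_mono)
    have "coeff_le (\<lambda>x. a_reg \<epsilon> x - a x) (\<delta>a \<epsilon>)" "coeff_le (\<lambda>x. b_reg \<epsilon> x - b x) (\<delta>b \<epsilon>)" 
      "coeff_le (\<lambda>x. c_reg \<epsilon> x - c x) (\<delta>c \<epsilon>)"
      unfolding \<delta>a_def \<delta>b_def \<delta>c_def using elim as(4-6) as(15-17)[OF \<epsilon>] by (auto intro!: Linf_diff_real)
    then have eld: "elliptic s (\<lambda>x. a_reg \<epsilon> x - a x) (\<lambda>x. b_reg \<epsilon> x - b x) (\<lambda>x. c_reg \<epsilon> x - c x) (\<delta> \<epsilon>)"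
      using as(2,3) by unfold_locales (auto elim!: coeff_le_mono simp: \<delta>_def)
    interpret two_solutions s a b c "a_reg \<epsilon>" "b_reg \<epsilon>" "c_reg \<epsilon>" "max M1 (max M2 M3)" "max N1 (max N2 N3)" "\<delta> \<epsilon>" 
      T k u0 "u0_reg \<epsilon>" u "u_reg \<epsilon>"
    proof (intro two_solutions.intro el el' eld two_solutions_axioms.intro)
      show "AE x in lborel. k \<le> a_reg \<epsilon> x" using as(23)[OF \<epsilon>] by eventually_elim (simp add: k_def)
      show "AE x in lborel. k \<le> c_reg \<epsilon> x" using as(25)[OF \<epsilon>] by eventually_elim (simp add: k_def)
      show "AE x in lborel. 0 \<le> b_reg \<epsilon> x" using as(24)[OF \<epsilon>] by eventually_elim (use as(8) in simp)
    qed (use as k as(18)[OF \<epsilon>] as(26)[OF \<epsilon>] in \<open>auto intro: H1_D\<close>)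
    have "(L2_norm (\<lambda>x. u0_reg \<epsilon> x - u0 x))\<^sup>2 \<le> (H1_norm (\<lambda>x. u0_reg \<epsilon> x - u0 x))\<^sup>2"
      by (intro power_mono L2_norm_le_H1_norm) simp
    then have "bound \<le> e \<epsilon>" by (simp add: bound_def e_def V_def)
    then show ?case using stability by (meson order_trans)
  qed
  have "((\<lambda>\<epsilon>. sqrt (e \<epsilon>)) \<longlongrightarrow> sqrt 0) (at_right 0)" "((\<lambda>\<epsilon>. sqrt (e \<epsilon> / k)) \<longlongrightarrow> sqrt (0 / k)) (at_right 0)"
    using k by (intro tendsto_intros e0; simp)+
  then have s1: "((\<lambda>\<epsilon>. sqrt (e \<epsilon>)) \<longlongrightarrow> 0) (at_right 0)" and s2: "((\<lambda>\<epsilon>. sqrt (e \<epsilon> / k)) \<longlongrightarrow> 0) (at_right 0)"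
    by simp_all
  show ?thesis
  proof
    show "((\<lambda>\<epsilon>. C_L2_norm T (\<lambda>t x. u_reg \<epsilon> t x - u t x)) \<longlongrightarrow> 0) (at_right 0)"
    proof (rule Lim_null_comparison[OF _ s1])
      show "\<forall>\<^sub>F \<epsilon> in at_right 0. norm (C_L2_norm T (\<lambda>t x. u_reg \<epsilon> t x - u t x)) \<le> sqrt (e \<epsilon>)"
        using ev
      proof eventually_elim
        case (elim \<epsilon>)
        let ?f = "\<lambda>t. L2_norm (\<lambda>x. u_reg \<epsilon> t x - u t x)"
        have le: "?f t \<le> sqrt (e \<epsilon>)" if "t \<in> {0..T}" for t using elim that by (intro real_le_rsqrt) auto
        have "(SUP t\<in>{0..T}. ?f t) \<le> sqrt (e \<epsilon>)" using as(1) by (intro cSUP_least le) auto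
        \<comment> \<open>A real supremum dominates its members only for sets bounded above, so the
          bound \<open>le\<close> is used here as well; t = 0 serves as the member.\<close>
        moreover have "0 \<le> (SUP t\<in>{0..T}. ?f t)"
          by (rule cSUP_upper2[of _ _ 0]) (use as(1) le in \<open>auto intro!: bdd_aboveI2[of _ _ "sqrt (e \<epsilon>)"]\<close>)
        ultimately show ?case by (simp add: C_L2_norm_def)
      qed
    qed
    show "((\<lambda>\<epsilon>. bochner_L2_norm T H1_norm (\<lambda>t x. u_reg \<epsilon> t x - u t x)) \<longlongrightarrow> 0) (at_right 0)"
    proof (rule Lim_null_comparison[OF _ s2])
      show "\<forall>\<^sub>F \<epsilon> in at_right 0. norm (bochner_L2_norm T H1_norm (\<lambda>t x. u_reg \<epsilon> t x - u t x)) \<le> sqrt (e \<epsilon> / k)"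
        using ev
      proof eventually_elim
        case (elim \<epsilon>)
        let ?n = "bochner_L2_norm T H1_norm (\<lambda>t x. u_reg \<epsilon> t x - u t x)"
        have "0 \<le> ?n" by (simp add: bochner_L2_norm_def)
        moreover have "?n \<le> sqrt (e \<epsilon> / k)"
          using elim k by (intro real_le_rsqrt) (simp add: le_divide_eq mult.commute)
        ultimately show ?case by simp
      qed
    qed
  qed
qed

end
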